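(* Let $(\mathcal{M},\otimes,\mathbf{1},\sigma)$ be an abelian symmetric monoidal category that satisfies the faithful coflatness condition. The following facts hold in $\mathsf{Hopf}_{\mathrm{coc}}(\mathcal{M})$: 1) regular epimorphisms in $\mathsf{Hopf}_{\mathrm{coc}}(\mathcal{M})$ (equivalently, cokernels in $\mathsf{Hopf}_{\mathrm{coc}}(\mathcal{M})$) coincide with the morphisms in $\mathsf{Hopf}_{\mathrm{coc}}(\mathcal{M})$ that are epimorphisms in $\mathcal{M}$; 2) monomorphisms in $\mathsf{Hopf}_{\mathrm{coc}}(\mathcal{M})$ are exactly the morphisms in $\mathsf{Hopf}_{\mathrm{coc}}(\mathcal{M})$ that are monomorphisms in $\mathcal{M}$.
   Context: Associativity and unit constraints are suppressed. An abelian symmetric monoidal category is a symmetric monoidal category $(\mathcal{M},\otimes,\mathbf{1},\sigma)$ such that $\mathcal{M}$ is abelian and, for every object $M$, the functors $M\otimes(-)$ and $(-)\otimes M$ are additive and exact. $\mathsf{Hopf}_{\mathrm{coc}}(\mathcal{M})$ is the category of Hopf monoids $(A,m_A,u_A,\Delta_A,\varepsilon_A,S_A)$ in $\mathcal{M}$ with $\sigma_{A,A}\Delta_A=\Delta_A$ and Hopf monoid morphisms; it is pointed with zero object $\mathbf{1}$. $\mathsf{Comon}_{\mathrm{coc}}({}_A\mathcal{M})$, for $A$ in $\mathsf{Hopf}_{\mathrm{coc}}(\mathcal{M})$: objects are cocommutative comonoids $Q$ in $\mathcal{M}$ with a left $A$-action $\mu_Q$ such that $\Delta_Q,\varepsilon_Q$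 are left $A$-linear, where $Q\otimes Q$ has action $(\mu_Q\otimes\mu_Q)(\mathrm{Id}_A\otimes\sigma_{A,Q}\otimes\mathrm{Id}_Q)(\Delta_A\otimes\mathrm{Id}_{Q\otimes Q})$ and $\mathbf{1}$ has action $\varepsilon_A$; morphisms are left $A$-linear comonoid morphisms; $A$ is an object of it via $m_A$. For a right $Q$-comodule $(V,\rho_V)$ and a left $Q$-comodule $(W,\lambda_W)$, $V\square_Q W$ is the equalizer in $\mathcal{M}$ of $\rho_V\otimes\mathrm{Id}_W,\ \mathrm{Id}_V\otimes\lambda_W: V\otimes W\to V\otimes Q\otimes W$; this gives functors $(-)\square_Q W:\mathcal{M}^Q\to\mathcal{M}$ from right $Q$-comodules. Faithful coflatness condition: for any $A$ in $\mathsf{Hopf}_{\mathrm{coc}}(\mathcal{M})$ and any morphism $\pi:A\to Q$ in $\mathsf{Comon}_{\mathrm{coc}}({}_A\mathcal{M})$ which is an epimorphism in $\mathcal{M}$, the functor $(-)\square_Q A$ preserves and reflects epimorphisms, where $A$ is a left $Q$-comodule via $(\pi\otimes\mathrm{Id}_A)\Delta_A$. *)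

theory Defs
  imports "HOL-Algebra.Group"
begin

section \<open>Categories\<close>

text \<open>
  Objects form a set \<open>Obj C\<close>; \<open>Hom C A B\<close> is the set of morphisms \<open>A \<rightarrow> B\<close>. Hom-sets
  are not required to be disjoint, so that a structured morphism can be represented by its
  underlying morphism. A notion applied to a morphism therefore takes its domain and codomain as
  arguments. Nothing is assumed about \<open>Hom C A B\<close> unless \<open>A\<close> and \<open>B\<close> are in \<open>Obj C\<close>.
\<close>

record ('o, 'm) cat =
  Obj :: "'o set"
  Hom :: "'o \<Rightarrow> 'o \<Rightarrow> 'm set"
  Id :: "'o \<Rightarrow> 'm"
  Comp :: "'m \<Rightarrow> 'm \<Rightarrow> 'm"  (infixr "\<cdot>\<index>" 55)

locale category =
  fixes C :: "('o, 'm, 'z) cat_scheme" (structure)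
  assumes Id_in_Hom: "A \<in> Obj C \<Longrightarrow> Id C A \<in> Hom C A A"
    and Comp_in_Hom: "\<lbrakk>A \<in> Obj C; B \<in> Obj C; D \<in> Obj C; f \<in> Hom C A B; g \<in> Hom C B D\<rbrakk>
      \<Longrightarrow> g \<cdot> f \<in> Hom C A D"
    and Comp_Id_left: "\<lbrakk>A \<in> Obj C; B \<in> Obj C; f \<in> Hom C A B\<rbrakk> \<Longrightarrow> Id C B \<cdot> f = f"
    and Comp_Id_right: "\<lbrakk>A \<in> Obj C; B \<in> Obj C; f \<in> Hom C A B\<rbrakk> \<Longrightarrow> f \<cdot> Id C A = f"
    and Comp_assoc: "\<lbrakk>A \<in> Obj C; B \<in> Obj C; D \<in> Obj C; E \<in> Obj C;
        f \<in> Hom C A B; g \<in> Hom C B D; h \<in> Hom C D E\<rbrakk> \<Longrightarrow> (h \<cdot> g) \<cdot> f = h \<cdot> (g \<cdot> f)"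

definition inverse_arrows :: "('o, 'm, 'z) cat_scheme \<Rightarrow> 'o \<Rightarrow> 'o \<Rightarrow> 'm \<Rightarrow> 'm \<Rightarrow> bool" where
  "inverse_arrows C A B f g \<longleftrightarrow>
     f \<in> Hom C A B \<and> g \<in> Hom C B A \<and> g \<cdot> f = Id C A \<and> f \<cdot> g = Id C B"
  for C (structure)

definition iso_arrow :: "('o, 'm, 'z) cat_scheme \<Rightarrow> 'o \<Rightarrow> 'o \<Rightarrow> 'm \<Rightarrow> bool" where
  "iso_arrow C A B f \<longleftrightarrow> (\<exists>g. inverse_arrows C A B f g)"

definition inv_arrow :: "('o, 'm, 'z) cat_scheme \<Rightarrow> 'o \<Rightarrow> 'o \<Rightarrow> 'm \<Rightarrow> 'm" where
  "inv_arrow C A B f = (THE g. inverse_arrows C A B f g)"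

definition monic :: "('o, 'm, 'z) cat_scheme \<Rightarrow> 'o \<Rightarrow> 'o \<Rightarrow> 'm \<Rightarrow> bool" where
  "monic C A B f \<longleftrightarrow> f \<in> Hom C A B \<and>
     (\<forall>X\<in>Obj C. \<forall>g\<in>Hom C X A. \<forall>h\<in>Hom C X A. f \<cdot> g = f \<cdot> h \<longrightarrow> g = h)"
  for C (structure)

definition epic :: "('o, 'm, 'z) cat_scheme \<Rightarrow> 'o \<Rightarrow> 'o \<Rightarrow> 'm \<Rightarrow> bool" where
  "epic C A B f \<longleftrightarrow> f \<in> Hom C A B \<and>
     (\<forall>X\<in>Obj C. \<forall>g\<in>Hom C B X. \<forall>h\<in>Hom C B X. g \<cdot> f = h \<cdot> f \<longrightarrow> g = h)"
  for C (structure)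

definition equalizer ::
    "('o, 'm, 'z) cat_scheme \<Rightarrow> 'o \<Rightarrow> 'o \<Rightarrow> 'm \<Rightarrow> 'm \<Rightarrow> 'o \<Rightarrow> 'm \<Rightarrow> bool" where
  "equalizer C A B f g E e \<longleftrightarrow>
     f \<in> Hom C A B \<and> g \<in> Hom C A B \<and> E \<in> Obj C \<and> e \<in> Hom C E A \<and> f \<cdot> e = g \<cdot> e \<and>
     (\<forall>X\<in>Obj C. \<forall>x\<in>Hom C X A. f \<cdot> x = g \<cdot> x \<longrightarrow> (\<exists>!t. t \<in> Hom C X E \<and> e \<cdot> t = x))"
  for C (structure)

definition coequalizer ::
    "('o, 'm, 'z) cat_scheme \<Rightarrow> 'o \<Rightarrow> 'o \<Rightarrow> 'm \<Rightarrow> 'm \<Rightarrow> 'o \<Rightarrow> 'm \<Rightarrow> bool" where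
  "coequalizer C A B f g Q q \<longleftrightarrow>
     f \<in> Hom C A B \<and> g \<in> Hom C A B \<and> Q \<in> Obj C \<and> q \<in> Hom C B Q \<and> q \<cdot> f = q \<cdot> g \<and>
     (\<forall>X\<in>Obj C. \<forall>x\<in>Hom C B X. x \<cdot> f = x \<cdot> g \<longrightarrow> (\<exists>!t. t \<in> Hom C Q X \<and> t \<cdot> q = x))"
  for C (structure)

definition zero_object :: "('o, 'm, 'z) cat_scheme \<Rightarrow> 'o \<Rightarrow> bool" where
  "zero_object C Z \<longleftrightarrow>
     Z \<in> Obj C \<and> (\<forall>A\<in>Obj C. (\<exists>!f. f \<in> Hom C Z A) \<and> (\<exists>!f. f \<in> Hom C A Z))"

definition zero_arrow :: "('o, 'm, 'z) cat_scheme \<Rightarrow> 'o \<Rightarrow> 'o \<Rightarrow> 'm \<Rightarrow> bool" where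
  "zero_arrow C A B z \<longleftrightarrow>
     (\<exists>Z f g. zero_object C Z \<and> f \<in> Hom C A Z \<and> g \<in> Hom C Z B \<and> z = g \<cdot> f)"
  for C (structure)

definition kernel ::
    "('o, 'm, 'z) cat_scheme \<Rightarrow> 'o \<Rightarrow> 'o \<Rightarrow> 'm \<Rightarrow> 'o \<Rightarrow> 'm \<Rightarrow> bool" where
  "kernel C A B f K k \<longleftrightarrow> (\<exists>z. zero_arrow C A B z \<and> equalizer C A B f z K k)"

definition cokernel ::
    "('o, 'm, 'z) cat_scheme \<Rightarrow> 'o \<Rightarrow> 'o \<Rightarrow> 'm \<Rightarrow> 'o \<Rightarrow> 'm \<Rightarrow> bool" where
  "cokernel C A B f Q q \<longleftrightarrow> (\<exists>z. zero_arrow C A B z \<and> coequalizer C A B f z Q q)"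

definition is_kernel :: "('o, 'm, 'z) cat_scheme \<Rightarrow> 'o \<Rightarrow> 'o \<Rightarrow> 'm \<Rightarrow> bool" where
  "is_kernel C K A k \<longleftrightarrow> (\<exists>B\<in>Obj C. \<exists>f\<in>Hom C A B. kernel C A B f K k)"

definition is_cokernel :: "('o, 'm, 'z) cat_scheme \<Rightarrow> 'o \<Rightarrow> 'o \<Rightarrow> 'm \<Rightarrow> bool" where
  "is_cokernel C B Q q \<longleftrightarrow> (\<exists>A\<in>Obj C. \<exists>f\<in>Hom C A B. cokernel C A B f Q q)"

definition regular_epi :: "('o, 'm, 'z) cat_scheme \<Rightarrow> 'o \<Rightarrow> 'o \<Rightarrow> 'm \<Rightarrow> bool" where
  "regular_epi C B Q q \<longleftrightarrow>
     (\<exists>A\<in>Obj C. \<exists>f\<in>Hom C A B. \<exists>g\<in>Hom C A B. coequalizer C A B f g Q q)"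

definition preserves_epis ::
    "('o, 'm, 'z) cat_scheme \<Rightarrow> ('p, 'n, 'y) cat_scheme \<Rightarrow> ('o \<Rightarrow> 'p) \<Rightarrow> ('o \<Rightarrow> 'o \<Rightarrow> 'm \<Rightarrow> 'n) \<Rightarrow> bool"
  where
  "preserves_epis C D Fo Fm \<longleftrightarrow> (\<forall>A\<in>Obj C. \<forall>B\<in>Obj C. \<forall>f\<in>Hom C A B.
     epic C A B f \<longrightarrow> epic D (Fo A) (Fo B) (Fm A B f))"

definition reflects_epis ::
    "('o, 'm, 'z) cat_scheme \<Rightarrow> ('p, 'n, 'y) cat_scheme \<Rightarrow> ('o \<Rightarrow> 'p) \<Rightarrow> ('o \<Rightarrow> 'o \<Rightarrow> 'm \<Rightarrow> 'n) \<Rightarrow> bool"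
  where
  "reflects_epis C D Fo Fm \<longleftrightarrow> (\<forall>A\<in>Obj C. \<forall>B\<in>Obj C. \<forall>f\<in>Hom C A B.
     epic D (Fo A) (Fo B) (Fm A B f) \<longrightarrow> epic C A B f)"


section \<open>Abelian categories\<close>

record ('o, 'm) add_cat = "('o, 'm) cat" +
  Add :: "'o \<Rightarrow> 'o \<Rightarrow> 'm \<Rightarrow> 'm \<Rightarrow> 'm"
  Zero :: "'o \<Rightarrow> 'o \<Rightarrow> 'm"

locale preadditive_category = category C
  for C :: "('o, 'm, 'z) add_cat_scheme" (structure) +
  assumes Hom_comm_group: "\<lbrakk>A \<in> Obj C; B \<in> Obj C\<rbrakk>
      \<Longrightarrow> comm_group \<lparr>carrier = Hom C A B, monoid.mult = Add C A B, one = Zero C A B\<rparr>"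
    and Comp_Add_right: "\<lbrakk>A \<in> Obj C; B \<in> Obj C; D \<in> Obj C;
        f \<in> Hom C A B; g \<in> Hom C A B; h \<in> Hom C B D\<rbrakk>
      \<Longrightarrow> h \<cdot> Add C A B f g = Add C A D (h \<cdot> f) (h \<cdot> g)"
    and Comp_Add_left: "\<lbrakk>A \<in> Obj C; B \<in> Obj C; D \<in> Obj C;
        f \<in> Hom C A B; g \<in> Hom C B D; h \<in> Hom C B D\<rbrakk>
      \<Longrightarrow> Add C B D g h \<cdot> f = Add C A D (g \<cdot> f) (h \<cdot> f)"

definition biproduct ::
    "('o, 'm, 'z) add_cat_scheme \<Rightarrow> 'o \<Rightarrow> 'o \<Rightarrow> 'o \<Rightarrow> 'm \<Rightarrow> 'm \<Rightarrow> 'm \<Rightarrow> 'm \<Rightarrow> bool" where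
  "biproduct C A B P i j p q \<longleftrightarrow>
     P \<in> Obj C \<and> i \<in> Hom C A P \<and> j \<in> Hom C B P \<and> p \<in> Hom C P A \<and> q \<in> Hom C P B \<and>
     p \<cdot> i = Id C A \<and> q \<cdot> j = Id C B \<and> p \<cdot> j = Zero C B A \<and> q \<cdot> i = Zero C A B \<and>
     Add C P P (i \<cdot> p) (j \<cdot> q) = Id C P"
  for C (structure)

locale abelian_category = preadditive_category C
  for C :: "('o, 'm, 'z) add_cat_scheme" (structure) +
  assumes ex_zero_object: "\<exists>Z. zero_object C Z"
    and ex_biproduct: "\<lbrakk>A \<in> Obj C; B \<in> Obj C\<rbrakk> \<Longrightarrow> \<exists>P i j p q. biproduct C A B P i j p q"
    and ex_kernel: "\<lbrakk>A \<in> Obj C; B \<in> Obj C; f \<in> Hom C A B\<rbrakk> \<Longrightarrow> \<exists>K k. kernel C A B f K k"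
    and ex_cokernel: "\<lbrakk>A \<in> Obj C; B \<in> Obj C; f \<in> Hom C A B\<rbrakk> \<Longrightarrow> \<exists>Q q. cokernel C A B f Q q"
    and monic_is_kernel: "\<lbrakk>A \<in> Obj C; B \<in> Obj C; monic C A B f\<rbrakk> \<Longrightarrow> is_kernel C A B f"
    and epic_is_cokernel: "\<lbrakk>A \<in> Obj C; B \<in> Obj C; epic C A B f\<rbrakk> \<Longrightarrow> is_cokernel C A B f"

definition short_exact ::
    "('o, 'm, 'z) cat_scheme \<Rightarrow> 'o \<Rightarrow> 'o \<Rightarrow> 'o \<Rightarrow> 'm \<Rightarrow> 'm \<Rightarrow> bool" where
  "short_exact C A B D f g \<longleftrightarrow> kernel C B D g A f \<and> cokernel C A B f D g"

text \<open>The functors below are endofunctors whose action on a morphism does not mention its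
  domain and codomain, such as \<open>M \<otimes> (-)\<close>.\<close>

definition additive_endofunctor ::
    "('o, 'm, 'z) add_cat_scheme \<Rightarrow> ('o \<Rightarrow> 'o) \<Rightarrow> ('m \<Rightarrow> 'm) \<Rightarrow> bool" where
  "additive_endofunctor C Fo Fm \<longleftrightarrow>
     (\<forall>A\<in>Obj C. \<forall>B\<in>Obj C. \<forall>f\<in>Hom C A B. \<forall>g\<in>Hom C A B.
        Fm (Add C A B f g) = Add C (Fo A) (Fo B) (Fm f) (Fm g))"

definition exact_endofunctor ::
    "('o, 'm, 'z) cat_scheme \<Rightarrow> ('o \<Rightarrow> 'o) \<Rightarrow> ('m \<Rightarrow> 'm) \<Rightarrow> bool" where
  "exact_endofunctor C Fo Fm \<longleftrightarrow>
     (\<forall>A\<in>Obj C. \<forall>B\<in>Obj C. \<forall>D\<in>Obj C. \<forall>f\<in>Hom C A B. \<forall>g\<in>Hom C B D.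
        short_exact C A B D f g \<longrightarrow> short_exact C (Fo A) (Fo B) (Fo D) (Fm f) (Fm g))"


section \<open>Abelian symmetric monoidal categories\<close>

text \<open>
  The monoidal structure is not assumed to be strict: \<open>assoc M A B D : (A \<otimes> B) \<otimes> D \<rightarrow> A \<otimes> (B \<otimes> D)\<close>,
  \<open>lunit M A : \<one> \<otimes> A \<rightarrow> A\<close> and \<open>runit M A : A \<otimes> \<one> \<rightarrow> A\<close> are the constraints, and
  \<open>braid M A B : A \<otimes> B \<rightarrow> B \<otimes> A\<close> is the symmetry.
\<close>

record ('o, 'm) asm_cat = "('o, 'm) add_cat" +
  tensor_obj :: "'o \<Rightarrow> 'o \<Rightarrow> 'o"  (infixr "\<otimes>\<^sub>o\<index>" 70)
  tensor_arr :: "'m \<Rightarrow> 'm \<Rightarrow> 'm"  (infixr "\<otimes>\<^sub>m\<index>" 70)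
  unit_obj :: 'o  ("\<one>\<^sub>o\<index>")
  assoc :: "'o \<Rightarrow> 'o \<Rightarrow> 'o \<Rightarrow> 'm"
  lunit :: "'o \<Rightarrow> 'm"
  runit :: "'o \<Rightarrow> 'm"
  braid :: "'o \<Rightarrow> 'o \<Rightarrow> 'm"

locale symmetric_monoidal_category = category M
  for M :: "('o, 'm, 'z) asm_cat_scheme" (structure) +
  assumes unit_Obj: "\<one>\<^sub>o \<in> Obj M"
    and tensor_Obj: "\<lbrakk>A \<in> Obj M; B \<in> Obj M\<rbrakk> \<Longrightarrow> A \<otimes>\<^sub>o B \<in> Obj M"
    and tensor_Hom: "\<lbrakk>A \<in> Obj M; B \<in> Obj M; A' \<in> Obj M; B' \<in> Obj M;
        f \<in> Hom M A A'; g \<in> Hom M B B'\<rbrakk> \<Longrightarrow> f \<otimes>\<^sub>m g \<in> Hom M (A \<otimes>\<^sub>o B) (A' \<otimes>\<^sub>o B')"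
    and tensor_Id: "\<lbrakk>A \<in> Obj M; B \<in> Obj M\<rbrakk> \<Longrightarrow> Id M A \<otimes>\<^sub>m Id M B = Id M (A \<otimes>\<^sub>o B)"
    and tensor_Comp: "\<lbrakk>A \<in> Obj M; A' \<in> Obj M; A'' \<in> Obj M; B \<in> Obj M; B' \<in> Obj M; B'' \<in> Obj M;
        f \<in> Hom M A A'; f' \<in> Hom M A' A''; g \<in> Hom M B B'; g' \<in> Hom M B' B''\<rbrakk>
      \<Longrightarrow> (f' \<cdot> f) \<otimes>\<^sub>m (g' \<cdot> g) = (f' \<otimes>\<^sub>m g') \<cdot> (f \<otimes>\<^sub>m g)"
    and assoc_iso: "\<lbrakk>A \<in> Obj M; B \<in> Obj M; D \<in> Obj M\<rbrakk>
      \<Longrightarrow> iso_arrow M ((A \<otimes>\<^sub>o B) \<otimes>\<^sub>o D) (A \<otimes>\<^sub>o (B \<otimes>\<^sub>o D)) (assoc M A B D)"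
    and lunit_iso: "A \<in> Obj M \<Longrightarrow> iso_arrow M (\<one>\<^sub>o \<otimes>\<^sub>o A) A (lunit M A)"
    and runit_iso: "A \<in> Obj M \<Longrightarrow> iso_arrow M (A \<otimes>\<^sub>o \<one>\<^sub>o) A (runit M A)"
    and braid_Hom: "\<lbrakk>A \<in> Obj M; B \<in> Obj M\<rbrakk> \<Longrightarrow> braid M A B \<in> Hom M (A \<otimes>\<^sub>o B) (B \<otimes>\<^sub>o A)"
    and assoc_natural: "\<lbrakk>A \<in> Obj M; A' \<in> Obj M; B \<in> Obj M; B' \<in> Obj M; D \<in> Obj M; D' \<in> Obj M;
        f \<in> Hom M A A'; g \<in> Hom M B B'; h \<in> Hom M D D'\<rbrakk>
      \<Longrightarrow> assoc M A' B' D' \<cdot> ((f \<otimes>\<^sub>m g) \<otimes>\<^sub>m h) = (f \<otimes>\<^sub>m (g \<otimes>\<^sub>m h)) \<cdot> assoc M A B D"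
    and lunit_natural: "\<lbrakk>A \<in> Obj M; A' \<in> Obj M; f \<in> Hom M A A'\<rbrakk>
      \<Longrightarrow> lunit M A' \<cdot> (Id M \<one>\<^sub>o \<otimes>\<^sub>m f) = f \<cdot> lunit M A"
    and runit_natural: "\<lbrakk>A \<in> Obj M; A' \<in> Obj M; f \<in> Hom M A A'\<rbrakk>
      \<Longrightarrow> runit M A' \<cdot> (f \<otimes>\<^sub>m Id M \<one>\<^sub>o) = f \<cdot> runit M A"
    and braid_natural: "\<lbrakk>A \<in> Obj M; A' \<in> Obj M; B \<in> Obj M; B' \<in> Obj M;
        f \<in> Hom M A A'; g \<in> Hom M B B'\<rbrakk>
      \<Longrightarrow> braid M A' B' \<cdot> (f \<otimes>\<^sub>m g) = (g \<otimes>\<^sub>m f) \<cdot> braid M A B"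
    and pentagon: "\<lbrakk>A \<in> Obj M; B \<in> Obj M; D \<in> Obj M; E \<in> Obj M\<rbrakk>
      \<Longrightarrow> (Id M A \<otimes>\<^sub>m assoc M B D E) \<cdot> assoc M A (B \<otimes>\<^sub>o D) E \<cdot> (assoc M A B D \<otimes>\<^sub>m Id M E)
        = assoc M A B (D \<otimes>\<^sub>o E) \<cdot> assoc M (A \<otimes>\<^sub>o B) D E"
    and triangle: "\<lbrakk>A \<in> Obj M; B \<in> Obj M\<rbrakk>
      \<Longrightarrow> (Id M A \<otimes>\<^sub>m lunit M B) \<cdot> assoc M A \<one>\<^sub>o B = runit M A \<otimes>\<^sub>m Id M B"
    and hexagon: "\<lbrakk>A \<in> Obj M; B \<in> Obj M; D \<in> Obj M\<rbrakk>
      \<Longrightarrow> assoc M B D A \<cdot> braid M A (B \<otimes>\<^sub>o D) \<cdot> assoc M A B D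
        = (Id M B \<otimes>\<^sub>m braid M A D) \<cdot> assoc M B A D \<cdot> (braid M A B \<otimes>\<^sub>m Id M D)"
    and braid_symmetric: "\<lbrakk>A \<in> Obj M; B \<in> Obj M\<rbrakk> \<Longrightarrow> braid M B A \<cdot> braid M A B = Id M (A \<otimes>\<^sub>o B)"

locale abelian_symmetric_monoidal_category =
  abelian_category M + symmetric_monoidal_category M
  for M :: "('o, 'm, 'z) asm_cat_scheme" (structure) +
  assumes tensor_left_additive:
      "X \<in> Obj M \<Longrightarrow> additive_endofunctor M (\<lambda>A. X \<otimes>\<^sub>o A) (\<lambda>f. Id M X \<otimes>\<^sub>m f)"
    and tensor_right_additive:
      "X \<in> Obj M \<Longrightarrow> additive_endofunctor M (\<lambda>A. A \<otimes>\<^sub>o X) (\<lambda>f. f \<otimes>\<^sub>m Id M X)"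
    and tensor_left_exact:
      "X \<in> Obj M \<Longrightarrow> exact_endofunctor M (\<lambda>A. X \<otimes>\<^sub>o A) (\<lambda>f. Id M X \<otimes>\<^sub>m f)"
    and tensor_right_exact:
      "X \<in> Obj M \<Longrightarrow> exact_endofunctor M (\<lambda>A. A \<otimes>\<^sub>o X) (\<lambda>f. f \<otimes>\<^sub>m Id M X)"

definition inv_assoc :: "('o, 'm, 'z) asm_cat_scheme \<Rightarrow> 'o \<Rightarrow> 'o \<Rightarrow> 'o \<Rightarrow> 'm" where
  "inv_assoc M A B D = inv_arrow M ((A \<otimes>\<^sub>o B) \<otimes>\<^sub>o D) (A \<otimes>\<^sub>o (B \<otimes>\<^sub>o D)) (assoc M A B D)"
  for M (structure)

text \<open>\<open>Id \<otimes> \<sigma> \<otimes> Id : (A \<otimes> B) \<otimes> (D \<otimes> E) \<rightarrow> (A \<otimes> D) \<otimes> (B \<otimes> E)\<close> with its constraints written out.\<close>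

definition middle_swap :: "('o, 'm, 'z) asm_cat_scheme \<Rightarrow> 'o \<Rightarrow> 'o \<Rightarrow> 'o \<Rightarrow> 'o \<Rightarrow> 'm" where
  "middle_swap M A B D E =
     inv_assoc M A D (B \<otimes>\<^sub>o E) \<cdot> (Id M A \<otimes>\<^sub>m assoc M D B E) \<cdot>
     (Id M A \<otimes>\<^sub>m (braid M B D \<otimes>\<^sub>m Id M E)) \<cdot>
     (Id M A \<otimes>\<^sub>m inv_assoc M B D E) \<cdot> assoc M A B (D \<otimes>\<^sub>o E)"
  for M (structure)


section \<open>Comonoids and Hopf monoids\<close>

record ('o, 'm) comon =
  ob :: 'o
  comult :: 'm
  counit :: 'm

definition comonoid :: "('o, 'm, 'z) asm_cat_scheme \<Rightarrow> ('o, 'm, 'y) comon_scheme \<Rightarrow> bool" where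
  "comonoid M Q \<longleftrightarrow>
     ob Q \<in> Obj M \<and> comult Q \<in> Hom M (ob Q) (ob Q \<otimes>\<^sub>o ob Q) \<and> counit Q \<in> Hom M (ob Q) \<one>\<^sub>o \<and>
     assoc M (ob Q) (ob Q) (ob Q) \<cdot> (comult Q \<otimes>\<^sub>m Id M (ob Q)) \<cdot> comult Q
       = (Id M (ob Q) \<otimes>\<^sub>m comult Q) \<cdot> comult Q \<and>
     lunit M (ob Q) \<cdot> (counit Q \<otimes>\<^sub>m Id M (ob Q)) \<cdot> comult Q = Id M (ob Q) \<and>
     runit M (ob Q) \<cdot> (Id M (ob Q) \<otimes>\<^sub>m counit Q) \<cdot> comult Q = Id M (ob Q)"
  for M (structure)

definition cocommutative :: "('o, 'm, 'z) asm_cat_scheme \<Rightarrow> ('o, 'm, 'y) comon_scheme \<Rightarrow> bool" where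
  "cocommutative M Q \<longleftrightarrow> braid M (ob Q) (ob Q) \<cdot> comult Q = comult Q"
  for M (structure)

definition comonoid_morphism ::
    "('o, 'm, 'z) asm_cat_scheme \<Rightarrow> ('o, 'm, 'y) comon_scheme \<Rightarrow> ('o, 'm, 'x) comon_scheme \<Rightarrow> 'm \<Rightarrow> bool" where
  "comonoid_morphism M P Q f \<longleftrightarrow> f \<in> Hom M (ob P) (ob Q) \<and>
     comult Q \<cdot> f = (f \<otimes>\<^sub>m f) \<cdot> comult P \<and> counit Q \<cdot> f = counit P"
  for M (structure)

record ('o, 'm) hopf_data = "('o, 'm) comon" +
  mmult :: 'm
  munit :: 'm
  antipode :: 'm

definition monoid_object :: "('o, 'm, 'z) asm_cat_scheme \<Rightarrow> ('o, 'm, 'y) hopf_data_scheme \<Rightarrow> bool" where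
  "monoid_object M A \<longleftrightarrow>
     ob A \<in> Obj M \<and> mmult A \<in> Hom M (ob A \<otimes>\<^sub>o ob A) (ob A) \<and> munit A \<in> Hom M \<one>\<^sub>o (ob A) \<and>
     mmult A \<cdot> (mmult A \<otimes>\<^sub>m Id M (ob A))
       = mmult A \<cdot> (Id M (ob A) \<otimes>\<^sub>m mmult A) \<cdot> assoc M (ob A) (ob A) (ob A) \<and>
     mmult A \<cdot> (munit A \<otimes>\<^sub>m Id M (ob A)) = lunit M (ob A) \<and>
     mmult A \<cdot> (Id M (ob A) \<otimes>\<^sub>m munit A) = runit M (ob A)"
  for M (structure)

definition monoid_morphism ::
    "('o, 'm, 'z) asm_cat_scheme \<Rightarrow> ('o, 'm, 'y) hopf_data_scheme \<Rightarrow> ('o, 'm, 'x) hopf_data_scheme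
      \<Rightarrow> 'm \<Rightarrow> bool" where
  "monoid_morphism M A B f \<longleftrightarrow> f \<in> Hom M (ob A) (ob B) \<and>
     f \<cdot> mmult A = mmult B \<cdot> (f \<otimes>\<^sub>m f) \<and> f \<cdot> munit A = munit B"
  for M (structure)

definition bimonoid :: "('o, 'm, 'z) asm_cat_scheme \<Rightarrow> ('o, 'm, 'y) hopf_data_scheme \<Rightarrow> bool" where
  "bimonoid M A \<longleftrightarrow> monoid_object M A \<and> comonoid M A \<and>
     comult A \<cdot> mmult A
       = (mmult A \<otimes>\<^sub>m mmult A) \<cdot> middle_swap M (ob A) (ob A) (ob A) (ob A) \<cdot> (comult A \<otimes>\<^sub>m comult A) \<and>
     comult A \<cdot> munit A = (munit A \<otimes>\<^sub>m munit A) \<cdot> inv_arrow M (\<one>\<^sub>o \<otimes>\<^sub>o \<one>\<^sub>o) \<one>\<^sub>o (lunit M \<one>\<^sub>o) \<and>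
     counit A \<cdot> mmult A = lunit M \<one>\<^sub>o \<cdot> (counit A \<otimes>\<^sub>m counit A) \<and>
     counit A \<cdot> munit A = Id M \<one>\<^sub>o"
  for M (structure)

definition hopf_monoid :: "('o, 'm, 'z) asm_cat_scheme \<Rightarrow> ('o, 'm, 'y) hopf_data_scheme \<Rightarrow> bool" where
  "hopf_monoid M A \<longleftrightarrow> bimonoid M A \<and> antipode A \<in> Hom M (ob A) (ob A) \<and>
     mmult A \<cdot> (antipode A \<otimes>\<^sub>m Id M (ob A)) \<cdot> comult A = munit A \<cdot> counit A \<and>
     mmult A \<cdot> (Id M (ob A) \<otimes>\<^sub>m antipode A) \<cdot> comult A = munit A \<cdot> counit A"
  for M (structure)

text \<open>A bimonoid morphism between Hopf monoids automatically commutes with the antipodes.\<close>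

definition Hopf_coc :: "('o, 'm, 'z) asm_cat_scheme \<Rightarrow> (('o, 'm) hopf_data, 'm) cat" where
  "Hopf_coc M =
     \<lparr>Obj = {A. hopf_monoid M A \<and> cocommutative M A},
      Hom = (\<lambda>A B. {f. monoid_morphism M A B f \<and> comonoid_morphism M A B f}),
      Id = (\<lambda>A. Id M (ob A)),
      Comp = Comp M\<rparr>"


section \<open>Cocommutative comonoids in the category of left modules\<close>

definition left_action :: "('o, 'm, 'z) asm_cat_scheme \<Rightarrow> ('o, 'm, 'y) hopf_data_scheme
    \<Rightarrow> 'o \<Rightarrow> 'm \<Rightarrow> bool" where
  "left_action M A V \<mu> \<longleftrightarrow> V \<in> Obj M \<and> \<mu> \<in> Hom M (ob A \<otimes>\<^sub>o V) V \<and>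
     \<mu> \<cdot> (mmult A \<otimes>\<^sub>m Id M V) = \<mu> \<cdot> (Id M (ob A) \<otimes>\<^sub>m \<mu>) \<cdot> assoc M (ob A) (ob A) V \<and>
     \<mu> \<cdot> (munit A \<otimes>\<^sub>m Id M V) = lunit M V"
  for M (structure)

definition left_linear :: "('o, 'm, 'z) asm_cat_scheme \<Rightarrow> ('o, 'm, 'y) hopf_data_scheme
    \<Rightarrow> 'o \<Rightarrow> 'm \<Rightarrow> 'o \<Rightarrow> 'm \<Rightarrow> 'm \<Rightarrow> bool" where
  "left_linear M A V \<mu> W \<nu> f \<longleftrightarrow> f \<in> Hom M V W \<and> f \<cdot> \<mu> = \<nu> \<cdot> (Id M (ob A) \<otimes>\<^sub>m f)"
  for M (structure)

definition tensor_action :: "('o, 'm, 'z) asm_cat_scheme \<Rightarrow> ('o, 'm, 'y) hopf_data_scheme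
    \<Rightarrow> 'o \<Rightarrow> 'm \<Rightarrow> 'o \<Rightarrow> 'm \<Rightarrow> 'm" where
  "tensor_action M A V \<mu> W \<nu> =
     (\<mu> \<otimes>\<^sub>m \<nu>) \<cdot> middle_swap M (ob A) (ob A) V W \<cdot> (comult A \<otimes>\<^sub>m Id M (V \<otimes>\<^sub>o W))"
  for M (structure)

text \<open>The action \<open>\<epsilon>\<^sub>A\<close> of \<open>A\<close> on the unit object, as a morphism \<open>A \<otimes> \<one> \<rightarrow> \<one>\<close>.\<close>

definition trivial_action :: "('o, 'm, 'z) asm_cat_scheme \<Rightarrow> ('o, 'm, 'y) hopf_data_scheme \<Rightarrow> 'm" where
  "trivial_action M A = counit A \<cdot> runit M (ob A)"
  for M (structure)

record ('o, 'm) module_comon = "('o, 'm) comon" +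
  act :: 'm

definition module_comonoid :: "('o, 'm, 'z) asm_cat_scheme \<Rightarrow> ('o, 'm, 'y) hopf_data_scheme
    \<Rightarrow> ('o, 'm, 'x) module_comon_scheme \<Rightarrow> bool" where
  "module_comonoid M A Q \<longleftrightarrow> comonoid M Q \<and> left_action M A (ob Q) (act Q) \<and>
     left_linear M A (ob Q) (act Q) (ob Q \<otimes>\<^sub>o ob Q)
       (tensor_action M A (ob Q) (act Q) (ob Q) (act Q)) (comult Q) \<and>
     left_linear M A (ob Q) (act Q) \<one>\<^sub>o (trivial_action M A) (counit Q)"
  for M (structure)

definition Comon_coc_mod :: "('o, 'm, 'z) asm_cat_scheme \<Rightarrow> ('o, 'm) hopf_data
    \<Rightarrow> (('o, 'm) module_comon, 'm) cat" where
  "Comon_coc_mod M A =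
     \<lparr>Obj = {Q. module_comonoid M A Q \<and> cocommutative M Q},
      Hom = (\<lambda>P Q. {f. comonoid_morphism M P Q f \<and>
                       left_linear M A (ob P) (act P) (ob Q) (act Q) f}),
      Id = (\<lambda>Q. Id M (ob Q)),
      Comp = Comp M\<rparr>"

definition regular_module_comon :: "('o, 'm) hopf_data \<Rightarrow> ('o, 'm) module_comon" where
  "regular_module_comon A =
     \<lparr>ob = ob A, comult = comult A, counit = counit A, act = mmult A\<rparr>"


section \<open>Comodules, cotensor products and faithful coflatness\<close>

text \<open>\<open>coact V\<close> is a morphism \<open>V \<rightarrow> V \<otimes> Q\<close> for right comodules, \<open>V \<rightarrow> Q \<otimes> V\<close> for left comodules.\<close>

record ('o, 'm) comod =
  cob :: 'o
  coact :: 'm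

definition right_comodule :: "('o, 'm, 'z) asm_cat_scheme \<Rightarrow> ('o, 'm, 'y) comon_scheme
    \<Rightarrow> ('o, 'm) comod \<Rightarrow> bool" where
  "right_comodule M Q V \<longleftrightarrow> cob V \<in> Obj M \<and> coact V \<in> Hom M (cob V) (cob V \<otimes>\<^sub>o ob Q) \<and>
     assoc M (cob V) (ob Q) (ob Q) \<cdot> (coact V \<otimes>\<^sub>m Id M (ob Q)) \<cdot> coact V
       = (Id M (cob V) \<otimes>\<^sub>m comult Q) \<cdot> coact V \<and>
     runit M (cob V) \<cdot> (Id M (cob V) \<otimes>\<^sub>m counit Q) \<cdot> coact V = Id M (cob V)"
  for M (structure)

definition right_comodules :: "('o, 'm, 'z) asm_cat_scheme \<Rightarrow> ('o, 'm, 'y) comon_scheme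
    \<Rightarrow> (('o, 'm) comod, 'm) cat" where
  "right_comodules M Q =
     \<lparr>Obj = {V. right_comodule M Q V},
      Hom = (\<lambda>V W. {f \<in> Hom M (cob V) (cob W).
                Comp M (coact W) f = Comp M (tensor_arr M f (Id M (ob Q))) (coact V)}),
      Id = (\<lambda>V. Id M (cob V)),
      Comp = Comp M\<rparr>"

text \<open>A chosen equalizer \<open>(V \<box>\<^sub>Q W, V \<box>\<^sub>Q W \<rightarrow> V \<otimes> W)\<close>.\<close>

definition cotensor :: "('o, 'm, 'z) asm_cat_scheme \<Rightarrow> ('o, 'm, 'y) comon_scheme
    \<Rightarrow> ('o, 'm) comod \<Rightarrow> ('o, 'm) comod \<Rightarrow> 'o \<times> 'm" where
  "cotensor M Q W V = (SOME (E, e). equalizer M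
      (cob V \<otimes>\<^sub>o cob W) (cob V \<otimes>\<^sub>o (ob Q \<otimes>\<^sub>o cob W))
      (assoc M (cob V) (ob Q) (cob W) \<cdot> (coact V \<otimes>\<^sub>m Id M (cob W)))
      (Id M (cob V) \<otimes>\<^sub>m coact W) E e)"
  for M (structure)

text \<open>Object and morphism part of the functor \<open>(-) \<box>\<^sub>Q W\<close>; note the order of the arguments.\<close>

definition cotensor_obj :: "('o, 'm, 'z) asm_cat_scheme \<Rightarrow> ('o, 'm, 'y) comon_scheme
    \<Rightarrow> ('o, 'm) comod \<Rightarrow> ('o, 'm) comod \<Rightarrow> 'o" where
  "cotensor_obj M Q W V = fst (cotensor M Q W V)"

definition cotensor_arr :: "('o, 'm, 'z) asm_cat_scheme \<Rightarrow> ('o, 'm, 'y) comon_scheme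
    \<Rightarrow> ('o, 'm) comod \<Rightarrow> ('o, 'm) comod \<Rightarrow> ('o, 'm) comod \<Rightarrow> 'm \<Rightarrow> 'm" where
  "cotensor_arr M Q W V V' f =
     (THE t. t \<in> Hom M (cotensor_obj M Q W V) (cotensor_obj M Q W V') \<and>
        snd (cotensor M Q W V') \<cdot> t = (f \<otimes>\<^sub>m Id M (cob W)) \<cdot> snd (cotensor M Q W V))"
  for M (structure)

definition induced_comodule :: "('o, 'm, 'z) asm_cat_scheme \<Rightarrow> ('o, 'm, 'y) comon_scheme
    \<Rightarrow> 'm \<Rightarrow> ('o, 'm) comod" where
  "induced_comodule M A \<pi> = \<lparr>cob = ob A, coact = (\<pi> \<otimes>\<^sub>m Id M (ob A)) \<cdot> comult A\<rparr>"
  for M (structure)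

definition faithful_coflatness_condition :: "('o, 'm, 'z) asm_cat_scheme \<Rightarrow> bool" where
  "faithful_coflatness_condition M \<longleftrightarrow>
     (\<forall>A\<in>Obj (Hopf_coc M). \<forall>Q\<in>Obj (Comon_coc_mod M A).
      \<forall>\<pi>\<in>Hom (Comon_coc_mod M A) (regular_module_comon A) Q.
        epic M (ob A) (ob Q) \<pi> \<longrightarrow>
        preserves_epis (right_comodules M Q) M
          (cotensor_obj M Q (induced_comodule M A \<pi>)) (cotensor_arr M Q (induced_comodule M A \<pi>)) \<and>
        reflects_epis (right_comodules M Q) M
          (cotensor_obj M Q (induced_comodule M A \<pi>)) (cotensor_arr M Q (induced_comodule M A \<pi>)))"

end

theory Submission
  imports Defs
begin

text \<open>
  With \<open>\<otimes>\<close> as product, cocommutative comonoids form a cartesian category, and cocommutative Hopf monoids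
  are the group objects in it. Identities between comonoid morphisms therefore reduce to
  computations in groups of generalized elements, with \<open>\<langle>x, y\<rangle> = (x \<otimes> y) \<Delta>\<close>. As \<open>\<otimes>\<close> is exact, equalizers of
  comonoids and images of Hopf monoids can be formed in \<open>M\<close>.

  If \<open>p : A \<rightarrow> B\<close> is epic in \<open>M\<close>, with Hopf kernel \<open>K\<close>, faithful coflatness shows that the linear kernel
  of \<open>p\<close> is generated by the elements \<open>k a - \<epsilon>(k) a\<close> with \<open>k\<close> in \<open>K\<close>; hence \<open>p\<close> is the cokernel of
  \<open>K \<rightarrow> A\<close>. The remaining implications follow by factoring a morphism through its image: the monic
  part of a regular epimorphism splits, and the epic part of a monomorphism is the cokernel of a trivial
  morphism.
\<close>

section \<open>Typed arrows\<close>

text \<open>Cotensoring with \<open>A\<close> over \<open>B\<close> is base change along p. It turns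
  p : A -> B into the second projection of the fibre product A x_B A, and that is the trivial
  K-torsor: (y, z) corresponds to (y z^-1, z) in K x A. This is why the map from K \<otimes> A to
  the linear kernel P acquires a section after cotensoring, and where that section comes from. Two
  obstacles shape the argument. The computations take place on W = A x_B A and are transported along
  a linear map from the cotensor product of P and \<open>A\<close> to W; a difference is handled
  through its two terms. Secondly, the equalizer in \<open>M\<close> of two comonoid morphisms f and
  g need not inherit a comultiplication; the equalizer of <1, f> and <1, g> does, and has the same
  generalized elements. The constraints suppressed in the informal statement are explicit here.
  Coherence is proved just far enough to make the tensor product of comonoids a comonoid; afterwards
  the constraints act on tuples <x, y> by rewriting.\<close>

text \<open>
  Recording domain and codomain makes composition a total operation that is associative without
  side conditions, \<open>Null\<close> being the result of an ill-typed composition.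
\<close>

datatype ('o, 'm) arrow = Null | Arr (dom: 'o) (cod: 'o) (raw: 'm)

context category
begin

definition valid :: "('o, 'm) arrow \<Rightarrow> bool" where
  "valid f \<longleftrightarrow> f \<noteq> Null \<and> dom f \<in> Obj C \<and> cod f \<in> Obj C \<and> raw f \<in> Hom C (dom f) (cod f)"

abbreviation in_hom :: "('o, 'm) arrow \<Rightarrow> 'o \<Rightarrow> 'o \<Rightarrow> bool"  ("\<guillemotleft>_ : _ \<rightarrow> _\<guillemotright>") where
  "\<guillemotleft>f : A \<rightarrow> B\<guillemotright> \<equiv> valid f \<and> dom f = A \<and> cod f = B"

definition comp :: "('o, 'm) arrow \<Rightarrow> ('o, 'm) arrow \<Rightarrow> ('o, 'm) arrow"  (infixr "\<odot>" 55) where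
  "g \<odot> f = (if valid g \<and> valid f \<and> cod f = dom g then Arr (dom f) (cod g) (raw g \<cdot> raw f) else Null)"

definition ide :: "'o \<Rightarrow> ('o, 'm) arrow" where
  "ide A = Arr A A (Id C A)"

lemma valid_Null [simp]: "\<not> valid Null"
  by (simp add: valid_def)

lemma valid_Arr [simp]: "valid (Arr A B f) \<longleftrightarrow> A \<in> Obj C \<and> B \<in> Obj C \<and> f \<in> Hom C A B"
  by (simp add: valid_def)

lemma valid_ide [simp]: "valid (ide A) \<longleftrightarrow> A \<in> Obj C"
  by (auto simp: ide_def Id_in_Hom)

lemma dom_ide [simp]: "dom (ide A) = A" and cod_ide [simp]: "cod (ide A) = A"
  by (simp_all add: ide_def)

lemma valid_comp [simp]: "valid (g \<odot> f) \<longleftrightarrow> valid g \<and> valid f \<and> cod f = dom g"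
  by (auto simp: comp_def valid_def intro: Comp_in_Hom)

lemma dom_comp [simp]: "\<lbrakk>valid g; valid f; cod f = dom g\<rbrakk> \<Longrightarrow> dom (g \<odot> f) = dom f"
  and cod_comp [simp]: "\<lbrakk>valid g; valid f; cod f = dom g\<rbrakk> \<Longrightarrow> cod (g \<odot> f) = cod g"
  by (simp_all add: comp_def)

lemma comp_assoc [simp]: "(h \<odot> g) \<odot> f = h \<odot> (g \<odot> f)"
proof (cases "valid f \<and> valid g \<and> valid h \<and> cod f = dom g \<and> cod g = dom h")
  case True
  then show ?thesis
    by (auto simp: comp_def valid_def intro: Comp_in_Hom Comp_assoc)
next
  case False
  moreover have "\<not> valid ((h \<odot> g) \<odot> f)" "\<not> valid (h \<odot> (g \<odot> f))"
    using False by auto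
  moreover have "\<not> valid (k \<odot> l) \<Longrightarrow> k \<odot> l = Null" for k l
    unfolding valid_comp by (auto simp: comp_def)
  ultimately show ?thesis
    by metis
qed

lemma ide_comp [simp]: "\<lbrakk>valid f; cod f = A\<rbrakk> \<Longrightarrow> ide A \<odot> f = f"
  by (cases f) (auto simp: comp_def ide_def Comp_Id_left Id_in_Hom)

lemma comp_ide [simp]: "\<lbrakk>valid f; dom f = A\<rbrakk> \<Longrightarrow> f \<odot> ide A = f"
  by (cases f) (auto simp: comp_def ide_def Comp_Id_right Id_in_Hom)

lemma comp_Arr: "\<lbrakk>valid (Arr B D g); valid (Arr A B f)\<rbrakk> \<Longrightarrow> Arr B D g \<odot> Arr A B f = Arr A D (g \<cdot> f)"
  by (simp add: comp_def)

lemma valid_in_Obj: "valid f \<Longrightarrow> dom f \<in> Obj C" "valid f \<Longrightarrow> cod f \<in> Obj C"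
  by (simp_all add: valid_def)

lemma valid_Arr_raw: "\<guillemotleft>f : A \<rightarrow> B\<guillemotright> \<Longrightarrow> Arr A B (raw f) = f"
  by (cases f) auto

lemma in_hom_raw: "\<guillemotleft>f : A \<rightarrow> B\<guillemotright> \<Longrightarrow> raw f \<in> Hom C A B"
  by (cases f) auto

text \<open>Simplification nests \<open>\<odot>\<close> to the right, so an equation for
  \<open>f \<odot> g\<close> no longer matches once something is composed on the right. Applied with
  \<open>THEN\<close>, this rule yields the form that does match; totality of \<open>\<odot>\<close>
  spares it any typing condition.\<close>

lemma comp_reassoc: "f \<odot> g = h \<Longrightarrow> f \<odot> g \<odot> x = h \<odot> x"
  by (metis comp_assoc)

lemma comp_reassoc3: "f \<odot> g \<odot> h = k \<Longrightarrow> f \<odot> g \<odot> h \<odot> x = k \<odot> x"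
  by (metis comp_assoc)

section \<open>Isomorphisms, monomorphisms and epimorphisms\<close>

definition inverses :: "('o, 'm) arrow \<Rightarrow> ('o, 'm) arrow \<Rightarrow> bool" where
  "inverses f g \<longleftrightarrow> valid f \<and> valid g \<and> dom g = cod f \<and> cod g = dom f \<and>
     g \<odot> f = ide (dom f) \<and> f \<odot> g = ide (cod f)"

definition iso :: "('o, 'm) arrow \<Rightarrow> bool" where
  "iso f \<longleftrightarrow> (\<exists>g. inverses f g)"

definition arr_inv :: "('o, 'm) arrow \<Rightarrow> ('o, 'm) arrow" where
  "arr_inv f = (SOME g. inverses f g)"

definition mono :: "('o, 'm) arrow \<Rightarrow> bool" where
  "mono f \<longleftrightarrow> valid f \<and> (\<forall>g h. valid g \<and> valid h \<and> cod g = dom f \<and> cod h = dom f \<and>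
      f \<odot> g = f \<odot> h \<longrightarrow> g = h)"

definition epi :: "('o, 'm) arrow \<Rightarrow> bool" where
  "epi f \<longleftrightarrow> valid f \<and> (\<forall>g h. valid g \<and> valid h \<and> dom g = cod f \<and> dom h = cod f \<and>
      g \<odot> f = h \<odot> f \<longrightarrow> g = h)"

lemma monoD: "\<lbrakk>mono f; f \<odot> g = f \<odot> h; valid g; valid h; cod g = dom f; cod h = dom f\<rbrakk> \<Longrightarrow> g = h"
  unfolding mono_def by blast

lemma epiD: "\<lbrakk>epi f; g \<odot> f = h \<odot> f; valid g; valid h; dom g = cod f; dom h = cod f\<rbrakk> \<Longrightarrow> g = h"
  unfolding epi_def by blast

lemma mono_valid: "mono f \<Longrightarrow> valid f" and epi_valid: "epi f \<Longrightarrow> valid f"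
  by (simp_all add: mono_def epi_def)

lemma inverses_inv: "iso f \<Longrightarrow> inverses f (arr_inv f)"
  by (auto simp: iso_def arr_inv_def intro: someI_ex)

lemma iso_valid: "iso f \<Longrightarrow> valid f"
  by (auto simp: iso_def inverses_def)

lemma valid_inv [simp]: "iso f \<Longrightarrow> valid (arr_inv f)"
  and dom_inv [simp]: "iso f \<Longrightarrow> dom (arr_inv f) = cod f"
  and cod_inv [simp]: "iso f \<Longrightarrow> cod (arr_inv f) = dom f"
  and inv_comp: "iso f \<Longrightarrow> arr_inv f \<odot> f = ide (dom f)"
  and comp_inv: "iso f \<Longrightarrow> f \<odot> arr_inv f = ide (cod f)"
  using inverses_inv by (auto simp: inverses_def)

lemma iso_imp_mono: assumes "iso f" shows "mono f"
  unfolding mono_def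
proof (intro conjI allI impI; (elim conjE)?)
  show "valid f" using assms by (rule iso_valid)
  fix g h assume *: "valid g" "valid h" "cod g = dom f" "cod h = dom f" "f \<odot> g = f \<odot> h"
  have "(arr_inv f \<odot> f) \<odot> g = (arr_inv f \<odot> f) \<odot> h" using * by simp
  then show "g = h" using * by (simp only: inv_comp[OF assms] ide_comp)
qed

lemma iso_imp_epi: assumes "iso f" shows "epi f"
  unfolding epi_def
proof (intro conjI allI impI; (elim conjE)?)
  show "valid f" using assms by (rule iso_valid)
  fix g h assume *: "valid g" "valid h" "dom g = cod f" "dom h = cod f" "g \<odot> f = h \<odot> f"
  have "(k \<odot> f) \<odot> arr_inv f = k" if "valid k" "dom k = cod f" for k
    using that by (simp add: comp_inv assms)
  then show "g = h" using * by metis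
qed

lemma monoI:
  "\<lbrakk>valid f; \<And>g h. \<lbrakk>valid g; valid h; cod g = dom f; cod h = dom f; f \<odot> g = f \<odot> h\<rbrakk> \<Longrightarrow> g = h\<rbrakk>
   \<Longrightarrow> mono f"
  unfolding mono_def by blast

lemma epiI:
  "\<lbrakk>valid f; \<And>g h. \<lbrakk>valid g; valid h; dom g = cod f; dom h = cod f; g \<odot> f = h \<odot> f\<rbrakk> \<Longrightarrow> g = h\<rbrakk>
   \<Longrightarrow> epi f"
  unfolding epi_def by blast

lemma mono_comp:
  assumes f: "mono f" and g: "mono g" and *: "cod g = dom f"
  shows "mono (f \<odot> g)"
proof (rule monoI)
  note [simp] = mono_valid[OF f] mono_valid[OF g] *
  show "valid (f \<odot> g)" by simp
  fix h k assume hk: "valid h" "valid k" "cod h = dom (f \<odot> g)" "cod k = dom (f \<odot> g)"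
    and eq: "(f \<odot> g) \<odot> h = (f \<odot> g) \<odot> k"
  have "g \<odot> h = g \<odot> k"
    by (rule monoD[OF f eq[unfolded comp_assoc]]) (use hk in simp_all)
  then show "h = k" by (rule monoD[OF g]) (use hk in simp_all)
qed

lemma epi_comp:
  assumes f: "epi f" and g: "epi g" and *: "cod g = dom f"
  shows "epi (f \<odot> g)"
proof (rule epiI)
  note [simp] = epi_valid[OF f] epi_valid[OF g] *
  show "valid (f \<odot> g)" by simp
  fix h k assume hk: "valid h" "valid k" "dom h = cod (f \<odot> g)" "dom k = cod (f \<odot> g)"
    and eq: "h \<odot> (f \<odot> g) = k \<odot> (f \<odot> g)"
  have "h \<odot> f = k \<odot> f"
    by (rule epiD[OF g eq[folded comp_assoc]]) (use hk in simp_all)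
  then show "h = k" by (rule epiD[OF f]) (use hk in simp_all)
qed

lemma mono_cancel:
  assumes "mono (f \<odot> g)"
  shows "mono g"
proof (rule monoI)
  have v: "valid f" "valid g" "cod g = dom f" using mono_valid[OF assms] by simp_all
  then show "valid g" by simp
  fix h k assume hk: "valid h" "valid k" "cod h = dom g" "cod k = dom g" and eq: "g \<odot> h = g \<odot> k"
  have "(f \<odot> g) \<odot> h = (f \<odot> g) \<odot> k" unfolding comp_assoc eq ..
  then show "h = k" by (rule monoD[OF assms]) (use hk v in simp_all)
qed

lemma epi_cancel:
  assumes "epi (f \<odot> g)"
  shows "epi f"
proof (rule epiI)
  have v: "valid f" "valid g" "cod g = dom f" using epi_valid[OF assms] by simp_all
  then show "valid f" by simp
  fix h k assume hk: "valid h" "valid k" "dom h = cod f" "dom k = cod f" and eq: "h \<odot> f = k \<odot> f"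
  have "h \<odot> (f \<odot> g) = k \<odot> (f \<odot> g)" unfolding comp_assoc[symmetric] eq ..
  then show "h = k" by (rule epiD[OF assms]) (use hk v in simp_all)
qed

lemma split_mono_epi_iso:
  assumes "mono f" "f \<odot> g = ide (cod f)" "valid g" "cod g = dom f" "dom g = cod f"
  shows "iso f"
proof -
  have [simp]: "valid f" by (rule mono_valid[OF assms(1)])
  have "f \<odot> g \<odot> f = f \<odot> ide (dom f)" using assms by (simp add: comp_reassoc[OF assms(2)])
  then have "g \<odot> f = ide (dom f)"
    by (rule monoD[OF assms(1)]) (use assms in \<open>auto simp: valid_in_Obj\<close>)
  then show ?thesis using assms by (auto simp: iso_def inverses_def)
qed

section \<open>Comparison with the notions on raw morphisms\<close>

lemma monic_iff:
  assumes [simp]: "A \<in> Obj C" "B \<in> Obj C"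
  shows "monic C A B f \<longleftrightarrow> mono (Arr A B f)"
proof
  assume m: "monic C A B f"
  then have f: "f \<in> Hom C A B" by (simp add: monic_def)
  show "mono (Arr A B f)"
  proof (rule monoI)
    show "valid (Arr A B f)" using f by simp
    fix g h assume *: "valid g" "valid h" "cod g = dom (Arr A B f)" "cod h = dom (Arr A B f)"
      "Arr A B f \<odot> g = Arr A B f \<odot> h"
    then have "dom g = dom h" "f \<cdot> raw g = f \<cdot> raw h"
      using f by (auto simp: comp_def)
    moreover have "raw g \<in> Hom C (dom g) A" "raw h \<in> Hom C (dom h) A" "dom g \<in> Obj C"
      using * by (auto simp: in_hom_raw valid_in_Obj)
    ultimately have "raw g = raw h" using m unfolding monic_def by metis
    then show "g = h"
      using \<open>dom g = dom h\<close> * by (metis valid_Arr_raw)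
  qed
next
  assume m: "mono (Arr A B f)"
  then have f: "f \<in> Hom C A B" using mono_valid by fastforce
  show "monic C A B f"
    unfolding monic_def
  proof (intro conjI ballI impI)
    fix X g h assume *: "X \<in> Obj C" "g \<in> Hom C X A" "h \<in> Hom C X A" "f \<cdot> g = f \<cdot> h"
    have "Arr X A g = Arr X A h"
      by (rule monoD[OF m]) (use * f in \<open>simp_all add: comp_Arr\<close>)
    then show "g = h" by simp
  qed (rule f)
qed

lemma epic_iff:
  assumes [simp]: "A \<in> Obj C" "B \<in> Obj C"
  shows "epic C A B f \<longleftrightarrow> epi (Arr A B f)"
proof
  assume m: "epic C A B f"
  then have f: "f \<in> Hom C A B" by (simp add: epic_def)
  show "epi (Arr A B f)"
  proof (rule epiI)
    show "valid (Arr A B f)" using f by simp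
    fix g h assume *: "valid g" "valid h" "dom g = cod (Arr A B f)" "dom h = cod (Arr A B f)"
      "g \<odot> Arr A B f = h \<odot> Arr A B f"
    then have "cod g = cod h" "raw g \<cdot> f = raw h \<cdot> f"
      using f by (auto simp: comp_def)
    moreover have "raw g \<in> Hom C B (cod g)" "raw h \<in> Hom C B (cod h)" "cod g \<in> Obj C"
      using * by (auto simp: in_hom_raw valid_in_Obj)
    ultimately have "raw g = raw h" using m unfolding epic_def by metis
    then show "g = h"
      using \<open>cod g = cod h\<close> * by (metis valid_Arr_raw)
  qed
next
  assume m: "epi (Arr A B f)"
  then have f: "f \<in> Hom C A B" using epi_valid by fastforce
  show "epic C A B f"
    unfolding epic_def
  proof (intro conjI ballI impI)
    fix X g h assume *: "X \<in> Obj C" "g \<in> Hom C B X" "h \<in> Hom C B X" "g \<cdot> f = h \<cdot> f"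
    have "Arr B X g = Arr B X h"
      by (rule epiD[OF m]) (use * f in \<open>simp_all add: comp_Arr\<close>)
    then show "g = h" by simp
  qed (rule f)
qed

text \<open>Isomorphisms are monic, so inverses are unique; hence the definite description in
  \<open>inv_arrow\<close> and the arbitrary choice in \<open>arr_inv\<close> pick the same
  morphism.\<close>

lemma inv_arrow_eq:
  assumes "A \<in> Obj C" "B \<in> Obj C" "iso_arrow C A B f"
  shows "iso (Arr A B f)" "Arr B A (inv_arrow C A B f) = arr_inv (Arr A B f)"
proof -
  obtain g where g: "inverse_arrows C A B f g"
    using assms by (auto simp: iso_arrow_def)
  have conv: "inverse_arrows C A B f h \<longleftrightarrow> inverses (Arr A B f) (Arr B A h)" for h
    using assms(1,2) by (auto simp: inverse_arrows_def inverses_def comp_Arr ide_def comp_def)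
  show iso: "iso (Arr A B f)" using g conv by (auto simp: iso_def)
  have uniq: "h = h'" if "inverses (Arr A B f) h" "inverses (Arr A B f) h'" for h h'
    using that iso_imp_mono[OF iso] unfolding inverses_def by (metis monoD)
  have "inv_arrow C A B f = g"
    unfolding inv_arrow_def using g uniq conv by (intro the_equality) blast+
  then show "Arr B A (inv_arrow C A B f) = arr_inv (Arr A B f)"
    using g conv uniq inverses_inv[OF iso] by blast
qed

end

section \<open>The tensor product of typed arrows\<close>

context symmetric_monoidal_category
begin

notation comp (infixr "\<odot>" 55)
notation in_hom ("\<guillemotleft>_ : _ \<rightarrow> _\<guillemotright>")

definition tens :: "('o, 'm) arrow \<Rightarrow> ('o, 'm) arrow \<Rightarrow> ('o, 'm) arrow"  (infixr "\<boxtimes>" 70) where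
  "f \<boxtimes> g = (if valid f \<and> valid g
     then Arr (dom f \<otimes>\<^sub>o dom g) (cod f \<otimes>\<^sub>o cod g) (raw f \<otimes>\<^sub>m raw g) else Null)"

declare tensor_Obj [simp] unit_Obj [simp]

lemma valid_tens [simp]: "valid (f \<boxtimes> g) \<longleftrightarrow> valid f \<and> valid g"
  by (auto simp: tens_def valid_def intro: tensor_Hom)

lemma dom_tens [simp]: "\<lbrakk>valid f; valid g\<rbrakk> \<Longrightarrow> dom (f \<boxtimes> g) = dom f \<otimes>\<^sub>o dom g"
  and cod_tens [simp]: "\<lbrakk>valid f; valid g\<rbrakk> \<Longrightarrow> cod (f \<boxtimes> g) = cod f \<otimes>\<^sub>o cod g"
  by (simp_all add: tens_def)

lemma tens_ide [simp]: "\<lbrakk>A \<in> Obj M; B \<in> Obj M\<rbrakk> \<Longrightarrow> ide A \<boxtimes> ide B = ide (A \<otimes>\<^sub>o B)"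
  by (simp add: tens_def) (simp add: ide_def tensor_Id)

lemma tens_comp [simp]:
  "\<lbrakk>valid f; valid g; valid f'; valid g'; cod f = dom f'; cod g = dom g'\<rbrakk>
   \<Longrightarrow> (f' \<boxtimes> g') \<odot> (f \<boxtimes> g) = (f' \<odot> f) \<boxtimes> (g' \<odot> g)"
  by (cases f; cases g; cases f'; cases g')
    (auto simp: tens_def comp_def tensor_Comp intro: Comp_in_Hom tensor_Hom)

lemmas tens_comp_comp [simp] = tens_comp[THEN comp_reassoc]

text \<open>As simplification rules these merge consecutive tensor products into one. They are
  switched off with \<open>del: interchange\<close> wherever a factor has to stay separate so that a
  naturality square can be applied to it.\<close>

lemmas interchange = tens_comp tens_comp_comp

lemma tens_Arr: "\<lbrakk>valid (Arr A A' f); valid (Arr B B' g)\<rbrakk>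
   \<Longrightarrow> Arr A A' f \<boxtimes> Arr B B' g = Arr (A \<otimes>\<^sub>o B) (A' \<otimes>\<^sub>o B') (f \<otimes>\<^sub>m g)"
  by (simp add: tens_def)

definition \<alpha> :: "'o \<Rightarrow> 'o \<Rightarrow> 'o \<Rightarrow> ('o, 'm) arrow" where
  "\<alpha> A B D = Arr ((A \<otimes>\<^sub>o B) \<otimes>\<^sub>o D) (A \<otimes>\<^sub>o (B \<otimes>\<^sub>o D)) (assoc M A B D)"

definition lu :: "'o \<Rightarrow> ('o, 'm) arrow" where
  "lu A = Arr (\<one>\<^sub>o \<otimes>\<^sub>o A) A (lunit M A)"

definition ru :: "'o \<Rightarrow> ('o, 'm) arrow" where
  "ru A = Arr (A \<otimes>\<^sub>o \<one>\<^sub>o) A (runit M A)"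

definition br :: "'o \<Rightarrow> 'o \<Rightarrow> ('o, 'm) arrow" where
  "br A B = Arr (A \<otimes>\<^sub>o B) (B \<otimes>\<^sub>o A) (braid M A B)"

lemma iso_\<alpha> [simp]: "\<lbrakk>A \<in> Obj M; B \<in> Obj M; D \<in> Obj M\<rbrakk> \<Longrightarrow> iso (\<alpha> A B D)"
  unfolding \<alpha>_def by (intro inv_arrow_eq) (auto intro: assoc_iso)

lemma iso_lu [simp]: "A \<in> Obj M \<Longrightarrow> iso (lu A)"
  unfolding lu_def by (intro inv_arrow_eq) (auto intro: lunit_iso)

lemma iso_ru [simp]: "A \<in> Obj M \<Longrightarrow> iso (ru A)"
  unfolding ru_def by (intro inv_arrow_eq) (auto intro: runit_iso)

lemma valid_structure [simp]:
  "\<lbrakk>A \<in> Obj M; B \<in> Obj M; D \<in> Obj M\<rbrakk> \<Longrightarrow> valid (\<alpha> A B D)"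
  "A \<in> Obj M \<Longrightarrow> valid (lu A)"
  "A \<in> Obj M \<Longrightarrow> valid (ru A)"
  "\<lbrakk>A \<in> Obj M; B \<in> Obj M\<rbrakk> \<Longrightarrow> valid (br A B)"
  by (rule iso_valid, simp)+ (auto simp: br_def braid_Hom)

lemma dom_structure [simp]:
  "dom (\<alpha> A B D) = (A \<otimes>\<^sub>o B) \<otimes>\<^sub>o D"
  "dom (lu A) = \<one>\<^sub>o \<otimes>\<^sub>o A"
  "dom (ru A) = A \<otimes>\<^sub>o \<one>\<^sub>o"
  "dom (br A B) = A \<otimes>\<^sub>o B"
  by (simp_all add: \<alpha>_def lu_def ru_def br_def)

lemma cod_structure [simp]:
  "cod (\<alpha> A B D) = A \<otimes>\<^sub>o (B \<otimes>\<^sub>o D)"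
  "cod (lu A) = A"
  "cod (ru A) = A"
  "cod (br A B) = B \<otimes>\<^sub>o A"
  by (simp_all add: \<alpha>_def lu_def ru_def br_def)

definition \<alpha>' :: "'o \<Rightarrow> 'o \<Rightarrow> 'o \<Rightarrow> ('o, 'm) arrow" where
  "\<alpha>' A B D = arr_inv (\<alpha> A B D)"

definition lu' :: "'o \<Rightarrow> ('o, 'm) arrow" where
  "lu' A = arr_inv (lu A)"

definition ru' :: "'o \<Rightarrow> ('o, 'm) arrow" where
  "ru' A = arr_inv (ru A)"

lemma inverse_structure [simp]:
  "\<lbrakk>A \<in> Obj M; B \<in> Obj M; D \<in> Obj M\<rbrakk> \<Longrightarrow> \<guillemotleft>\<alpha>' A B D : A \<otimes>\<^sub>o (B \<otimes>\<^sub>o D) \<rightarrow> (A \<otimes>\<^sub>o B) \<otimes>\<^sub>o D\<guillemotright>"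
  "A \<in> Obj M \<Longrightarrow> \<guillemotleft>lu' A : A \<rightarrow> \<one>\<^sub>o \<otimes>\<^sub>o A\<guillemotright>"
  "A \<in> Obj M \<Longrightarrow> \<guillemotleft>ru' A : A \<rightarrow> A \<otimes>\<^sub>o \<one>\<^sub>o\<guillemotright>"
  by (simp_all add: \<alpha>'_def lu'_def ru'_def)

lemma structure_inverse [simp]:
  "\<lbrakk>A \<in> Obj M; B \<in> Obj M; D \<in> Obj M\<rbrakk> \<Longrightarrow> \<alpha> A B D \<odot> \<alpha>' A B D = ide (A \<otimes>\<^sub>o (B \<otimes>\<^sub>o D))"
  "\<lbrakk>A \<in> Obj M; B \<in> Obj M; D \<in> Obj M\<rbrakk> \<Longrightarrow> \<alpha>' A B D \<odot> \<alpha> A B D = ide ((A \<otimes>\<^sub>o B) \<otimes>\<^sub>o D)"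
  "A \<in> Obj M \<Longrightarrow> lu A \<odot> lu' A = ide A"
  "A \<in> Obj M \<Longrightarrow> lu' A \<odot> lu A = ide (\<one>\<^sub>o \<otimes>\<^sub>o A)"
  "A \<in> Obj M \<Longrightarrow> ru A \<odot> ru' A = ide A"
  "A \<in> Obj M \<Longrightarrow> ru' A \<odot> ru A = ide (A \<otimes>\<^sub>o \<one>\<^sub>o)"
  by (simp_all add: \<alpha>'_def lu'_def ru'_def comp_inv inv_comp)

lemma br_br [simp]: "\<lbrakk>A \<in> Obj M; B \<in> Obj M\<rbrakk> \<Longrightarrow> br B A \<odot> br A B = ide (A \<otimes>\<^sub>o B)"
  by (simp add: br_def comp_Arr braid_Hom braid_symmetric ide_def)

lemmas structure_inverse_comp [simp] = structure_inverse[THEN comp_reassoc] br_br[THEN comp_reassoc]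

lemma iso_br [simp]: "\<lbrakk>A \<in> Obj M; B \<in> Obj M\<rbrakk> \<Longrightarrow> iso (br A B)"
  unfolding iso_def inverses_def by (rule exI[of _ "br B A"]) simp

lemma \<alpha>_natural:
  "\<lbrakk>valid f; valid g; valid h; cod f = A; cod g = B; cod h = D\<rbrakk>
   \<Longrightarrow> \<alpha> A B D \<odot> ((f \<boxtimes> g) \<boxtimes> h) = (f \<boxtimes> (g \<boxtimes> h)) \<odot> \<alpha> (dom f) (dom g) (dom h)"
  using assoc_natural[of "dom f" "cod f" "dom g" "cod g" "dom h" "cod h" "raw f" "raw g" "raw h"]
    iso_valid[OF iso_\<alpha>, of "cod f" "cod g" "cod h"] iso_valid[OF iso_\<alpha>, of "dom f" "dom g" "dom h"]
  by (auto simp: \<alpha>_def comp_def tens_def valid_def intro!: tensor_Hom)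

lemma lu_natural: "valid f \<Longrightarrow> cod f = A \<Longrightarrow> lu A \<odot> (ide \<one>\<^sub>o \<boxtimes> f) = f \<odot> lu (dom f)"
  using lunit_natural[of "dom f" "cod f" "raw f"] valid_structure(2)[of "dom f"] valid_structure(2)[of "cod f"]
  by (auto simp: lu_def comp_def tens_def valid_def ide_def Id_in_Hom intro!: tensor_Hom)

lemma ru_natural: "valid f \<Longrightarrow> cod f = A \<Longrightarrow> ru A \<odot> (f \<boxtimes> ide \<one>\<^sub>o) = f \<odot> ru (dom f)"
  using runit_natural[of "dom f" "cod f" "raw f"] valid_structure(3)[of "dom f"] valid_structure(3)[of "cod f"]
  by (auto simp: ru_def comp_def tens_def valid_def ide_def Id_in_Hom intro!: tensor_Hom)

lemma br_natural: "\<lbrakk>valid f; valid g; cod f = A; cod g = B\<rbrakk>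
   \<Longrightarrow> br A B \<odot> (f \<boxtimes> g) = (g \<boxtimes> f) \<odot> br (dom f) (dom g)"
  using braid_natural[of "dom f" "cod f" "dom g" "cod g" "raw f" "raw g"]
  by (auto simp: br_def comp_def tens_def valid_def intro!: tensor_Hom braid_Hom)

lemma pentagon_arrow:
  assumes [simp]: "A \<in> Obj M" "B \<in> Obj M" "D \<in> Obj M" "E \<in> Obj M"
  shows "(ide A \<boxtimes> \<alpha> B D E) \<odot> \<alpha> A (B \<otimes>\<^sub>o D) E \<odot> (\<alpha> A B D \<boxtimes> ide E)
     = \<alpha> A B (D \<otimes>\<^sub>o E) \<odot> \<alpha> (A \<otimes>\<^sub>o B) D E"
proof -
  have *: "assoc M X Y Z \<in> Hom M ((X \<otimes>\<^sub>o Y) \<otimes>\<^sub>o Z) (X \<otimes>\<^sub>o (Y \<otimes>\<^sub>o Z))"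
    if "X \<in> Obj M" "Y \<in> Obj M" "Z \<in> Obj M" for X Y Z
    using valid_structure(1)[OF that] by (simp add: \<alpha>_def)
  show ?thesis
    by (simp add: \<alpha>_def ide_def comp_Arr tens_Arr * Id_in_Hom tensor_Hom pentagon Comp_in_Hom[of _ "(A \<otimes>\<^sub>o B \<otimes>\<^sub>o D) \<otimes>\<^sub>o E"])
qed

lemma triangle_arrow:
  assumes [simp]: "A \<in> Obj M" "B \<in> Obj M"
  shows "(ide A \<boxtimes> lu B) \<odot> \<alpha> A \<one>\<^sub>o B = ru A \<boxtimes> ide B"
  using valid_structure(1)[of A "\<one>\<^sub>o" B] valid_structure(2)[of B] valid_structure(3)[of A]
  by (simp add: \<alpha>_def lu_def ru_def ide_def comp_Arr tens_Arr Id_in_Hom tensor_Hom triangle)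

lemma hexagon_arrow:
  assumes [simp]: "A \<in> Obj M" "B \<in> Obj M" "D \<in> Obj M"
  shows "\<alpha> B D A \<odot> br A (B \<otimes>\<^sub>o D) \<odot> \<alpha> A B D
     = (ide B \<boxtimes> br A D) \<odot> \<alpha> B A D \<odot> (br A B \<boxtimes> ide D)"
proof -
  have *: "assoc M X Y Z \<in> Hom M ((X \<otimes>\<^sub>o Y) \<otimes>\<^sub>o Z) (X \<otimes>\<^sub>o (Y \<otimes>\<^sub>o Z))"
    if "X \<in> Obj M" "Y \<in> Obj M" "Z \<in> Obj M" for X Y Z
    using valid_structure(1)[OF that] by (simp add: \<alpha>_def)
  show ?thesis
    by (simp add: \<alpha>_def br_def ide_def comp_Arr tens_Arr * Id_in_Hom tensor_Hom braid_Hom hexagon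
       Comp_in_Hom[of _ "A \<otimes>\<^sub>o B \<otimes>\<^sub>o D"]  Comp_in_Hom[of _ "(B \<otimes>\<^sub>o A) \<otimes>\<^sub>o D"])
qed

end

section \<open>Coherence\<close>

context symmetric_monoidal_category
begin

lemma iso_comp [simp]: "\<lbrakk>iso f; iso g; cod g = dom f\<rbrakk> \<Longrightarrow> iso (f \<odot> g)"
  unfolding iso_def[of "f \<odot> g"] inverses_def
  by (rule exI[of _ "arr_inv g \<odot> arr_inv f"])
    (simp add: iso_valid comp_inv inv_comp valid_in_Obj comp_inv[THEN comp_reassoc]
      inv_comp[THEN comp_reassoc])

lemma iso_tens [simp]: "\<lbrakk>iso f; iso g\<rbrakk> \<Longrightarrow> iso (f \<boxtimes> g)"
  unfolding iso_def[of "f \<boxtimes> g"] inverses_def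
  by (rule exI[of _ "arr_inv f \<boxtimes> arr_inv g"]) (simp add: iso_valid comp_inv inv_comp valid_in_Obj)

lemma iso_ide [simp]: "A \<in> Obj M \<Longrightarrow> iso (ide A)"
  unfolding iso_def inverses_def by (rule exI[of _ "ide A"]) simp

lemma \<alpha>_natural_ide:
  "\<lbrakk>A \<in> Obj M; B \<in> Obj M; valid h; cod h = D\<rbrakk>
   \<Longrightarrow> \<alpha> A B D \<odot> (ide (A \<otimes>\<^sub>o B) \<boxtimes> h) = (ide A \<boxtimes> (ide B \<boxtimes> h)) \<odot> \<alpha> A B (dom h)"
  using \<alpha>_natural[of "ide A" "ide B" h A B D] by simp

lemmas \<alpha>_nat = \<alpha>_natural \<alpha>_natural_ide
lemmas \<alpha>_nat_comp = \<alpha>_nat[THEN comp_reassoc]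

lemma \<alpha>'_natural:
  assumes [simp]: "valid f" "valid g" "valid h" and eqs: "cod f = A" "cod g = B" "cod h = D"
  shows "\<alpha>' A B D \<odot> (f \<boxtimes> (g \<boxtimes> h)) = ((f \<boxtimes> g) \<boxtimes> h) \<odot> \<alpha>' (dom f) (dom g) (dom h)"
proof -
  have [simp]: "A \<in> Obj M" "B \<in> Obj M" "D \<in> Obj M" "dom f \<in> Obj M" "dom g \<in> Obj M" "dom h \<in> Obj M"
    using eqs valid_in_Obj by auto
  note [simp] = eqs
  show ?thesis
    by (rule monoD[OF iso_imp_mono[of "\<alpha> A B D"]]) (simp_all add: \<alpha>_nat_comp)
qed

lemma \<alpha>'_natural_ide:
  "\<lbrakk>B \<in> Obj M; D \<in> Obj M; valid f; cod f = A\<rbrakk>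
   \<Longrightarrow> \<alpha>' A B D \<odot> (f \<boxtimes> ide (B \<otimes>\<^sub>o D)) = ((f \<boxtimes> ide B) \<boxtimes> ide D) \<odot> \<alpha>' (dom f) B D"
  using \<alpha>'_natural[of f "ide B" "ide D" A B D] by simp

lemmas \<alpha>'_nat = \<alpha>'_natural \<alpha>'_natural_ide
lemmas \<alpha>'_nat_comp = \<alpha>'_nat[THEN comp_reassoc]

text \<open>\<open>lu\<close> is a natural isomorphism from
  \<open>ide \<one>\<^sub>o \<boxtimes> (-)\<close> to the identity, so tensoring with the unit is
  faithful. Coherence laws can thus be proved after tensoring with the unit, where the pentagon and
  the triangle apply.\<close>

lemma tens_unit_cancel:
  assumes eq: "ide \<one>\<^sub>o \<boxtimes> f = ide \<one>\<^sub>o \<boxtimes> g"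
    and [simp]: "valid f" "valid g" "dom f = A" "dom g = A" "cod f = B" "cod g = B"
  shows "f = g"
proof (rule epiD[OF iso_imp_epi[of "lu A"]])
  have "A \<in> Obj M" using valid_in_Obj(1)[of f] by simp
  then show "iso (lu A)" by simp
  have "f \<odot> lu A = lu B \<odot> (ide \<one>\<^sub>o \<boxtimes> f)" using lu_natural[of f B] by simp
  also have "\<dots> = g \<odot> lu A" unfolding eq using lu_natural[of g B] by simp
  finally show "f \<odot> lu A = g \<odot> lu A" .
qed simp_all

lemma unit_tens_cancel:
  assumes eq: "f \<boxtimes> ide \<one>\<^sub>o = g \<boxtimes> ide \<one>\<^sub>o"
    and [simp]: "valid f" "valid g" "dom f = A" "dom g = A" "cod f = B" "cod g = B"
  shows "f = g"
proof (rule epiD[OF iso_imp_epi[of "ru A"]])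
  have "A \<in> Obj M" using valid_in_Obj(1)[of f] by simp
  then show "iso (ru A)" by simp
  have "f \<odot> ru A = ru B \<odot> (f \<boxtimes> ide \<one>\<^sub>o)" using ru_natural[of f B] by simp
  also have "\<dots> = g \<odot> ru A" unfolding eq using ru_natural[of g B] by simp
  finally show "f \<odot> ru A = g \<odot> ru A" .
qed simp_all

text \<open>Kelly's argument: take the pentagon for the unit twice, \<open>A\<close> and
  \<open>B\<close>, and replace the unit constraints by associators through the triangle and
  naturality. The claim appears tensored with the unit, and \<open>tens_unit_cancel\<close> removes
  it.\<close>

lemma lu_tensor:
  assumes [simp]: "A \<in> Obj M" "B \<in> Obj M"
  shows "lu (A \<otimes>\<^sub>o B) \<odot> \<alpha> \<one>\<^sub>o A B = lu A \<boxtimes> ide B"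
proof (rule tens_unit_cancel)
  have "(ide \<one>\<^sub>o \<boxtimes> (lu (A \<otimes>\<^sub>o B) \<odot> \<alpha> \<one>\<^sub>o A B)) \<odot> \<alpha> \<one>\<^sub>o (\<one>\<^sub>o \<otimes>\<^sub>o A) B \<odot> (\<alpha> \<one>\<^sub>o \<one>\<^sub>o A \<boxtimes> ide B)
    = (ru \<one>\<^sub>o \<boxtimes> ide (A \<otimes>\<^sub>o B)) \<odot> \<alpha> (\<one>\<^sub>o \<otimes>\<^sub>o \<one>\<^sub>o) A B"
    using arg_cong[OF pentagon_arrow[of "\<one>\<^sub>o" "\<one>\<^sub>o" A B], of "\<lambda>x. (ide \<one>\<^sub>o \<boxtimes> lu (A \<otimes>\<^sub>o B)) \<odot> x"]
    by (simp add: triangle_arrow[THEN comp_reassoc])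
  also have "\<dots> = \<alpha> \<one>\<^sub>o A B \<odot> ((ru \<one>\<^sub>o \<boxtimes> ide A) \<boxtimes> ide B)"
    by (simp add: \<alpha>_nat)
  also have "\<dots> = \<alpha> \<one>\<^sub>o A B \<odot> (((ide \<one>\<^sub>o \<boxtimes> lu A) \<odot> \<alpha> \<one>\<^sub>o \<one>\<^sub>o A) \<boxtimes> ide B)"
    by (simp only: triangle_arrow assms unit_Obj)
  also have "\<dots> = \<alpha> \<one>\<^sub>o A B \<odot> ((ide \<one>\<^sub>o \<boxtimes> lu A) \<boxtimes> ide B) \<odot> (\<alpha> \<one>\<^sub>o \<one>\<^sub>o A \<boxtimes> ide B)"
    by simp
  also have "\<dots> = (ide \<one>\<^sub>o \<boxtimes> (lu A \<boxtimes> ide B)) \<odot> \<alpha> \<one>\<^sub>o (\<one>\<^sub>o \<otimes>\<^sub>o A) B \<odot> (\<alpha> \<one>\<^sub>o \<one>\<^sub>o A \<boxtimes> ide B)"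
    by (simp del: interchange add: \<alpha>_nat_comp)
  finally show "ide \<one>\<^sub>o \<boxtimes> (lu (A \<otimes>\<^sub>o B) \<odot> \<alpha> \<one>\<^sub>o A B) = ide \<one>\<^sub>o \<boxtimes> (lu A \<boxtimes> ide B)"
    by (rule epiD[OF iso_imp_epi, rotated]) simp_all
qed simp_all

lemma lu_tensor_unit:
  assumes [simp]: "A \<in> Obj M"
  shows "lu (\<one>\<^sub>o \<otimes>\<^sub>o A) = ide \<one>\<^sub>o \<boxtimes> lu A"
  by (rule monoD[OF iso_imp_mono[of "lu A"]]) (simp_all add: lu_natural)

text \<open>\<open>lu_tensor\<close> and the triangle, both at the unit object, express the two
  sides tensored with the unit by the same composite.\<close>

lemma lu_unit: "lu \<one>\<^sub>o = ru \<one>\<^sub>o"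
proof (rule unit_tens_cancel)
  have "lu \<one>\<^sub>o \<boxtimes> ide \<one>\<^sub>o = lu (\<one>\<^sub>o \<otimes>\<^sub>o \<one>\<^sub>o) \<odot> \<alpha> \<one>\<^sub>o \<one>\<^sub>o \<one>\<^sub>o"
    by (simp add: lu_tensor)
  also have "\<dots> = ru \<one>\<^sub>o \<boxtimes> ide \<one>\<^sub>o"
    by (simp add: lu_tensor_unit triangle_arrow)
  finally show "lu \<one>\<^sub>o \<boxtimes> ide \<one>\<^sub>o = ru \<one>\<^sub>o \<boxtimes> ide \<one>\<^sub>o" .
qed simp_all

text \<open>Mirror image of \<open>lu_tensor\<close>, from the pentagon whose last two objects are
  the unit.\<close>

lemma ru_tensor:
  assumes [simp]: "A \<in> Obj M" "B \<in> Obj M"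
  shows "(ide A \<boxtimes> ru B) \<odot> \<alpha> A B \<one>\<^sub>o = ru (A \<otimes>\<^sub>o B)"
proof (rule unit_tens_cancel)
  have "\<alpha> A B \<one>\<^sub>o \<odot> (ru (A \<otimes>\<^sub>o B) \<boxtimes> ide \<one>\<^sub>o)
     = \<alpha> A B \<one>\<^sub>o \<odot> (ide (A \<otimes>\<^sub>o B) \<boxtimes> lu \<one>\<^sub>o) \<odot> \<alpha> (A \<otimes>\<^sub>o B) \<one>\<^sub>o \<one>\<^sub>o"
    by (simp only: triangle_arrow unit_Obj tensor_Obj assms)
  also have "\<dots> = (ide A \<boxtimes> (ide B \<boxtimes> lu \<one>\<^sub>o)) \<odot> \<alpha> A B (\<one>\<^sub>o \<otimes>\<^sub>o \<one>\<^sub>o) \<odot> \<alpha> (A \<otimes>\<^sub>o B) \<one>\<^sub>o \<one>\<^sub>o"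
    by (simp add: \<alpha>_nat_comp)
  also have "\<dots> = (ide A \<boxtimes> (ide B \<boxtimes> lu \<one>\<^sub>o)) \<odot> (ide A \<boxtimes> \<alpha> B \<one>\<^sub>o \<one>\<^sub>o) \<odot> \<alpha> A (B \<otimes>\<^sub>o \<one>\<^sub>o) \<one>\<^sub>o \<odot> (\<alpha> A B \<one>\<^sub>o \<boxtimes> ide \<one>\<^sub>o)"
    by (simp only: pentagon_arrow unit_Obj assms)
  also have "\<dots> = (ide A \<boxtimes> (ru B \<boxtimes> ide \<one>\<^sub>o)) \<odot> \<alpha> A (B \<otimes>\<^sub>o \<one>\<^sub>o) \<one>\<^sub>o \<odot> (\<alpha> A B \<one>\<^sub>o \<boxtimes> ide \<one>\<^sub>o)"
    by (simp add: triangle_arrow)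
  also have "\<dots> = \<alpha> A B \<one>\<^sub>o \<odot> (((ide A \<boxtimes> ru B) \<odot> \<alpha> A B \<one>\<^sub>o) \<boxtimes> ide \<one>\<^sub>o)"
    using \<alpha>_natural[of "ide A" "ru B" "ide \<one>\<^sub>o", THEN comp_reassoc, of A B "\<one>\<^sub>o" "\<alpha> A B \<one>\<^sub>o \<boxtimes> ide \<one>\<^sub>o"] by simp
  finally show "((ide A \<boxtimes> ru B) \<odot> \<alpha> A B \<one>\<^sub>o) \<boxtimes> ide \<one>\<^sub>o = ru (A \<otimes>\<^sub>o B) \<boxtimes> ide \<one>\<^sub>o"
    by (rule monoD[OF iso_imp_mono[of "\<alpha> A B \<one>\<^sub>o"], THEN sym, rotated]) simp_all
qed simp_all

text \<open>For the isomorphism f = \<open>lu A \<odot> br A \<one>\<^sub>o\<close>, the hexagon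
  with two unit factors becomes f (ru \<otimes> 1) = f (f \<otimes> 1). Cancelling f and then the
  unit factor leaves ru = f.\<close>

lemma lu_br:
  assumes [simp]: "A \<in> Obj M"
  shows "lu A \<odot> br A \<one>\<^sub>o = ru A"
proof (rule unit_tens_cancel)
  have "br A \<one>\<^sub>o \<odot> (ru A \<boxtimes> ide \<one>\<^sub>o) = br A \<one>\<^sub>o \<odot> (ide A \<boxtimes> lu \<one>\<^sub>o) \<odot> \<alpha> A \<one>\<^sub>o \<one>\<^sub>o"
    by (simp add: triangle_arrow)
  also have "\<dots> = (lu \<one>\<^sub>o \<boxtimes> ide A) \<odot> br A (\<one>\<^sub>o \<otimes>\<^sub>o \<one>\<^sub>o) \<odot> \<alpha> A \<one>\<^sub>o \<one>\<^sub>o"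
    by (simp add: br_natural[THEN comp_reassoc])
  also have "\<dots> = (ide \<one>\<^sub>o \<boxtimes> lu A) \<odot> \<alpha> \<one>\<^sub>o \<one>\<^sub>o A \<odot> br A (\<one>\<^sub>o \<otimes>\<^sub>o \<one>\<^sub>o) \<odot> \<alpha> A \<one>\<^sub>o \<one>\<^sub>o"
    by (simp add: triangle_arrow[THEN comp_reassoc] lu_unit)
  also have "\<dots> = (ide \<one>\<^sub>o \<boxtimes> lu A) \<odot> (ide \<one>\<^sub>o \<boxtimes> br A \<one>\<^sub>o) \<odot> \<alpha> \<one>\<^sub>o A \<one>\<^sub>o \<odot> (br A \<one>\<^sub>o \<boxtimes> ide \<one>\<^sub>o)"
    by (simp only: hexagon_arrow assms unit_Obj)
  finally have "lu A \<odot> br A \<one>\<^sub>o \<odot> (ru A \<boxtimes> ide \<one>\<^sub>o)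
     = lu A \<odot> (ide \<one>\<^sub>o \<boxtimes> (lu A \<odot> br A \<one>\<^sub>o)) \<odot> \<alpha> \<one>\<^sub>o A \<one>\<^sub>o \<odot> (br A \<one>\<^sub>o \<boxtimes> ide \<one>\<^sub>o)"
    by simp
  also have "\<dots> = lu A \<odot> br A \<one>\<^sub>o \<odot> ((lu A \<odot> br A \<one>\<^sub>o) \<boxtimes> ide \<one>\<^sub>o)"
    by (simp add: lu_natural[THEN comp_reassoc] lu_tensor[THEN comp_reassoc])
  finally have "(lu A \<odot> br A \<one>\<^sub>o) \<odot> (ru A \<boxtimes> ide \<one>\<^sub>o) = (lu A \<odot> br A \<one>\<^sub>o) \<odot> ((lu A \<odot> br A \<one>\<^sub>o) \<boxtimes> ide \<one>\<^sub>o)"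
    by simp
  then show "(lu A \<odot> br A \<one>\<^sub>o) \<boxtimes> ide \<one>\<^sub>o = ru A \<boxtimes> ide \<one>\<^sub>o"
    by (rule monoD[OF iso_imp_mono, THEN sym, rotated]) simp_all
qed simp_all

lemma ru_br:
  assumes [simp]: "A \<in> Obj M"
  shows "ru A \<odot> br \<one>\<^sub>o A = lu A"
  by (simp add: lu_br[symmetric])

section \<open>Transposing adjacent tensor factors\<close>

definition sw :: "'o \<Rightarrow> 'o \<Rightarrow> 'o \<Rightarrow> ('o, 'm) arrow" where
  "sw B D E = \<alpha> D B E \<odot> (br B D \<boxtimes> ide E) \<odot> \<alpha>' B D E"

text \<open>The typed version of \<open>middle_swap\<close>. Isolating \<open>sw\<close>, an
  adjacent transposition in a right-nested word, reduces each law of \<open>ms\<close> to laws of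
  \<open>sw\<close>.\<close>

definition ms :: "'o \<Rightarrow> 'o \<Rightarrow> 'o \<Rightarrow> 'o \<Rightarrow> ('o, 'm) arrow" where
  "ms A B D E = \<alpha>' A D (B \<otimes>\<^sub>o E) \<odot> (ide A \<boxtimes> sw B D E) \<odot> \<alpha> A B (D \<otimes>\<^sub>o E)"

lemma sw_in_hom [simp]: "\<lbrakk>B \<in> Obj M; D \<in> Obj M; E \<in> Obj M\<rbrakk>
    \<Longrightarrow> \<guillemotleft>sw B D E : B \<otimes>\<^sub>o (D \<otimes>\<^sub>o E) \<rightarrow> D \<otimes>\<^sub>o (B \<otimes>\<^sub>o E)\<guillemotright>"
  by (simp add: sw_def)

lemma ms_in_hom [simp]: "\<lbrakk>A \<in> Obj M; B \<in> Obj M; D \<in> Obj M; E \<in> Obj M\<rbrakk>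
    \<Longrightarrow> \<guillemotleft>ms A B D E : (A \<otimes>\<^sub>o B) \<otimes>\<^sub>o (D \<otimes>\<^sub>o E) \<rightarrow> (A \<otimes>\<^sub>o D) \<otimes>\<^sub>o (B \<otimes>\<^sub>o E)\<guillemotright>"
  by (simp add: ms_def)

lemma sw_sw [simp]: "\<lbrakk>B \<in> Obj M; D \<in> Obj M; E \<in> Obj M\<rbrakk> \<Longrightarrow> sw D B E \<odot> sw B D E = ide (B \<otimes>\<^sub>o (D \<otimes>\<^sub>o E))"
  by (simp add: sw_def)

lemmas sw_sw_comp [simp] = sw_sw[THEN comp_reassoc]

lemma sw_natural:
  assumes [simp]: "valid f" "valid g" "valid h" and eqs: "cod f = B" "cod g = D" "cod h = E"
  shows "sw B D E \<odot> (f \<boxtimes> (g \<boxtimes> h)) = (g \<boxtimes> (f \<boxtimes> h)) \<odot> sw (dom f) (dom g) (dom h)"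
proof -
  have [simp]: "B \<in> Obj M" "D \<in> Obj M" "E \<in> Obj M" "dom f \<in> Obj M" "dom g \<in> Obj M" "dom h \<in> Obj M"
    using eqs valid_in_Obj by auto
  note [simp] = eqs
  have *: "(br B D \<boxtimes> ide E) \<odot> ((f \<boxtimes> g) \<boxtimes> h) \<odot> x = ((g \<boxtimes> f) \<boxtimes> h) \<odot> (br (dom f) (dom g) \<boxtimes> ide (dom h)) \<odot> x" for x
    by (simp add: br_natural)
  show ?thesis
    unfolding sw_def comp_assoc
    by (simp add: \<alpha>'_nat del: interchange) (simp add: * \<alpha>_nat_comp del: interchange)
qed

lemma ms_natural:
  assumes [simp]: "valid f" "valid g" "valid h" "valid k"
    and eqs: "cod f = A" "cod g = B" "cod h = D" "cod k = E"
  shows "ms A B D E \<odot> ((f \<boxtimes> g) \<boxtimes> (h \<boxtimes> k)) = ((f \<boxtimes> h) \<boxtimes> (g \<boxtimes> k)) \<odot> ms (dom f) (dom g) (dom h) (dom k)"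
proof -
  have [simp]: "A \<in> Obj M" "B \<in> Obj M" "D \<in> Obj M" "E \<in> Obj M"
    "dom f \<in> Obj M" "dom g \<in> Obj M" "dom h \<in> Obj M" "dom k \<in> Obj M"
    using eqs valid_in_Obj by auto
  note [simp] = eqs
  have *: "(ide A \<boxtimes> sw B D E) \<odot> (f \<boxtimes> (g \<boxtimes> (h \<boxtimes> k))) \<odot> x =
     (f \<boxtimes> (h \<boxtimes> (g \<boxtimes> k))) \<odot> (ide (dom f) \<boxtimes> sw (dom g) (dom h) (dom k)) \<odot> x" for x
    by (simp add: sw_natural)
  show ?thesis
    unfolding ms_def comp_assoc
    by (simp add: \<alpha>_nat del: interchange) (simp add: * \<alpha>'_nat_comp del: interchange)
qed

lemma \<alpha>_ms: "\<lbrakk>A \<in> Obj M; B \<in> Obj M; D \<in> Obj M; E \<in> Obj M\<rbrakk>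
    \<Longrightarrow> \<alpha> A D (B \<otimes>\<^sub>o E) \<odot> ms A B D E = (ide A \<boxtimes> sw B D E) \<odot> \<alpha> A B (D \<otimes>\<^sub>o E)"
  by (simp add: ms_def)

lemma sw_unit_left:
  assumes [simp]: "D \<in> Obj M" "E \<in> Obj M"
  shows "(ide D \<boxtimes> lu E) \<odot> sw \<one>\<^sub>o D E = lu (D \<otimes>\<^sub>o E)"
proof -
  have "(ide D \<boxtimes> lu E) \<odot> sw \<one>\<^sub>o D E = (lu D \<boxtimes> ide E) \<odot> \<alpha>' \<one>\<^sub>o D E"
    by (simp add: sw_def triangle_arrow[THEN comp_reassoc] ru_br)
  also have "\<dots> = lu (D \<otimes>\<^sub>o E)"
    by (simp flip: lu_tensor)
  finally show ?thesis .
qed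

lemma sw_unit_right:
  assumes [simp]: "B \<in> Obj M" "E \<in> Obj M"
  shows "lu (B \<otimes>\<^sub>o E) \<odot> sw B \<one>\<^sub>o E = ide B \<boxtimes> lu E"
proof -
  have "lu (B \<otimes>\<^sub>o E) \<odot> sw B \<one>\<^sub>o E = ((lu B \<odot> br B \<one>\<^sub>o) \<boxtimes> ide E) \<odot> \<alpha>' B \<one>\<^sub>o E"
    by (simp add: sw_def lu_tensor[THEN comp_reassoc])
  also have "\<dots> = ide B \<boxtimes> lu E"
    by (simp add: lu_br flip: triangle_arrow)
  finally show ?thesis .
qed

lemma pentagon_partial:
  assumes [simp]: "A \<in> Obj M" "B \<in> Obj M" "D \<in> Obj M" "E \<in> Obj M"
  shows "\<alpha> A (B \<otimes>\<^sub>o D) E \<odot> (\<alpha> A B D \<boxtimes> ide E) = (ide A \<boxtimes> \<alpha>' B D E) \<odot> \<alpha> A B (D \<otimes>\<^sub>o E) \<odot> \<alpha> (A \<otimes>\<^sub>o B) D E"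
  using arg_cong[OF pentagon_arrow[of A B D E], of "\<lambda>x. (ide A \<boxtimes> \<alpha>' B D E) \<odot> x"] by simp

lemma pentagon_inverse:
  assumes [simp]: "A \<in> Obj M" "B \<in> Obj M" "D \<in> Obj M" "E \<in> Obj M"
  shows "\<alpha> (A \<otimes>\<^sub>o B) D E \<odot> (\<alpha>' A B D \<boxtimes> ide E) \<odot> \<alpha>' A (B \<otimes>\<^sub>o D) E = \<alpha>' A B (D \<otimes>\<^sub>o E) \<odot> (ide A \<boxtimes> \<alpha> B D E)"
proof (rule monoD[OF iso_imp_mono[of "\<alpha> A B (D \<otimes>\<^sub>o E)"]])
  show "\<alpha> A B (D \<otimes>\<^sub>o E) \<odot> \<alpha> (A \<otimes>\<^sub>o B) D E \<odot> (\<alpha>' A B D \<boxtimes> ide E) \<odot> \<alpha>' A (B \<otimes>\<^sub>o D) E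
      = \<alpha> A B (D \<otimes>\<^sub>o E) \<odot> \<alpha>' A B (D \<otimes>\<^sub>o E) \<odot> (ide A \<boxtimes> \<alpha> B D E)"
    using arg_cong[OF pentagon_arrow[of A B D E], of "\<lambda>x. x \<odot> (\<alpha>' A B D \<boxtimes> ide E) \<odot> \<alpha>' A (B \<otimes>\<^sub>o D) E"] by simp
qed simp_all

text \<open>The hexagon in terms of \<open>sw\<close>: moving \<open>D\<close> past X \<otimes> Y
  means moving it past \<open>X\<close> and then past \<open>Y\<close>. Two rearranged pentagons
  bring the associators into place.\<close>

lemma sw_tensor_mid:
  assumes [simp]: "X \<in> Obj M" "Y \<in> Obj M" "D \<in> Obj M" "Z \<in> Obj M"
  shows "\<alpha> X Y (D \<otimes>\<^sub>o Z) \<odot> sw D (X \<otimes>\<^sub>o Y) Z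
     = (ide X \<boxtimes> sw D Y Z) \<odot> sw D X (Y \<otimes>\<^sub>o Z) \<odot> (ide D \<boxtimes> \<alpha> X Y Z)"
proof -
  have hex: "\<alpha> X Y D \<odot> br D (X \<otimes>\<^sub>o Y) = (ide X \<boxtimes> br D Y) \<odot> \<alpha> X D Y \<odot> (br D X \<boxtimes> ide Y) \<odot> \<alpha>' D X Y"
    using arg_cong[OF hexagon_arrow[of D X Y], of "\<lambda>x. x \<odot> \<alpha>' D X Y"] by simp
  have "\<alpha> X Y (D \<otimes>\<^sub>o Z) \<odot> sw D (X \<otimes>\<^sub>o Y) Z
     = (ide X \<boxtimes> \<alpha> Y D Z) \<odot> \<alpha> X (Y \<otimes>\<^sub>o D) Z \<odot> ((\<alpha> X Y D \<odot> br D (X \<otimes>\<^sub>o Y)) \<boxtimes> ide Z) \<odot> \<alpha>' D (X \<otimes>\<^sub>o Y) Z"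
    using pentagon_arrow[of X Y D Z, THEN arg_cong, of "\<lambda>x. x \<odot> (br D (X \<otimes>\<^sub>o Y) \<boxtimes> ide Z) \<odot> \<alpha>' D (X \<otimes>\<^sub>o Y) Z"]
    by (simp add: sw_def)
  also have "\<dots> = (ide X \<boxtimes> \<alpha> Y D Z) \<odot> \<alpha> X (Y \<otimes>\<^sub>o D) Z \<odot> ((ide X \<boxtimes> br D Y) \<boxtimes> ide Z) \<odot> (\<alpha> X D Y \<boxtimes> ide Z)
     \<odot> ((br D X \<boxtimes> ide Y) \<boxtimes> ide Z) \<odot> (\<alpha>' D X Y \<boxtimes> ide Z) \<odot> \<alpha>' D (X \<otimes>\<^sub>o Y) Z"
    by (simp add: hex)
  also have "\<dots> = (ide X \<boxtimes> \<alpha> Y D Z) \<odot> (ide X \<boxtimes> (br D Y \<boxtimes> ide Z)) \<odot> (\<alpha> X (D \<otimes>\<^sub>o Y) Z \<odot> (\<alpha> X D Y \<boxtimes> ide Z))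
     \<odot> ((br D X \<boxtimes> ide Y) \<boxtimes> ide Z) \<odot> (\<alpha>' D X Y \<boxtimes> ide Z) \<odot> \<alpha>' D (X \<otimes>\<^sub>o Y) Z"
    by (simp del: interchange add: \<alpha>_nat_comp)
  also have "\<dots> = (ide X \<boxtimes> sw D Y Z) \<odot> \<alpha> X D (Y \<otimes>\<^sub>o Z) \<odot> \<alpha> (X \<otimes>\<^sub>o D) Y Z
     \<odot> ((br D X \<boxtimes> ide Y) \<boxtimes> ide Z) \<odot> (\<alpha>' D X Y \<boxtimes> ide Z) \<odot> \<alpha>' D (X \<otimes>\<^sub>o Y) Z"
    unfolding pentagon_partial[OF assms(1,3,2,4)] sw_def by simp
  also have "\<dots> = (ide X \<boxtimes> sw D Y Z) \<odot> \<alpha> X D (Y \<otimes>\<^sub>o Z) \<odot> (br D X \<boxtimes> ide (Y \<otimes>\<^sub>o Z)) \<odot>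
      (\<alpha> (D \<otimes>\<^sub>o X) Y Z \<odot> (\<alpha>' D X Y \<boxtimes> ide Z) \<odot> \<alpha>' D (X \<otimes>\<^sub>o Y) Z)"
    by (simp del: interchange add: \<alpha>_nat_comp)
  also have "\<dots> = (ide X \<boxtimes> sw D Y Z) \<odot> sw D X (Y \<otimes>\<^sub>o Z) \<odot> (ide D \<boxtimes> \<alpha> X Y Z)"
    unfolding pentagon_inverse[OF assms(3,1,2,4)] by (simp add: sw_def)
  finally show ?thesis .
qed

text \<open>Read \<open>sw_tensor_mid\<close> backwards. As the braiding is a symmetry, the inverse
  of a transposition is again a transposition, so a compound factor in the first slot is covered
  too.\<close>

lemma sw_tensor_left:
  assumes [simp]: "B \<in> Obj M" "D \<in> Obj M" "X \<in> Obj M" "W \<in> Obj M"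
  shows "(ide X \<boxtimes> \<alpha> B D W) \<odot> sw (B \<otimes>\<^sub>o D) X W
     = sw B X (D \<otimes>\<^sub>o W) \<odot> (ide B \<boxtimes> sw D X W) \<odot> \<alpha> B D (X \<otimes>\<^sub>o W)"
  using sw_tensor_mid[of B D X W, THEN arg_cong,
      of "\<lambda>x. sw B X (D \<otimes>\<^sub>o W) \<odot> (ide B \<boxtimes> sw D X W) \<odot> x \<odot> sw (B \<otimes>\<^sub>o D) X W"]
  by simp

lemma sw_tensor_right:
  assumes [simp]: "B \<in> Obj M" "X \<in> Obj M" "Y \<in> Obj M" "W \<in> Obj M"
  shows "sw B X (Y \<otimes>\<^sub>o W) \<odot> (ide B \<boxtimes> \<alpha> X Y W) \<odot> \<alpha> B (X \<otimes>\<^sub>o Y) W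
     = (ide X \<boxtimes> \<alpha> B Y W) \<odot> \<alpha> X (B \<otimes>\<^sub>o Y) W \<odot> (sw B X Y \<boxtimes> ide W)"
proof -
  have "(ide X \<boxtimes> \<alpha> B Y W) \<odot> \<alpha> X (B \<otimes>\<^sub>o Y) W \<odot> (sw B X Y \<boxtimes> ide W)
     = (ide X \<boxtimes> \<alpha> B Y W) \<odot> (\<alpha> X (B \<otimes>\<^sub>o Y) W \<odot> (\<alpha> X B Y \<boxtimes> ide W)) \<odot> ((br B X \<boxtimes> ide Y) \<boxtimes> ide W) \<odot> (\<alpha>' B X Y \<boxtimes> ide W)"
    by (simp add: sw_def)
  also have "\<dots> = \<alpha> X B (Y \<otimes>\<^sub>o W) \<odot> \<alpha> (X \<otimes>\<^sub>o B) Y W \<odot> ((br B X \<boxtimes> ide Y) \<boxtimes> ide W) \<odot> (\<alpha>' B X Y \<boxtimes> ide W)"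
    unfolding pentagon_partial[OF assms(2,1,3,4)] by simp
  also have "\<dots> = \<alpha> X B (Y \<otimes>\<^sub>o W) \<odot> (br B X \<boxtimes> ide (Y \<otimes>\<^sub>o W)) \<odot> \<alpha> (B \<otimes>\<^sub>o X) Y W \<odot> (\<alpha>' B X Y \<boxtimes> ide W)"
    by (simp del: interchange add: \<alpha>_nat_comp)
  also have "\<dots> = \<alpha> X B (Y \<otimes>\<^sub>o W) \<odot> (br B X \<boxtimes> ide (Y \<otimes>\<^sub>o W)) \<odot>
      (\<alpha> (B \<otimes>\<^sub>o X) Y W \<odot> (\<alpha>' B X Y \<boxtimes> ide W) \<odot> \<alpha>' B (X \<otimes>\<^sub>o Y) W) \<odot> \<alpha> B (X \<otimes>\<^sub>o Y) W"
    by simp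
  also have "\<dots> = sw B X (Y \<otimes>\<^sub>o W) \<odot> (ide B \<boxtimes> \<alpha> X Y W) \<odot> \<alpha> B (X \<otimes>\<^sub>o Y) W"
    unfolding pentagon_inverse[OF assms] by (simp add: sw_def)
  finally show ?thesis by simp
qed

text \<open>The isomorphism \<open>?F\<close> renests the target to the right. There both sides are
  products of the same three transpositions, \<open>B\<close> past \<open>X\<close>,
  \<open>D\<close> past \<open>X\<close> and \<open>D\<close> past \<open>Y\<close>. They differ
  only in the order of \<open>B\<close> past \<open>X\<close> and \<open>D\<close> past
  \<open>Y\<close>, which commute by naturality of \<open>sw\<close>. This is the coherence behind
  coassociativity of a tensor product of comonoids.\<close>

lemma ms_assoc:
  assumes [simp]: "A \<in> Obj M" "B \<in> Obj M" "D \<in> Obj M" "X \<in> Obj M" "Y \<in> Obj M" "Z \<in> Obj M"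
  shows "\<alpha> (A \<otimes>\<^sub>o X) (B \<otimes>\<^sub>o Y) (D \<otimes>\<^sub>o Z) \<odot> (ms A B X Y \<boxtimes> ide (D \<otimes>\<^sub>o Z)) \<odot> ms (A \<otimes>\<^sub>o B) D (X \<otimes>\<^sub>o Y) Z
     = (ide (A \<otimes>\<^sub>o X) \<boxtimes> ms B D Y Z) \<odot> ms A (B \<otimes>\<^sub>o D) X (Y \<otimes>\<^sub>o Z) \<odot> (\<alpha> A B D \<boxtimes> \<alpha> X Y Z)"
proof -
  let ?V = "X \<otimes>\<^sub>o (Y \<otimes>\<^sub>o Z)"
  let ?C = "D \<otimes>\<^sub>o Z"
  let ?T = "(ide X \<boxtimes> (ide B \<boxtimes> sw D Y Z)) \<odot> sw B X (D \<otimes>\<^sub>o (Y \<otimes>\<^sub>o Z)) \<odot> (ide B \<boxtimes> sw D X (Y \<otimes>\<^sub>o Z))"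
  let ?F = "(ide A \<boxtimes> (ide X \<boxtimes> \<alpha> B Y ?C)) \<odot> \<alpha> A X ((B \<otimes>\<^sub>o Y) \<otimes>\<^sub>o ?C)"
  let ?L = "\<alpha> (A \<otimes>\<^sub>o X) (B \<otimes>\<^sub>o Y) ?C \<odot> (ms A B X Y \<boxtimes> ide ?C) \<odot> ms (A \<otimes>\<^sub>o B) D (X \<otimes>\<^sub>o Y) Z"
  let ?R = "(ide (A \<otimes>\<^sub>o X) \<boxtimes> ms B D Y Z) \<odot> ms A (B \<otimes>\<^sub>o D) X (Y \<otimes>\<^sub>o Z) \<odot> (\<alpha> A B D \<boxtimes> \<alpha> X Y Z)"
  have "?F \<odot> ?R = (ide A \<boxtimes> (ide X \<boxtimes> (\<alpha> B Y ?C \<odot> ms B D Y Z))) \<odot> (\<alpha> A X ((B \<otimes>\<^sub>o D) \<otimes>\<^sub>o (Y \<otimes>\<^sub>o Z)) \<odot> ms A (B \<otimes>\<^sub>o D) X (Y \<otimes>\<^sub>o Z)) \<odot> (\<alpha> A B D \<boxtimes> \<alpha> X Y Z)"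
    by (simp add: \<alpha>_nat_comp)
  also have "\<dots> = (ide A \<boxtimes> ((ide X \<boxtimes> (ide B \<boxtimes> sw D Y Z)) \<odot> ((ide X \<boxtimes> \<alpha> B D (Y \<otimes>\<^sub>o Z)) \<odot> sw (B \<otimes>\<^sub>o D) X (Y \<otimes>\<^sub>o Z)))) \<odot> \<alpha> A (B \<otimes>\<^sub>o D) ?V \<odot> (\<alpha> A B D \<boxtimes> \<alpha> X Y Z)"
    by (simp add: \<alpha>_ms)
  also have "\<dots> = (ide A \<boxtimes> ?T) \<odot> (ide A \<boxtimes> \<alpha> B D ?V) \<odot> \<alpha> A (B \<otimes>\<^sub>o D) ?V \<odot> (\<alpha> A B D \<boxtimes> ide ?V) \<odot> (ide ((A \<otimes>\<^sub>o B) \<otimes>\<^sub>o D) \<boxtimes> \<alpha> X Y Z)"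
    by (simp add: sw_tensor_left)
  also have "\<dots> = (ide A \<boxtimes> ?T) \<odot> \<alpha> A B (D \<otimes>\<^sub>o ?V) \<odot> \<alpha> (A \<otimes>\<^sub>o B) D ?V \<odot> (ide ((A \<otimes>\<^sub>o B) \<otimes>\<^sub>o D) \<boxtimes> \<alpha> X Y Z)"
    using pentagon_arrow[of A B D ?V, THEN comp_reassoc3, of "ide ((A \<otimes>\<^sub>o B) \<otimes>\<^sub>o D) \<boxtimes> \<alpha> X Y Z"]
    by (simp del: interchange)
  also have "\<dots> = (ide A \<boxtimes> ?T) \<odot> (ide A \<boxtimes> (ide B \<boxtimes> (ide D \<boxtimes> \<alpha> X Y Z))) \<odot> \<alpha> A B (D \<otimes>\<^sub>o ((X \<otimes>\<^sub>o Y) \<otimes>\<^sub>o Z)) \<odot> \<alpha> (A \<otimes>\<^sub>o B) D ((X \<otimes>\<^sub>o Y) \<otimes>\<^sub>o Z)"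
    by (simp del: interchange add: \<alpha>_nat \<alpha>_nat_comp)
  finally have R: "?F \<odot> ?R = (ide A \<boxtimes> (?T \<odot> (ide B \<boxtimes> (ide D \<boxtimes> \<alpha> X Y Z)))) \<odot> \<alpha> A B (D \<otimes>\<^sub>o ((X \<otimes>\<^sub>o Y) \<otimes>\<^sub>o Z)) \<odot> \<alpha> (A \<otimes>\<^sub>o B) D ((X \<otimes>\<^sub>o Y) \<otimes>\<^sub>o Z)"
    by simp
  have "?F \<odot> ?L = (ide A \<boxtimes> (ide X \<boxtimes> \<alpha> B Y ?C)) \<odot> (\<alpha> A X ((B \<otimes>\<^sub>o Y) \<otimes>\<^sub>o ?C) \<odot> \<alpha> (A \<otimes>\<^sub>o X) (B \<otimes>\<^sub>o Y) ?C) \<odot> (ms A B X Y \<boxtimes> ide ?C) \<odot> ms (A \<otimes>\<^sub>o B) D (X \<otimes>\<^sub>o Y) Z"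
    by simp
  also have "\<dots> = (ide A \<boxtimes> (ide X \<boxtimes> \<alpha> B Y ?C)) \<odot> ((ide A \<boxtimes> \<alpha> X (B \<otimes>\<^sub>o Y) ?C) \<odot> \<alpha> A (X \<otimes>\<^sub>o (B \<otimes>\<^sub>o Y)) ?C \<odot> (\<alpha> A X (B \<otimes>\<^sub>o Y) \<boxtimes> ide ?C)) \<odot> (ms A B X Y \<boxtimes> ide ?C) \<odot> ms (A \<otimes>\<^sub>o B) D (X \<otimes>\<^sub>o Y) Z"
    by (simp only: pentagon_arrow assms tensor_Obj)
  also have "\<dots> = (ide A \<boxtimes> ((ide X \<boxtimes> \<alpha> B Y ?C) \<odot> \<alpha> X (B \<otimes>\<^sub>o Y) ?C)) \<odot> \<alpha> A (X \<otimes>\<^sub>o (B \<otimes>\<^sub>o Y)) ?C \<odot> ((\<alpha> A X (B \<otimes>\<^sub>o Y) \<odot> ms A B X Y) \<boxtimes> ide ?C) \<odot> ms (A \<otimes>\<^sub>o B) D (X \<otimes>\<^sub>o Y) Z"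
    by simp
  also have "\<dots> = (ide A \<boxtimes> ((ide X \<boxtimes> \<alpha> B Y ?C) \<odot> \<alpha> X (B \<otimes>\<^sub>o Y) ?C)) \<odot> \<alpha> A (X \<otimes>\<^sub>o (B \<otimes>\<^sub>o Y)) ?C \<odot> ((ide A \<boxtimes> sw B X Y) \<boxtimes> ide ?C) \<odot> (\<alpha> A B (X \<otimes>\<^sub>o Y) \<boxtimes> ide ?C) \<odot> ms (A \<otimes>\<^sub>o B) D (X \<otimes>\<^sub>o Y) Z"
    by (simp add: \<alpha>_ms)
  also have "\<dots> = (ide A \<boxtimes> ((ide X \<boxtimes> \<alpha> B Y ?C) \<odot> \<alpha> X (B \<otimes>\<^sub>o Y) ?C)) \<odot> (ide A \<boxtimes> (sw B X Y \<boxtimes> ide ?C)) \<odot> \<alpha> A (B \<otimes>\<^sub>o (X \<otimes>\<^sub>o Y)) ?C \<odot> (\<alpha> A B (X \<otimes>\<^sub>o Y) \<boxtimes> ide ?C) \<odot> ms (A \<otimes>\<^sub>o B) D (X \<otimes>\<^sub>o Y) Z"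
    by (simp del: interchange add: \<alpha>_nat_comp)
  also have "\<dots> = (ide A \<boxtimes> (sw B X (Y \<otimes>\<^sub>o ?C) \<odot> (ide B \<boxtimes> \<alpha> X Y ?C) \<odot> \<alpha> B (X \<otimes>\<^sub>o Y) ?C)) \<odot> \<alpha> A (B \<otimes>\<^sub>o (X \<otimes>\<^sub>o Y)) ?C \<odot> (\<alpha> A B (X \<otimes>\<^sub>o Y) \<boxtimes> ide ?C) \<odot> ms (A \<otimes>\<^sub>o B) D (X \<otimes>\<^sub>o Y) Z"
    by (simp add: sw_tensor_right)
  also have "\<dots> = (ide A \<boxtimes> (sw B X (Y \<otimes>\<^sub>o ?C) \<odot> (ide B \<boxtimes> \<alpha> X Y ?C))) \<odot> ((ide A \<boxtimes> \<alpha> B (X \<otimes>\<^sub>o Y) ?C) \<odot> \<alpha> A (B \<otimes>\<^sub>o (X \<otimes>\<^sub>o Y)) ?C \<odot> (\<alpha> A B (X \<otimes>\<^sub>o Y) \<boxtimes> ide ?C)) \<odot> ms (A \<otimes>\<^sub>o B) D (X \<otimes>\<^sub>o Y) Z"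
    by simp
  also have "\<dots> = (ide A \<boxtimes> (sw B X (Y \<otimes>\<^sub>o ?C) \<odot> (ide B \<boxtimes> \<alpha> X Y ?C))) \<odot> \<alpha> A B ((X \<otimes>\<^sub>o Y) \<otimes>\<^sub>o ?C) \<odot> (\<alpha> (A \<otimes>\<^sub>o B) (X \<otimes>\<^sub>o Y) ?C \<odot> ms (A \<otimes>\<^sub>o B) D (X \<otimes>\<^sub>o Y) Z)"
    by (simp only: pentagon_arrow assms tensor_Obj comp_assoc)
  also have "\<dots> = (ide A \<boxtimes> (sw B X (Y \<otimes>\<^sub>o ?C) \<odot> (ide B \<boxtimes> \<alpha> X Y ?C))) \<odot> \<alpha> A B ((X \<otimes>\<^sub>o Y) \<otimes>\<^sub>o ?C) \<odot> (ide (A \<otimes>\<^sub>o B) \<boxtimes> sw D (X \<otimes>\<^sub>o Y) Z) \<odot> \<alpha> (A \<otimes>\<^sub>o B) D ((X \<otimes>\<^sub>o Y) \<otimes>\<^sub>o Z)"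
    by (simp only: \<alpha>_ms assms tensor_Obj comp_assoc)
  also have "\<dots> = (ide A \<boxtimes> (sw B X (Y \<otimes>\<^sub>o ?C) \<odot> (ide B \<boxtimes> (\<alpha> X Y ?C \<odot> sw D (X \<otimes>\<^sub>o Y) Z)))) \<odot> \<alpha> A B (D \<otimes>\<^sub>o ((X \<otimes>\<^sub>o Y) \<otimes>\<^sub>o Z)) \<odot> \<alpha> (A \<otimes>\<^sub>o B) D ((X \<otimes>\<^sub>o Y) \<otimes>\<^sub>o Z)"
    by (simp add: \<alpha>_nat_comp)
  also have "\<dots> = (ide A \<boxtimes> ((sw B X (Y \<otimes>\<^sub>o ?C) \<odot> (ide B \<boxtimes> (ide X \<boxtimes> sw D Y Z))) \<odot> (ide B \<boxtimes> sw D X (Y \<otimes>\<^sub>o Z)) \<odot> (ide B \<boxtimes> (ide D \<boxtimes> \<alpha> X Y Z)))) \<odot> \<alpha> A B (D \<otimes>\<^sub>o ((X \<otimes>\<^sub>o Y) \<otimes>\<^sub>o Z)) \<odot> \<alpha> (A \<otimes>\<^sub>o B) D ((X \<otimes>\<^sub>o Y) \<otimes>\<^sub>o Z)"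
    by (simp add: sw_tensor_mid)
  also have "\<dots> = ?F \<odot> ?R"
    unfolding R by (simp del: interchange add: sw_natural sw_natural[THEN comp_reassoc])
  finally have "?F \<odot> ?L = ?F \<odot> ?R" .
  then show ?thesis
    by (rule monoD[OF iso_imp_mono, rotated]) simp_all
qed

lemma ms_unit_left:
  assumes [simp]: "A \<in> Obj M" "X \<in> Obj M"
  shows "lu (A \<otimes>\<^sub>o X) \<odot> (lu \<one>\<^sub>o \<boxtimes> ide (A \<otimes>\<^sub>o X)) \<odot> ms \<one>\<^sub>o A \<one>\<^sub>o X = lu A \<boxtimes> lu X"
proof -
  have "lu (A \<otimes>\<^sub>o X) \<odot> (lu \<one>\<^sub>o \<boxtimes> ide (A \<otimes>\<^sub>o X)) \<odot> ms \<one>\<^sub>o A \<one>\<^sub>o X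
     = lu (A \<otimes>\<^sub>o X) \<odot> (ide \<one>\<^sub>o \<boxtimes> lu (A \<otimes>\<^sub>o X)) \<odot> (\<alpha> \<one>\<^sub>o \<one>\<^sub>o (A \<otimes>\<^sub>o X) \<odot> ms \<one>\<^sub>o A \<one>\<^sub>o X)"
    by (simp add: lu_unit flip: triangle_arrow)
  also have "\<dots> = lu (A \<otimes>\<^sub>o X) \<odot> (ide \<one>\<^sub>o \<boxtimes> (ide A \<boxtimes> lu X)) \<odot> \<alpha> \<one>\<^sub>o A (\<one>\<^sub>o \<otimes>\<^sub>o X)"
    by (simp add: \<alpha>_ms sw_unit_right)
  also have "\<dots> = (ide A \<boxtimes> lu X) \<odot> (lu (A \<otimes>\<^sub>o (\<one>\<^sub>o \<otimes>\<^sub>o X)) \<odot> \<alpha> \<one>\<^sub>o A (\<one>\<^sub>o \<otimes>\<^sub>o X))"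
    by (simp add: lu_natural[THEN comp_reassoc])
  also have "\<dots> = lu A \<boxtimes> lu X"
    by (simp add: lu_tensor)
  finally show ?thesis .
qed

text \<open>The hexagon splits the large braiding into transpositions of single factors. The one
  that moves \<open>X\<close> past \<open>B\<close> cancels against the transposition inside
  \<open>ms A B X Y\<close>; the other ones reassemble to the right-hand side.\<close>

lemma ms_br:
  assumes [simp]: "A \<in> Obj M" "B \<in> Obj M" "X \<in> Obj M" "Y \<in> Obj M"
  shows "br (A \<otimes>\<^sub>o X) (B \<otimes>\<^sub>o Y) \<odot> ms A B X Y = ms B A Y X \<odot> (br A B \<boxtimes> br X Y)"
proof -
  have hex: "\<alpha> B' D' A' \<odot> br A' (B' \<otimes>\<^sub>o D') = (ide B' \<boxtimes> br A' D') \<odot> sw A' B' D'"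
    if [simp]: "A' \<in> Obj M" "B' \<in> Obj M" "D' \<in> Obj M" for A' B' D'
    using arg_cong[OF hexagon_arrow[of A' B' D'], of "\<lambda>x. x \<odot> \<alpha>' A' B' D'"] by (simp add: sw_def)
  have hex': "br (A \<otimes>\<^sub>o X) Y = sw A Y X \<odot> (ide A \<boxtimes> br X Y) \<odot> \<alpha> A X Y"
    using arg_cong[OF hex[of Y A X], of "\<lambda>x. sw A Y X \<odot> (ide A \<boxtimes> br X Y) \<odot> x \<odot> br (A \<otimes>\<^sub>o X) Y"] by simp
  have "\<alpha> B Y (A \<otimes>\<^sub>o X) \<odot> br (A \<otimes>\<^sub>o X) (B \<otimes>\<^sub>o Y) \<odot> ms A B X Y
     = (ide B \<boxtimes> br (A \<otimes>\<^sub>o X) Y) \<odot> sw (A \<otimes>\<^sub>o X) B Y \<odot> ms A B X Y"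
    using hex[of "A \<otimes>\<^sub>o X" B Y, THEN comp_reassoc] by simp
  also have "\<dots> = (ide B \<boxtimes> (sw A Y X \<odot> (ide A \<boxtimes> br X Y))) \<odot> ((ide B \<boxtimes> \<alpha> A X Y) \<odot> sw (A \<otimes>\<^sub>o X) B Y) \<odot> ms A B X Y"
    by (simp add: hex')
  also have "\<dots> = (ide B \<boxtimes> (sw A Y X \<odot> (ide A \<boxtimes> br X Y))) \<odot> sw A B (X \<otimes>\<^sub>o Y) \<odot> (ide A \<boxtimes> sw X B Y) \<odot> (\<alpha> A X (B \<otimes>\<^sub>o Y) \<odot> ms A B X Y)"
    by (simp only: sw_tensor_left assms comp_assoc)
  also have "\<dots> = (ide B \<boxtimes> sw A Y X) \<odot> (ide B \<boxtimes> (ide A \<boxtimes> br X Y)) \<odot> sw A B (X \<otimes>\<^sub>o Y) \<odot> \<alpha> A B (X \<otimes>\<^sub>o Y)"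
    by (simp add: \<alpha>_ms)
  also have "\<dots> = (ide B \<boxtimes> sw A Y X) \<odot> \<alpha> B A (Y \<otimes>\<^sub>o X) \<odot> (br A B \<boxtimes> br X Y)"
    using \<alpha>_natural_ide[of B A "br X Y", THEN comp_reassoc, of "Y \<otimes>\<^sub>o X" "br A B \<boxtimes> ide (X \<otimes>\<^sub>o Y)"]
    by (simp add: sw_def)
  also have "\<dots> = \<alpha> B Y (A \<otimes>\<^sub>o X) \<odot> ms B A Y X \<odot> (br A B \<boxtimes> br X Y)"
    by (simp add: \<alpha>_ms[THEN comp_reassoc])
  finally show ?thesis
    by (rule monoD[OF iso_imp_mono, rotated]) simp_all
qed

lemma ms_unit_middle:
  assumes [simp]: "A \<in> Obj M" "B \<in> Obj M"
  shows "(ru A \<boxtimes> lu B) \<odot> ms A \<one>\<^sub>o \<one>\<^sub>o B = ru A \<boxtimes> lu B"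
proof -
  have *: "ru A \<boxtimes> lu B = (ide A \<boxtimes> (lu B \<odot> lu (\<one>\<^sub>o \<otimes>\<^sub>o B))) \<odot> \<alpha> A \<one>\<^sub>o (\<one>\<^sub>o \<otimes>\<^sub>o B)"
    using arg_cong[OF triangle_arrow[of A "\<one>\<^sub>o \<otimes>\<^sub>o B"], of "\<lambda>x. (ide A \<boxtimes> lu B) \<odot> x"] by simp
  have "lu (\<one>\<^sub>o \<otimes>\<^sub>o B) \<odot> sw \<one>\<^sub>o \<one>\<^sub>o B = lu (\<one>\<^sub>o \<otimes>\<^sub>o B)"
    using sw_unit_right[of "\<one>\<^sub>o" B] by (simp add: lu_tensor_unit)
  then show ?thesis
    unfolding * by (simp add: \<alpha>_ms)
qed

lemma ms_unit_right:
  assumes [simp]: "A \<in> Obj M" "B \<in> Obj M"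
  shows "(ru A \<boxtimes> ru B) \<odot> ms A B \<one>\<^sub>o \<one>\<^sub>o = ru (A \<otimes>\<^sub>o B) \<odot> (ide (A \<otimes>\<^sub>o B) \<boxtimes> lu \<one>\<^sub>o)"
proof -
  have *: "ru A \<boxtimes> ru B = (ide A \<boxtimes> (ru B \<odot> lu (B \<otimes>\<^sub>o \<one>\<^sub>o))) \<odot> \<alpha> A \<one>\<^sub>o (B \<otimes>\<^sub>o \<one>\<^sub>o)"
    using arg_cong[OF triangle_arrow[of A "B \<otimes>\<^sub>o \<one>\<^sub>o"], of "\<lambda>x. (ide A \<boxtimes> ru B) \<odot> x"] by simp
  have "(ru A \<boxtimes> ru B) \<odot> ms A B \<one>\<^sub>o \<one>\<^sub>o = (ide A \<boxtimes> (ru B \<odot> (ide B \<boxtimes> lu \<one>\<^sub>o))) \<odot> \<alpha> A B (\<one>\<^sub>o \<otimes>\<^sub>o \<one>\<^sub>o)"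
    unfolding * by (simp add: \<alpha>_ms sw_unit_right)
  also have "\<dots> = ((ide A \<boxtimes> ru B) \<odot> \<alpha> A B \<one>\<^sub>o) \<odot> (ide (A \<otimes>\<^sub>o B) \<boxtimes> lu \<one>\<^sub>o)"
    by (simp add: \<alpha>_nat)
  also have "\<dots> = ru (A \<otimes>\<^sub>o B) \<odot> (ide (A \<otimes>\<^sub>o B) \<boxtimes> lu \<one>\<^sub>o)"
    by (simp only: ru_tensor assms)
  finally show ?thesis .
qed

lemma ms_unit_left_left:
  assumes [simp]: "A \<in> Obj M" "B \<in> Obj M"
  shows "(lu A \<boxtimes> lu B) \<odot> ms \<one>\<^sub>o \<one>\<^sub>o A B = lu (A \<otimes>\<^sub>o B) \<odot> (lu \<one>\<^sub>o \<boxtimes> ide (A \<otimes>\<^sub>o B))"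
proof -
  have "lu A \<boxtimes> lu B = (ide A \<boxtimes> lu B) \<odot> (lu A \<boxtimes> ide (\<one>\<^sub>o \<otimes>\<^sub>o B))"
    by simp
  also have "\<dots> = (ide A \<boxtimes> lu B) \<odot> lu (A \<otimes>\<^sub>o (\<one>\<^sub>o \<otimes>\<^sub>o B)) \<odot> \<alpha> \<one>\<^sub>o A (\<one>\<^sub>o \<otimes>\<^sub>o B)"
    by (simp only: lu_tensor assms unit_Obj tensor_Obj)
  finally have *: "lu A \<boxtimes> lu B = lu (A \<otimes>\<^sub>o B) \<odot> (ide \<one>\<^sub>o \<boxtimes> (ide A \<boxtimes> lu B)) \<odot> \<alpha> \<one>\<^sub>o A (\<one>\<^sub>o \<otimes>\<^sub>o B)"
    by (simp add: lu_natural[THEN comp_reassoc])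
  have "(lu A \<boxtimes> lu B) \<odot> ms \<one>\<^sub>o \<one>\<^sub>o A B = lu (A \<otimes>\<^sub>o B) \<odot> (ide \<one>\<^sub>o \<boxtimes> lu (A \<otimes>\<^sub>o B)) \<odot> \<alpha> \<one>\<^sub>o \<one>\<^sub>o (A \<otimes>\<^sub>o B)"
    unfolding * by (simp add: \<alpha>_ms sw_unit_left)
  also have "\<dots> = lu (A \<otimes>\<^sub>o B) \<odot> (lu \<one>\<^sub>o \<boxtimes> ide (A \<otimes>\<^sub>o B))"
    by (simp add: triangle_arrow lu_unit)
  finally show ?thesis .
qed

section \<open>Raw forms of composites and constraints\<close>

lemma raw_comp: "\<lbrakk>valid g; valid f; cod f = dom g\<rbrakk> \<Longrightarrow> raw (g \<odot> f) = raw g \<cdot> raw f"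
  by (simp add: comp_def)

lemma raw_tens: "\<lbrakk>valid f; valid g\<rbrakk> \<Longrightarrow> raw (f \<boxtimes> g) = raw f \<otimes>\<^sub>m raw g"
  by (simp add: tens_def)

lemma raw_structure:
  "raw (ide A) = Id M A"
  "raw (\<alpha> A B D) = assoc M A B D"
  "raw (lu A) = lunit M A"
  "raw (ru A) = runit M A"
  "raw (br A B) = braid M A B"
  by (simp_all add: ide_def \<alpha>_def lu_def ru_def br_def)

lemma raw_lu': "A \<in> Obj M \<Longrightarrow> raw (lu' A) = inv_arrow M (\<one>\<^sub>o \<otimes>\<^sub>o A) A (lunit M A)"
  unfolding lu'_def lu_def by (subst inv_arrow_eq(2)[symmetric]) (auto intro: lunit_iso)

lemma raw_\<alpha>':
  "\<lbrakk>A \<in> Obj M; B \<in> Obj M; D \<in> Obj M\<rbrakk> \<Longrightarrow> raw (\<alpha>' A B D) = inv_assoc M A B D"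
  unfolding inv_assoc_def \<alpha>'_def \<alpha>_def by (subst inv_arrow_eq(2)[symmetric]) (auto intro: assoc_iso)

lemma raw_ms:
  assumes [simp]: "A \<in> Obj M" "B \<in> Obj M" "D \<in> Obj M" "E \<in> Obj M"
  shows "raw (ms A B D E) = middle_swap M A B D E"
proof -
  have "ms A B D E = \<alpha>' A D (B \<otimes>\<^sub>o E) \<odot> (ide A \<boxtimes> \<alpha> D B E) \<odot> (ide A \<boxtimes> (br B D \<boxtimes> ide E)) \<odot>
     (ide A \<boxtimes> \<alpha>' B D E) \<odot> \<alpha> A B (D \<otimes>\<^sub>o E)"
    by (simp add: ms_def sw_def)
  then show ?thesis
    by (simp add: raw_comp raw_tens raw_structure raw_\<alpha>' middle_swap_def del: interchange)
qed

end

section \<open>Cocommutative comonoids\<close>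

context symmetric_monoidal_category
begin

lemma arrow_eq_iff:
  "\<lbrakk>valid f; valid g; dom f = dom g; cod f = cod g\<rbrakk> \<Longrightarrow> f = g \<longleftrightarrow> raw f = raw g"
  by (metis valid_Arr_raw)

definition \<Delta> :: "('o, 'm, 'y) comon_scheme \<Rightarrow> ('o, 'm) arrow" where
  "\<Delta> T = Arr (ob T) (ob T \<otimes>\<^sub>o ob T) (comult T)"

definition \<epsilon> :: "('o, 'm, 'y) comon_scheme \<Rightarrow> ('o, 'm) arrow" where
  "\<epsilon> T = Arr (ob T) \<one>\<^sub>o (counit T)"

definition coc :: "('o, 'm, 'y) comon_scheme \<Rightarrow> bool" where
  "coc T \<longleftrightarrow> comonoid M T \<and> cocommutative M T"

definition cmap :: "('o, 'm, 'y) comon_scheme \<Rightarrow> ('o, 'm, 'x) comon_scheme \<Rightarrow> ('o, 'm) arrow \<Rightarrow> bool" where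
  "cmap T U f \<longleftrightarrow> \<guillemotleft>f : ob T \<rightarrow> ob U\<guillemotright> \<and> \<Delta> U \<odot> f = (f \<boxtimes> f) \<odot> \<Delta> T \<and> \<epsilon> U \<odot> f = \<epsilon> T"

lemma dom_comon [simp]: "dom (\<Delta> T) = ob T" "dom (\<epsilon> T) = ob T"
  and cod_comon [simp]: "cod (\<Delta> T) = ob T \<otimes>\<^sub>o ob T" "cod (\<epsilon> T) = \<one>\<^sub>o"
  and raw_comon: "raw (\<Delta> T) = comult T" "raw (\<epsilon> T) = counit T"
  by (simp_all add: \<Delta>_def \<epsilon>_def)

lemma coc_iff: "coc T \<longleftrightarrow> ob T \<in> Obj M \<and> valid (\<Delta> T) \<and> valid (\<epsilon> T) \<and>
    \<alpha> (ob T) (ob T) (ob T) \<odot> (\<Delta> T \<boxtimes> ide (ob T)) \<odot> \<Delta> T = (ide (ob T) \<boxtimes> \<Delta> T) \<odot> \<Delta> T \<and>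
    lu (ob T) \<odot> (\<epsilon> T \<boxtimes> ide (ob T)) \<odot> \<Delta> T = ide (ob T) \<and>
    ru (ob T) \<odot> (ide (ob T) \<boxtimes> \<epsilon> T) \<odot> \<Delta> T = ide (ob T) \<and>
    br (ob T) (ob T) \<odot> \<Delta> T = \<Delta> T"
proof (cases "ob T \<in> Obj M \<and> comult T \<in> Hom M (ob T) (ob T \<otimes>\<^sub>o ob T) \<and> counit T \<in> Hom M (ob T) \<one>\<^sub>o")
  case True
  then have [simp]: "ob T \<in> Obj M" and v [simp]: "valid (\<Delta> T)" "valid (\<epsilon> T)"
    by (auto simp: \<Delta>_def \<epsilon>_def)
  show ?thesis
    unfolding coc_def comonoid_def cocommutative_def using True v
    by (simp add: arrow_eq_iff raw_comp raw_tens raw_structure raw_comon)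
next
  case False
  then show ?thesis by (auto simp: coc_def comonoid_def \<Delta>_def \<epsilon>_def)
qed

lemma cocD [simp]:
  assumes "coc T"
  shows "ob T \<in> Obj M" "valid (\<Delta> T)" "valid (\<epsilon> T)"
    "\<alpha> (ob T) (ob T) (ob T) \<odot> (\<Delta> T \<boxtimes> ide (ob T)) \<odot> \<Delta> T = (ide (ob T) \<boxtimes> \<Delta> T) \<odot> \<Delta> T"
    "lu (ob T) \<odot> (\<epsilon> T \<boxtimes> ide (ob T)) \<odot> \<Delta> T = ide (ob T)"
    "ru (ob T) \<odot> (ide (ob T) \<boxtimes> \<epsilon> T) \<odot> \<Delta> T = ide (ob T)"
    "br (ob T) (ob T) \<odot> \<Delta> T = \<Delta> T"
  using assms by (simp_all add: coc_iff)

text \<open>The right counit law of \<open>coc_iff\<close> is derived here: cocommutativity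
  transfers the left one to it through \<open>lu_br\<close>.\<close>

lemma cocI:
  assumes [simp]: "ob T \<in> Obj M" "valid (\<Delta> T)" "valid (\<epsilon> T)"
    and "\<alpha> (ob T) (ob T) (ob T) \<odot> (\<Delta> T \<boxtimes> ide (ob T)) \<odot> \<Delta> T = (ide (ob T) \<boxtimes> \<Delta> T) \<odot> \<Delta> T"
    and "lu (ob T) \<odot> (\<epsilon> T \<boxtimes> ide (ob T)) \<odot> \<Delta> T = ide (ob T)"
    and br [simp]: "br (ob T) (ob T) \<odot> \<Delta> T = \<Delta> T"
  shows "coc T"
proof -
  have "ru (ob T) \<odot> (ide (ob T) \<boxtimes> \<epsilon> T) \<odot> \<Delta> T = lu (ob T) \<odot> br (ob T) \<one>\<^sub>o \<odot> (ide (ob T) \<boxtimes> \<epsilon> T) \<odot> \<Delta> T"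
    by (simp flip: lu_br)
  also have "\<dots> = lu (ob T) \<odot> (\<epsilon> T \<boxtimes> ide (ob T)) \<odot> \<Delta> T"
    by (simp add: br_natural[THEN comp_reassoc])
  finally show ?thesis
    unfolding coc_iff using assms by simp
qed

lemma comonoid_morphism_iff:
  assumes [simp]: "coc T" "coc U"
  shows "comonoid_morphism M T U f \<longleftrightarrow> cmap T U (Arr (ob T) (ob U) f)"
proof (cases "f \<in> Hom M (ob T) (ob U)")
  case True
  then have v: "valid (Arr (ob T) (ob U) f)" by simp
  have "\<Delta> U \<odot> Arr (ob T) (ob U) f = (Arr (ob T) (ob U) f \<boxtimes> Arr (ob T) (ob U) f) \<odot> \<Delta> T
     \<longleftrightarrow> comult U \<cdot> f = (f \<otimes>\<^sub>m f) \<cdot> comult T"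
    using v by (subst arrow_eq_iff) (simp_all add: raw_comp raw_tens raw_comon del: valid_Arr)
  moreover have "\<epsilon> U \<odot> Arr (ob T) (ob U) f = \<epsilon> T \<longleftrightarrow> counit U \<cdot> f = counit T"
    using v by (subst arrow_eq_iff) (simp_all add: raw_comp raw_tens raw_comon del: valid_Arr)
  ultimately show ?thesis
    using True by (simp add: comonoid_morphism_def cmap_def)
qed (auto simp: comonoid_morphism_def cmap_def)

lemma cmapD:
  assumes "cmap T U f"
  shows "valid f" "dom f = ob T" "cod f = ob U" "\<epsilon> U \<odot> f = \<epsilon> T"
  using assms by (simp_all add: cmap_def)

lemma cmap_ide [simp]: "coc T \<Longrightarrow> cmap T T (ide (ob T))"
  by (simp add: cmap_def)

lemma cmap_comp:
  assumes "cmap T U f" "cmap U V g" shows "cmap T V (g \<odot> f)"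
proof -
  have [simp]: "valid f" "dom f = ob T" "cod f = ob U" "valid g" "dom g = ob U" "cod g = ob V"
    and f: "\<Delta> U \<odot> f = (f \<boxtimes> f) \<odot> \<Delta> T" "\<epsilon> U \<odot> f = \<epsilon> T"
    and g: "\<Delta> V \<odot> g = (g \<boxtimes> g) \<odot> \<Delta> U" "\<epsilon> V \<odot> g = \<epsilon> U"
    using assms by (auto simp: cmap_def)
  show ?thesis
    by (simp add: cmap_def g[THEN comp_reassoc] f)
qed

text \<open>The components may be arbitrary arrows out of \<open>T\<close>. The rules for
  constraints acting on pairs hold in this generality, whereas precomposition
  (\<open>pair_cmap\<close>) and the projections rely on compatibility with \<Delta> or \<epsilon>.
  The linear case matters for the inverse of the shear map below.\<close>

definition pair :: "('o, 'm, 'y) comon_scheme \<Rightarrow> ('o, 'm) arrow \<Rightarrow> ('o, 'm) arrow \<Rightarrow> ('o, 'm) arrow" where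
  "pair T x y = (x \<boxtimes> y) \<odot> \<Delta> T"

lemma valid_pair [simp]: "\<lbrakk>coc T; valid x; valid y; dom x = ob T; dom y = ob T\<rbrakk> \<Longrightarrow> valid (pair T x y)"
  and dom_pair [simp]: "\<lbrakk>coc T; valid x; valid y; dom x = ob T; dom y = ob T\<rbrakk> \<Longrightarrow> dom (pair T x y) = ob T"
  and cod_pair [simp]: "\<lbrakk>coc T; valid x; valid y; dom x = ob T; dom y = ob T\<rbrakk>
    \<Longrightarrow> cod (pair T x y) = cod x \<otimes>\<^sub>o cod y"
  by (simp_all add: pair_def)

lemma tens_pair [simp]:
  "\<lbrakk>coc T; valid x; valid y; dom x = ob T; dom y = ob T; valid f; valid g; cod x = dom f; cod y = dom g\<rbrakk>
   \<Longrightarrow> (f \<boxtimes> g) \<odot> pair T x y = pair T (f \<odot> x) (g \<odot> y)"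
  by (simp add: pair_def)

lemmas tens_pair_comp [simp] = tens_pair[THEN comp_reassoc]

lemma pair_cmap:
  assumes "cmap T U h" and [simp]: "coc T" "coc U" "valid x" "valid y" "dom x = ob U" "dom y = ob U"
  shows "pair U x y \<odot> h = pair T (x \<odot> h) (y \<odot> h)"
proof -
  have [simp]: "valid h" "dom h = ob T" "cod h = ob U" "\<Delta> U \<odot> h = (h \<boxtimes> h) \<odot> \<Delta> T"
    using assms(1) by (simp_all add: cmap_def)
  show ?thesis by (simp add: pair_def)
qed

lemma comult_cmap: "cmap T U x \<Longrightarrow> \<Delta> U \<odot> x = pair T x x"
  by (simp add: cmap_def pair_def)

text \<open>Naturality moves x, y and z out of the way and leaves coassociativity of
  \<open>\<Delta> T\<close>. With the companion rules for \<open>\<alpha>'\<close>,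
  \<open>br\<close>, \<open>lu\<close> and \<open>ru\<close>, each constraint acts on tuples by
  permuting or dropping components, so identities of tuples follow by simplification.\<close>

lemma \<alpha>_pair [simp]:
  assumes [simp]: "coc T" "valid x" "valid y" "valid z" "dom x = ob T" "dom y = ob T" "dom z = ob T"
    and eqs: "cod x = A" "cod y = B" "cod z = D"
  shows "\<alpha> A B D \<odot> pair T (pair T x y) z = pair T x (pair T y z)"
proof -
  have [simp]: "A \<in> Obj M" "B \<in> Obj M" "D \<in> Obj M" using eqs valid_in_Obj by auto
  note [simp] = eqs
  have "\<alpha> A B D \<odot> pair T (pair T x y) z
     = \<alpha> A B D \<odot> ((x \<boxtimes> y) \<boxtimes> z) \<odot> (\<Delta> T \<boxtimes> ide (ob T)) \<odot> \<Delta> T"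
    by (simp add: pair_def)
  also have "\<dots> = (x \<boxtimes> (y \<boxtimes> z)) \<odot> \<alpha> (ob T) (ob T) (ob T) \<odot> (\<Delta> T \<boxtimes> ide (ob T)) \<odot> \<Delta> T"
    using \<alpha>_natural[of x y z A B D, THEN comp_reassoc] by (simp del: interchange)
  also have "\<dots> = pair T x (pair T y z)"
    by (simp add: pair_def)
  finally show ?thesis .
qed

lemma \<alpha>'_pair [simp]:
  assumes [simp]: "coc T" "valid x" "valid y" "valid z" "dom x = ob T" "dom y = ob T" "dom z = ob T"
    and eqs: "cod x = A" "cod y = B" "cod z = D"
  shows "\<alpha>' A B D \<odot> pair T x (pair T y z) = pair T (pair T x y) z"
proof -
  have [simp]: "A \<in> Obj M" "B \<in> Obj M" "D \<in> Obj M" using eqs valid_in_Obj by auto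
  show ?thesis
    using \<alpha>_pair[OF assms, THEN arg_cong, of "\<lambda>w. \<alpha>' A B D \<odot> w"] eqs by (simp del: \<alpha>_pair)
qed

lemma br_pair [simp]:
  assumes [simp]: "coc T" "valid x" "valid y" "dom x = ob T" "dom y = ob T"
    and eqs: "cod x = A" "cod y = B"
  shows "br A B \<odot> pair T x y = pair T y x"
  unfolding pair_def using br_natural[of x y A B, THEN comp_reassoc] eqs by simp

lemma lu_pair [simp]:
  assumes [simp]: "coc T" "valid y" "dom y = ob T" and eqs: "cod y = B"
  shows "lu B \<odot> pair T (\<epsilon> T) y = y"
proof -
  have "lu B \<odot> pair T (\<epsilon> T) y = (lu B \<odot> (ide \<one>\<^sub>o \<boxtimes> y)) \<odot> (\<epsilon> T \<boxtimes> ide (ob T)) \<odot> \<Delta> T"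
    by (simp add: pair_def)
  also have "\<dots> = y" using eqs by (simp add: lu_natural del: interchange)
  finally show ?thesis .
qed

lemma ru_pair [simp]:
  assumes [simp]: "coc T" "valid y" "dom y = ob T" and eqs: "cod y = B"
  shows "ru B \<odot> pair T y (\<epsilon> T) = y"
proof -
  have "ru B \<odot> pair T y (\<epsilon> T) = (ru B \<odot> (y \<boxtimes> ide \<one>\<^sub>o)) \<odot> (ide (ob T) \<boxtimes> \<epsilon> T) \<odot> \<Delta> T"
    by (simp add: pair_def)
  also have "\<dots> = y" using eqs by (simp add: ru_natural del: interchange)
  finally show ?thesis .
qed

lemma ms_pair [simp]:
  assumes [simp]: "coc T" "valid x" "valid y" "valid z" "valid w"
      "dom x = ob T" "dom y = ob T" "dom z = ob T" "dom w = ob T"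
    and eqs: "cod x = A" "cod y = B" "cod z = D" "cod w = E"
  shows "ms A B D E \<odot> pair T (pair T x y) (pair T z w) = pair T (pair T x z) (pair T y w)"
proof -
  have [simp]: "A \<in> Obj M" "B \<in> Obj M" "D \<in> Obj M" "E \<in> Obj M" using eqs valid_in_Obj by auto
  note [simp] = eqs
  show ?thesis by (simp add: ms_def sw_def)
qed

section \<open>Products of cocommutative comonoids\<close>

definition prod :: "('o, 'm, 'y) comon_scheme \<Rightarrow> ('o, 'm, 'x) comon_scheme \<Rightarrow> ('o, 'm) comon" where
  "prod U V = \<lparr>ob = ob U \<otimes>\<^sub>o ob V,
     comult = raw (ms (ob U) (ob U) (ob V) (ob V) \<odot> (\<Delta> U \<boxtimes> \<Delta> V)),
     counit = raw (lu \<one>\<^sub>o \<odot> (\<epsilon> U \<boxtimes> \<epsilon> V))\<rparr>"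

lemma ob_prod [simp]: "ob (prod U V) = ob U \<otimes>\<^sub>o ob V"
  by (simp add: prod_def)

lemma comult_prod: "\<lbrakk>coc U; coc V\<rbrakk> \<Longrightarrow> \<Delta> (prod U V) = ms (ob U) (ob U) (ob V) (ob V) \<odot> (\<Delta> U \<boxtimes> \<Delta> V)"
  and counit_prod: "\<lbrakk>coc U; coc V\<rbrakk> \<Longrightarrow> \<epsilon> (prod U V) = lu \<one>\<^sub>o \<odot> (\<epsilon> U \<boxtimes> \<epsilon> V)"
  unfolding prod_def by (simp_all add: \<Delta>_def[of "\<lparr>ob = _, comult = _, counit = _\<rparr>"] \<epsilon>_def[of "\<lparr>ob = _, comult = _, counit = _\<rparr>"] valid_Arr_raw)

text \<open>Naturality of \<open>ms\<close> separates the two comultiplications from the shuffles.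
  The laws then come from \<open>ms_assoc\<close>, \<open>ms_unit_left\<close> and
  \<open>ms_br\<close> together with the corresponding laws of the factors.\<close>

lemma coc_prod [simp]:
  assumes [simp]: "coc U" "coc V"
  shows "coc (prod U V)"
proof (rule cocI)
  let ?u = "ob U" and ?v = "ob V"
  note c [simp] = comult_prod counit_prod
  show "valid (\<Delta> (prod U V))" "valid (\<epsilon> (prod U V))" "ob (prod U V) \<in> Obj M" by simp_all
  have "\<alpha> (?u \<otimes>\<^sub>o ?v) (?u \<otimes>\<^sub>o ?v) (?u \<otimes>\<^sub>o ?v) \<odot> (\<Delta> (prod U V) \<boxtimes> ide (?u \<otimes>\<^sub>o ?v)) \<odot> \<Delta> (prod U V)
    = \<alpha> (?u \<otimes>\<^sub>o ?v) (?u \<otimes>\<^sub>o ?v) (?u \<otimes>\<^sub>o ?v) \<odot> (ms ?u ?u ?v ?v \<boxtimes> ide (?u \<otimes>\<^sub>o ?v)) \<odot>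
        (((\<Delta> U \<boxtimes> \<Delta> V) \<boxtimes> (ide ?u \<boxtimes> ide ?v)) \<odot> ms ?u ?u ?v ?v) \<odot> (\<Delta> U \<boxtimes> \<Delta> V)"
    by simp
  also have "\<dots> = (\<alpha> (?u \<otimes>\<^sub>o ?v) (?u \<otimes>\<^sub>o ?v) (?u \<otimes>\<^sub>o ?v) \<odot> (ms ?u ?u ?v ?v \<boxtimes> ide (?u \<otimes>\<^sub>o ?v)) \<odot>
        ms (?u \<otimes>\<^sub>o ?u) ?u (?v \<otimes>\<^sub>o ?v) ?v) \<odot> ((\<Delta> U \<boxtimes> ide ?u) \<boxtimes> (\<Delta> V \<boxtimes> ide ?v)) \<odot> (\<Delta> U \<boxtimes> \<Delta> V)"
    using ms_natural[of "\<Delta> U" "ide ?u" "\<Delta> V" "ide ?v" "?u \<otimes>\<^sub>o ?u" ?u "?v \<otimes>\<^sub>o ?v" ?v, THEN comp_reassoc, where x = "\<Delta> U \<boxtimes> \<Delta> V"]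
    by (simp del: interchange tens_ide)
  also have "\<dots> = (ide (?u \<otimes>\<^sub>o ?v) \<boxtimes> ms ?u ?u ?v ?v) \<odot> ms ?u (?u \<otimes>\<^sub>o ?u) ?v (?v \<otimes>\<^sub>o ?v) \<odot>
      ((\<alpha> ?u ?u ?u \<odot> (\<Delta> U \<boxtimes> ide ?u) \<odot> \<Delta> U) \<boxtimes> (\<alpha> ?v ?v ?v \<odot> (\<Delta> V \<boxtimes> ide ?v) \<odot> \<Delta> V))"
    by (subst ms_assoc) simp_all
  also have "\<dots> = (ide (?u \<otimes>\<^sub>o ?v) \<boxtimes> ms ?u ?u ?v ?v) \<odot> (ms ?u (?u \<otimes>\<^sub>o ?u) ?v (?v \<otimes>\<^sub>o ?v) \<odot>
      ((ide ?u \<boxtimes> \<Delta> U) \<boxtimes> (ide ?v \<boxtimes> \<Delta> V))) \<odot> (\<Delta> U \<boxtimes> \<Delta> V)"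
    by simp
  also have "\<dots> = (ide (?u \<otimes>\<^sub>o ?v) \<boxtimes> \<Delta> (prod U V)) \<odot> \<Delta> (prod U V)"
    by (subst ms_natural) simp_all
  finally show "\<alpha> (ob (prod U V)) (ob (prod U V)) (ob (prod U V)) \<odot> (\<Delta> (prod U V) \<boxtimes> ide (ob (prod U V))) \<odot> \<Delta> (prod U V)
     = (ide (ob (prod U V)) \<boxtimes> \<Delta> (prod U V)) \<odot> \<Delta> (prod U V)"
    by simp
  have "lu (?u \<otimes>\<^sub>o ?v) \<odot> (\<epsilon> (prod U V) \<boxtimes> ide (?u \<otimes>\<^sub>o ?v)) \<odot> \<Delta> (prod U V)
     = lu (?u \<otimes>\<^sub>o ?v) \<odot> (lu \<one>\<^sub>o \<boxtimes> ide (?u \<otimes>\<^sub>o ?v)) \<odot> (((\<epsilon> U \<boxtimes> \<epsilon> V) \<boxtimes> (ide ?u \<boxtimes> ide ?v)) \<odot> ms ?u ?u ?v ?v) \<odot> (\<Delta> U \<boxtimes> \<Delta> V)"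
    by simp
  also have "\<dots> = (lu (?u \<otimes>\<^sub>o ?v) \<odot> (lu \<one>\<^sub>o \<boxtimes> ide (?u \<otimes>\<^sub>o ?v)) \<odot> ms \<one>\<^sub>o ?u \<one>\<^sub>o ?v) \<odot> ((\<epsilon> U \<boxtimes> ide ?u) \<boxtimes> (\<epsilon> V \<boxtimes> ide ?v)) \<odot> (\<Delta> U \<boxtimes> \<Delta> V)"
    using ms_natural[of "\<epsilon> U" "ide ?u" "\<epsilon> V" "ide ?v" "\<one>\<^sub>o" ?u "\<one>\<^sub>o" ?v, THEN comp_reassoc, where x = "\<Delta> U \<boxtimes> \<Delta> V"]
    by (simp del: interchange tens_ide)
  also have "\<dots> = ide (?u \<otimes>\<^sub>o ?v)"
    unfolding ms_unit_left[OF cocD(1)[OF assms(1)] cocD(1)[OF assms(2)]] by simp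
  finally show "lu (ob (prod U V)) \<odot> (\<epsilon> (prod U V) \<boxtimes> ide (ob (prod U V))) \<odot> \<Delta> (prod U V) = ide (ob (prod U V))"
    by simp
  show "br (ob (prod U V)) (ob (prod U V)) \<odot> \<Delta> (prod U V) = \<Delta> (prod U V)"
    by (simp add: ms_br[THEN comp_reassoc])
qed

text \<open>Cocommutativity is essential here: the comultiplication of the product sends <x, y> to
  <<x, x>, <y, y>> with its middle entries exchanged, and \<open>ms_pair\<close> performs that
  exchange by means of \<open>br_pair\<close>.\<close>

lemma cmap_pair:
  assumes "cmap T U x" "cmap T V y" and [simp]: "coc T" "coc U" "coc V"
  shows "cmap T (prod U V) (pair T x y)"
  unfolding cmap_def
proof (intro conjI)
  note [simp] = cmapD[OF assms(1)] cmapD[OF assms(2)] comult_cmap[OF assms(1)] comult_cmap[OF assms(2)]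
  show "valid (pair T x y)" "dom (pair T x y) = ob T" "cod (pair T x y) = ob (prod U V)"
    by simp_all
  show "\<Delta> (prod U V) \<odot> pair T x y = (pair T x y \<boxtimes> pair T x y) \<odot> \<Delta> T"
    by (simp add: comult_prod) (simp add: pair_def)
  show "\<epsilon> (prod U V) \<odot> pair T x y = \<epsilon> T"
    by (simp add: counit_prod)
qed

definition p1 :: "('o, 'm, 'y) comon_scheme \<Rightarrow> ('o, 'm, 'x) comon_scheme \<Rightarrow> ('o, 'm) arrow" where
  "p1 U V = ru (ob U) \<odot> (ide (ob U) \<boxtimes> \<epsilon> V)"

definition p2 :: "('o, 'm, 'y) comon_scheme \<Rightarrow> ('o, 'm, 'x) comon_scheme \<Rightarrow> ('o, 'm) arrow" where
  "p2 U V = lu (ob V) \<odot> (\<epsilon> U \<boxtimes> ide (ob V))"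

lemma p1_in_hom [simp]: "\<lbrakk>coc U; coc V\<rbrakk> \<Longrightarrow> \<guillemotleft>p1 U V : ob U \<otimes>\<^sub>o ob V \<rightarrow> ob U\<guillemotright>"
  and p2_in_hom [simp]: "\<lbrakk>coc U; coc V\<rbrakk> \<Longrightarrow> \<guillemotleft>p2 U V : ob U \<otimes>\<^sub>o ob V \<rightarrow> ob V\<guillemotright>"
  by (simp_all add: p1_def p2_def)

lemma cmap_p1 [simp]:
  assumes [simp]: "coc U" "coc V"
  shows "cmap (prod U V) U (p1 U V)"
  unfolding cmap_def
proof (intro conjI)
  let ?u = "ob U" and ?v = "ob V"
  show "valid (p1 U V)" "dom (p1 U V) = ob (prod U V)" "cod (p1 U V) = ob U" by simp_all
  have e: "lu \<one>\<^sub>o \<odot> (\<epsilon> V \<boxtimes> \<epsilon> V) \<odot> \<Delta> V = \<epsilon> V"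
    using lu_pair[of V "\<epsilon> V" "\<one>\<^sub>o"] by (simp add: pair_def del: lu_pair)
  have "(p1 U V \<boxtimes> p1 U V) \<odot> \<Delta> (prod U V)
     = (ru ?u \<boxtimes> ru ?u) \<odot> (((ide ?u \<boxtimes> \<epsilon> V) \<boxtimes> (ide ?u \<boxtimes> \<epsilon> V)) \<odot> ms ?u ?u ?v ?v) \<odot> (\<Delta> U \<boxtimes> \<Delta> V)"
    by (simp add: comult_prod p1_def)
  also have "\<dots> = ((ru ?u \<boxtimes> ru ?u) \<odot> ms ?u ?u \<one>\<^sub>o \<one>\<^sub>o) \<odot> ((ide ?u \<boxtimes> ide ?u) \<boxtimes> (\<epsilon> V \<boxtimes> \<epsilon> V)) \<odot> (\<Delta> U \<boxtimes> \<Delta> V)"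
    using ms_natural[of "ide ?u" "ide ?u" "\<epsilon> V" "\<epsilon> V" ?u ?u "\<one>\<^sub>o" "\<one>\<^sub>o", THEN comp_reassoc, where x = "\<Delta> U \<boxtimes> \<Delta> V"]
    by (simp del: interchange tens_ide)
  also have "\<dots> = ru (?u \<otimes>\<^sub>o ?u) \<odot> (\<Delta> U \<boxtimes> (lu \<one>\<^sub>o \<odot> (\<epsilon> V \<boxtimes> \<epsilon> V) \<odot> \<Delta> V))"
    by (simp add: ms_unit_right)
  also have "\<dots> = ru (?u \<otimes>\<^sub>o ?u) \<odot> (\<Delta> U \<boxtimes> ide \<one>\<^sub>o) \<odot> (ide ?u \<boxtimes> \<epsilon> V)"
    unfolding e by simp
  also have "\<dots> = \<Delta> U \<odot> p1 U V"
    using ru_natural[of "\<Delta> U", THEN comp_reassoc] by (simp add: p1_def del: interchange)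
  finally show "\<Delta> U \<odot> p1 U V = (p1 U V \<boxtimes> p1 U V) \<odot> \<Delta> (prod U V)" by simp
  have "\<epsilon> U \<odot> p1 U V = (ru \<one>\<^sub>o \<odot> (\<epsilon> U \<boxtimes> ide \<one>\<^sub>o)) \<odot> (ide ?u \<boxtimes> \<epsilon> V)"
    using ru_natural[of "\<epsilon> U"] by (simp add: p1_def del: interchange)
  then show "\<epsilon> U \<odot> p1 U V = \<epsilon> (prod U V)"
    by (simp add: counit_prod lu_unit)
qed

lemma cmap_p2 [simp]:
  assumes [simp]: "coc U" "coc V"
  shows "cmap (prod U V) V (p2 U V)"
  unfolding cmap_def
proof (intro conjI)
  let ?u = "ob U" and ?v = "ob V"
  show "valid (p2 U V)" "dom (p2 U V) = ob (prod U V)" "cod (p2 U V) = ob V" by simp_all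
  have e: "lu \<one>\<^sub>o \<odot> (\<epsilon> U \<boxtimes> \<epsilon> U) \<odot> \<Delta> U = \<epsilon> U"
    using lu_pair[of U "\<epsilon> U" "\<one>\<^sub>o"] by (simp add: pair_def del: lu_pair)
  have "(p2 U V \<boxtimes> p2 U V) \<odot> \<Delta> (prod U V)
     = (lu ?v \<boxtimes> lu ?v) \<odot> (((\<epsilon> U \<boxtimes> ide ?v) \<boxtimes> (\<epsilon> U \<boxtimes> ide ?v)) \<odot> ms ?u ?u ?v ?v) \<odot> (\<Delta> U \<boxtimes> \<Delta> V)"
    by (simp add: comult_prod p2_def)
  also have "\<dots> = ((lu ?v \<boxtimes> lu ?v) \<odot> ms \<one>\<^sub>o \<one>\<^sub>o ?v ?v) \<odot> ((\<epsilon> U \<boxtimes> \<epsilon> U) \<boxtimes> (ide ?v \<boxtimes> ide ?v)) \<odot> (\<Delta> U \<boxtimes> \<Delta> V)"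
    using ms_natural[of "\<epsilon> U" "\<epsilon> U" "ide ?v" "ide ?v" "\<one>\<^sub>o" "\<one>\<^sub>o" ?v ?v, THEN comp_reassoc, where x = "\<Delta> U \<boxtimes> \<Delta> V"]
    by (simp del: interchange tens_ide)
  also have "\<dots> = lu (?v \<otimes>\<^sub>o ?v) \<odot> ((lu \<one>\<^sub>o \<odot> (\<epsilon> U \<boxtimes> \<epsilon> U) \<odot> \<Delta> U) \<boxtimes> \<Delta> V)"
    by (simp add: ms_unit_left_left)
  also have "\<dots> = lu (?v \<otimes>\<^sub>o ?v) \<odot> (ide \<one>\<^sub>o \<boxtimes> \<Delta> V) \<odot> (\<epsilon> U \<boxtimes> ide ?v)"
    unfolding e by simp
  also have "\<dots> = \<Delta> V \<odot> p2 U V"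
    using lu_natural[of "\<Delta> V", THEN comp_reassoc] by (simp add: p2_def del: interchange)
  finally show "\<Delta> V \<odot> p2 U V = (p2 U V \<boxtimes> p2 U V) \<odot> \<Delta> (prod U V)" by simp
  have "\<epsilon> V \<odot> p2 U V = (lu \<one>\<^sub>o \<odot> (ide \<one>\<^sub>o \<boxtimes> \<epsilon> V)) \<odot> (\<epsilon> U \<boxtimes> ide ?v)"
    using lu_natural[of "\<epsilon> V"] by (simp add: p2_def del: interchange)
  then show "\<epsilon> V \<odot> p2 U V = \<epsilon> (prod U V)"
    by (simp add: counit_prod)
qed

lemma p1_pair [simp]:
  "\<lbrakk>coc T; coc U; coc V; valid x; valid y; dom x = ob T; dom y = ob T; cod x = ob U; cod y = ob V; \<epsilon> V \<odot> y = \<epsilon> T\<rbrakk>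
   \<Longrightarrow> p1 U V \<odot> pair T x y = x"
  by (simp add: p1_def)

lemma p2_pair [simp]:
  "\<lbrakk>coc T; coc U; coc V; valid x; valid y; dom x = ob T; dom y = ob T; cod x = ob U; cod y = ob V; \<epsilon> U \<odot> x = \<epsilon> T\<rbrakk>
   \<Longrightarrow> p2 U V \<odot> pair T x y = y"
  by (simp add: p2_def)

text \<open>After the counits have been applied, the two middle factors swapped by \<open>ms\<close>
  are units, where the swap is invisible (\<open>ms_unit_middle\<close>). With
  \<open>p1_pair\<close> and \<open>p2_pair\<close> this makes \<open>prod\<close> a categorical
  product. It also supplies the generic element: inserting this pair reduces an identity on a
  product to one about tuples.\<close>

lemma pair_p1_p2 [simp]:
  assumes [simp]: "coc U" "coc V"
  shows "pair (prod U V) (p1 U V) (p2 U V) = ide (ob U \<otimes>\<^sub>o ob V)"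
proof -
  let ?u = "ob U" and ?v = "ob V"
  have "pair (prod U V) (p1 U V) (p2 U V)
     = (ru ?u \<boxtimes> lu ?v) \<odot> (((ide ?u \<boxtimes> \<epsilon> V) \<boxtimes> (\<epsilon> U \<boxtimes> ide ?v)) \<odot> ms ?u ?u ?v ?v) \<odot> (\<Delta> U \<boxtimes> \<Delta> V)"
    by (simp add: comult_prod pair_def p1_def p2_def)
  also have "\<dots> = ((ru ?u \<boxtimes> lu ?v) \<odot> ms ?u \<one>\<^sub>o \<one>\<^sub>o ?v) \<odot> ((ide ?u \<boxtimes> \<epsilon> U) \<boxtimes> (\<epsilon> V \<boxtimes> ide ?v)) \<odot> (\<Delta> U \<boxtimes> \<Delta> V)"
    using ms_natural[of "ide ?u" "\<epsilon> U" "\<epsilon> V" "ide ?v" ?u "\<one>\<^sub>o" "\<one>\<^sub>o" ?v, THEN comp_reassoc, where x = "\<Delta> U \<boxtimes> \<Delta> V"]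
    by (simp del: interchange tens_ide)
  also have "\<dots> = ide (?u \<otimes>\<^sub>o ?v)"
    by (simp add: ms_unit_middle)
  finally show ?thesis .
qed

text \<open>Exhibits a tensor product of arrows as the product map of the cartesian structure, which
  reduces \<open>cmap_tens\<close> to \<open>cmap_pair\<close>.\<close>

lemma tens_eq_pair:
  assumes [simp]: "coc U" "coc V" "valid f" "valid g" "dom f = ob U" "dom g = ob V"
  shows "f \<boxtimes> g = pair (prod U V) (f \<odot> p1 U V) (g \<odot> p2 U V)"
proof -
  have "f \<boxtimes> g = (f \<boxtimes> g) \<odot> pair (prod U V) (p1 U V) (p2 U V)"
    by (simp del: tens_pair)
  then show ?thesis by (simp del: pair_p1_p2)
qed

lemma cmap_tens:
  assumes "cmap U U' f" "cmap V V' g" and [simp]: "coc U" "coc V" "coc U'" "coc V'"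
  shows "cmap (prod U V) (prod U' V') (f \<boxtimes> g)"
  by (subst tens_eq_pair)
    (auto simp: cmapD[OF assms(1)] cmapD[OF assms(2)] intro!: cmap_pair cmap_comp assms)

section \<open>The terminal comonoid\<close>

definition unit_comon :: "('o, 'm) comon" where
  "unit_comon = \<lparr>ob = \<one>\<^sub>o, comult = raw (lu' \<one>\<^sub>o), counit = Id M \<one>\<^sub>o\<rparr>"

lemma unit_comon [simp]:
  "ob unit_comon = \<one>\<^sub>o" "\<Delta> unit_comon = lu' \<one>\<^sub>o" "\<epsilon> unit_comon = ide \<one>\<^sub>o"
  by (simp_all add: unit_comon_def \<Delta>_def \<epsilon>_def ide_def valid_Arr_raw)

lemma coc_unit_comon [simp]: "coc unit_comon"
proof (rule cocI)
  have "\<alpha> \<one>\<^sub>o \<one>\<^sub>o \<one>\<^sub>o = (ide \<one>\<^sub>o \<boxtimes> lu' \<one>\<^sub>o) \<odot> (lu \<one>\<^sub>o \<boxtimes> ide \<one>\<^sub>o)"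
    using arg_cong[OF triangle_arrow[of "\<one>\<^sub>o" "\<one>\<^sub>o"], of "\<lambda>x. (ide \<one>\<^sub>o \<boxtimes> lu' \<one>\<^sub>o) \<odot> x"]
    by (simp flip: lu_unit)
  then show "\<alpha> (ob unit_comon) (ob unit_comon) (ob unit_comon) \<odot> (\<Delta> unit_comon \<boxtimes> ide (ob unit_comon)) \<odot> \<Delta> unit_comon
     = (ide (ob unit_comon) \<boxtimes> \<Delta> unit_comon) \<odot> \<Delta> unit_comon"
    by simp
  have "br \<one>\<^sub>o \<one>\<^sub>o = ide (\<one>\<^sub>o \<otimes>\<^sub>o \<one>\<^sub>o)"
    by (rule monoD[OF iso_imp_mono[of "lu \<one>\<^sub>o"]]) (simp_all add: lu_br, simp add: lu_unit)
  then show "br (ob unit_comon) (ob unit_comon) \<odot> \<Delta> unit_comon = \<Delta> unit_comon" by simp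
qed simp_all

lemma cmap_counit [simp]:
  assumes [simp]: "coc T" shows "cmap T unit_comon (\<epsilon> T)"
  unfolding cmap_def
proof (intro conjI)
  show "\<Delta> unit_comon \<odot> \<epsilon> T = (\<epsilon> T \<boxtimes> \<epsilon> T) \<odot> \<Delta> T"
    by (rule monoD[OF iso_imp_mono[of "lu \<one>\<^sub>o"]]) (simp_all flip: pair_def)
qed simp_all

end

section \<open>Cocommutative Hopf monoids as group objects\<close>

context symmetric_monoidal_category
begin

definition mm :: "('o, 'm, 'y) hopf_data_scheme \<Rightarrow> ('o, 'm) arrow" where
  "mm A = Arr (ob A \<otimes>\<^sub>o ob A) (ob A) (mmult A)"

definition un :: "('o, 'm, 'y) hopf_data_scheme \<Rightarrow> ('o, 'm) arrow" where
  "un A = Arr \<one>\<^sub>o (ob A) (munit A)"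

definition an :: "('o, 'm, 'y) hopf_data_scheme \<Rightarrow> ('o, 'm) arrow" where
  "an A = Arr (ob A) (ob A) (antipode A)"

definition hopf :: "('o, 'm, 'y) hopf_data_scheme \<Rightarrow> bool" where
  "hopf A \<longleftrightarrow> hopf_monoid M A \<and> cocommutative M A"

lemma dom_hopf [simp]: "dom (mm A) = ob A \<otimes>\<^sub>o ob A" "dom (un A) = \<one>\<^sub>o" "dom (an A) = ob A"
  and cod_hopf [simp]: "cod (mm A) = ob A" "cod (un A) = ob A" "cod (an A) = ob A"
  and raw_hopf: "raw (mm A) = mmult A" "raw (un A) = munit A" "raw (an A) = antipode A"
  by (simp_all add: mm_def un_def an_def)

text \<open>The four compatibility axioms of a bimonoid say precisely that multiplication and unit
  are comonoid morphisms, out of the product and the terminal object respectively. In this form a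
  Hopf monoid is visibly a group object, except that the antipode is so far only linear.\<close>

lemma hopf_iff: "hopf A \<longleftrightarrow> coc A \<and> cmap (prod A A) A (mm A) \<and> cmap unit_comon A (un A) \<and>
    mm A \<odot> (mm A \<boxtimes> ide (ob A)) = mm A \<odot> (ide (ob A) \<boxtimes> mm A) \<odot> \<alpha> (ob A) (ob A) (ob A) \<and>
    mm A \<odot> (un A \<boxtimes> ide (ob A)) = lu (ob A) \<and>
    mm A \<odot> (ide (ob A) \<boxtimes> un A) = ru (ob A) \<and>
    valid (an A) \<and>
    mm A \<odot> (an A \<boxtimes> ide (ob A)) \<odot> \<Delta> A = un A \<odot> \<epsilon> A \<and>
    mm A \<odot> (ide (ob A) \<boxtimes> an A) \<odot> \<Delta> A = un A \<odot> \<epsilon> A"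
proof (cases "coc A \<and> mmult A \<in> Hom M (ob A \<otimes>\<^sub>o ob A) (ob A) \<and> munit A \<in> Hom M \<one>\<^sub>o (ob A) \<and>
    antipode A \<in> Hom M (ob A) (ob A)")
  case True
  then have c [simp]: "coc A" by simp
  have [simp]: "ob A \<in> Obj M" by simp
  have [simp]: "valid (mm A)" "valid (un A)" "valid (an A)"
    using True by (simp_all add: mm_def un_def an_def)
  note raws = raw_comp raw_tens raw_structure raw_comon raw_hopf raw_ms raw_lu'
  have m: "cmap (prod A A) A (mm A) \<longleftrightarrow>
      comult A \<cdot> mmult A = (mmult A \<otimes>\<^sub>m mmult A) \<cdot> middle_swap M (ob A) (ob A) (ob A) (ob A) \<cdot> (comult A \<otimes>\<^sub>m comult A) \<and>
      counit A \<cdot> mmult A = lunit M \<one>\<^sub>o \<cdot> (counit A \<otimes>\<^sub>m counit A)"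
    by (simp add: cmap_def arrow_eq_iff comult_prod counit_prod raws)
  have u: "cmap unit_comon A (un A) \<longleftrightarrow>
      comult A \<cdot> munit A = (munit A \<otimes>\<^sub>m munit A) \<cdot> inv_arrow M (\<one>\<^sub>o \<otimes>\<^sub>o \<one>\<^sub>o) \<one>\<^sub>o (lunit M \<one>\<^sub>o) \<and>
      counit A \<cdot> munit A = Id M \<one>\<^sub>o"
    by (simp add: cmap_def arrow_eq_iff raws)
  have e: "comonoid M A" "cocommutative M A" using c by (simp_all add: coc_def)
  show ?thesis
    unfolding hopf_def hopf_monoid_def bimonoid_def monoid_object_def m u using True e
    by (simp add: arrow_eq_iff raws) blast
next
  case False
  then show ?thesis
    by (auto simp: hopf_def hopf_monoid_def bimonoid_def monoid_object_def coc_def cmap_def mm_def un_def an_def)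
qed

lemma hopfD [simp]:
  assumes "hopf A"
  shows "coc A" "cmap (prod A A) A (mm A)" "cmap unit_comon A (un A)"
    "mm A \<odot> (un A \<boxtimes> ide (ob A)) = lu (ob A)"
    "mm A \<odot> (ide (ob A) \<boxtimes> un A) = ru (ob A)"
    "valid (an A)"
    "mm A \<odot> (an A \<boxtimes> ide (ob A)) \<odot> \<Delta> A = un A \<odot> \<epsilon> A"
    "mm A \<odot> (ide (ob A) \<boxtimes> an A) \<odot> \<Delta> A = un A \<odot> \<epsilon> A"
  and hopf_assoc: "mm A \<odot> (mm A \<boxtimes> ide (ob A)) = mm A \<odot> (ide (ob A) \<boxtimes> mm A) \<odot> \<alpha> (ob A) (ob A) (ob A)"
  using assms by (simp_all add: hopf_iff)

lemma valid_hopf [simp]: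
  assumes "hopf A" shows "valid (mm A)" "valid (un A)"
  using cmapD(1)[OF hopfD(2)[OF assms]] cmapD(1)[OF hopfD(3)[OF assms]] .

lemma counit_unit [simp]: "hopf A \<Longrightarrow> \<epsilon> A \<odot> un A = ide \<one>\<^sub>o"
  using cmapD(4)[OF hopfD(3)] by simp

lemmas counit_unit_comp [simp] = counit_unit[THEN comp_reassoc]

text \<open>The convolution product. On comonoid morphisms it is the multiplication of the group of
  \<open>T\<close>-points of \<open>A\<close>. It is also associative and unital on arbitrary
  arrows, while the inverse law \<open>cv_inverse\<close> requires a comonoid morphism.\<close>

definition cv :: "('o, 'm, 'y) hopf_data_scheme \<Rightarrow> ('o, 'm, 'x) comon_scheme \<Rightarrow> ('o, 'm) arrow
    \<Rightarrow> ('o, 'm) arrow \<Rightarrow> ('o, 'm) arrow" where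
  "cv A T x y = mm A \<odot> pair T x y"

lemma cv_in_hom [simp]:
  assumes "hopf A" "coc T" "\<guillemotleft>x : ob T \<rightarrow> ob A\<guillemotright>" "\<guillemotleft>y : ob T \<rightarrow> ob A\<guillemotright>"
  shows "valid (cv A T x y)" "dom (cv A T x y) = ob T" "cod (cv A T x y) = ob A"
  using assms by (simp_all add: cv_def)

lemma cv_assoc:
  assumes [simp]: "hopf A" "coc T" "valid x" "dom x = ob T" "cod x = ob A"
    "valid y" "dom y = ob T" "cod y = ob A" "valid z" "dom z = ob T" "cod z = ob A"
  shows "cv A T (cv A T x y) z = cv A T x (cv A T y z)"
proof -
  show ?thesis
    using comp_reassoc[OF hopf_assoc[OF assms(1)], of "pair T (pair T x y) z"] by (simp add: cv_def)
qed

lemma cv_unit_left [simp]: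
  assumes [simp]: "hopf A" "coc T" "valid x" "dom x = ob T" "cod x = ob A"
  shows "cv A T (un A \<odot> \<epsilon> T) x = x"
  using comp_reassoc[OF hopfD(4)[OF assms(1)], of "pair T (\<epsilon> T) x"] by (simp add: cv_def)

lemma cv_unit_right [simp]:
  assumes [simp]: "hopf A" "coc T" "valid x" "dom x = ob T" "cod x = ob A"
  shows "cv A T x (un A \<odot> \<epsilon> T) = x"
  using comp_reassoc[OF hopfD(5)[OF assms(1)], of "pair T x (\<epsilon> T)"] by (simp add: cv_def)

lemma cv_inverse [simp]:
  assumes "cmap T A x" and [simp]: "hopf A" "coc T"
  shows "cv A T (an A \<odot> x) x = un A \<odot> \<epsilon> T" "cv A T x (an A \<odot> x) = un A \<odot> \<epsilon> T"
proof -
  note [simp] = cmapD[OF assms(1)]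
  have "cv A T (an A \<odot> x) x = (mm A \<odot> (an A \<boxtimes> ide (ob A)) \<odot> \<Delta> A) \<odot> x"
    by (simp add: cv_def comult_cmap[OF assms(1)] del: hopfD(7))
  then show "cv A T (an A \<odot> x) x = un A \<odot> \<epsilon> T" by simp
  have "cv A T x (an A \<odot> x) = (mm A \<odot> (ide (ob A) \<boxtimes> an A) \<odot> \<Delta> A) \<odot> x"
    by (simp add: cv_def comult_cmap[OF assms(1)] del: hopfD(8))
  then show "cv A T x (an A \<odot> x) = un A \<odot> \<epsilon> T" by simp
qed

lemma cmap_cv:
  assumes "cmap T A x" "cmap T A y" and [simp]: "hopf A" "coc T"
  shows "cmap T A (cv A T x y)"
  unfolding cv_def by (rule cmap_comp[OF cmap_pair[OF assms(1,2)]]) simp_all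

lemma cv_comp:
  assumes "cmap T U h" and [simp]: "hopf A" "coc T" "coc U" "valid x" "dom x = ob U" "cod x = ob A"
    "valid y" "dom y = ob U" "cod y = ob A"
  shows "cv A U x y \<odot> h = cv A T (x \<odot> h) (y \<odot> h)"
  unfolding cv_def by (simp add: pair_cmap[OF assms(1)])

lemma cmap_triv [simp]: "\<lbrakk>coc T; hopf A\<rbrakk> \<Longrightarrow> cmap T A (un A \<odot> \<epsilon> T)"
  by (rule cmap_comp[of _ unit_comon]) simp_all

lemma cmap_inverse:
  assumes "cmap T U f" and [simp]: "coc T" "coc U" and fg: "f \<odot> g = ide (ob U)" "g \<odot> f = ide (ob T)"
    and g [simp]: "valid g" "dom g = ob U" "cod g = ob T"
  shows "cmap U T g"
proof -
  have f: "\<Delta> U \<odot> f = (f \<boxtimes> f) \<odot> \<Delta> T" "\<epsilon> U \<odot> f = \<epsilon> T" and [simp]: "valid f" "dom f = ob T" "cod f = ob U"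
    using assms(1) by (simp_all add: cmap_def)
  have "\<Delta> T \<odot> g = (g \<boxtimes> g) \<odot> ((f \<boxtimes> f) \<odot> \<Delta> T) \<odot> g"
    by (simp add: fg)
  also have "\<dots> = (g \<boxtimes> g) \<odot> \<Delta> U"
    unfolding f(1)[symmetric] by (simp add: fg)
  finally have "\<Delta> T \<odot> g = (g \<boxtimes> g) \<odot> \<Delta> U" .
  moreover have "\<epsilon> T \<odot> g = \<epsilon> U"
    unfolding f(2)[symmetric] by (simp add: fg)
  ultimately show ?thesis by (simp add: cmap_def)
qed

text \<open>The shear map \<open>(x, y) \<mapsto> (xy, y)\<close> is a comonoid map with linear inverse \<open>(x, y) \<mapsto> (x S(y), y)\<close>;
  the inverse is then a comonoid map too, and so is its restriction \<open>S\<close>.\<close>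

lemma cmap_antipode [simp]:
  assumes [simp]: "hopf A"
  shows "cmap A A (an A)"
proof -
  let ?a = "ob A" and ?P = "prod A A" and ?p = "p1 A A" and ?q = "p2 A A"
  \<comment> \<open>\<open>F t\<close> is the linear map (x, y) -> (x t(y), y): the identity for
    \<open>t\<close> gives the shear map, the antipode its inverse.\<close>
  define F where "F t = (mm A \<boxtimes> ide ?a) \<odot> \<alpha>' ?a ?a ?a \<odot> (ide ?a \<boxtimes> ((t \<boxtimes> ide ?a) \<odot> \<Delta> A))" for t
  have F_hom [simp]: "valid (F t)" "dom (F t) = ?a \<otimes>\<^sub>o ?a" "cod (F t) = ?a \<otimes>\<^sub>o ?a"
    if "valid t" "dom t = ?a" "cod t = ?a" for t
    using that by (simp_all add: F_def)
  have F: "F t \<odot> pair T x y = pair T (cv A T x (t \<odot> y)) y"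
    if [simp]: "valid t" "dom t = ?a" "cod t = ?a" "coc T" "valid x" "dom x = ob T" "cod x = ?a"
      and y: "cmap T A y" for T :: "('o, 'm) comon" and t x y
  proof -
    note [simp] = cmapD[OF y]
    show ?thesis
      by (simp add: F_def comult_cmap[OF y] cv_def)
  qed
  \<comment> \<open>The same rule with \<open>A\<close> itself as test comonoid; \<open>A\<close> is
    a record of another type than the comonoids over which the previous rule ranges.\<close>
  have F': "F t \<odot> pair A x y = pair A (cv A A x (t \<odot> y)) y"
    if [simp]: "valid t" "dom t = ?a" "cod t = ?a" "valid x" "dom x = ?a" "cod x = ?a"
      and y: "cmap A A y" for t x y
  proof -
    note [simp] = cmapD[OF y]
    show ?thesis
      by (simp add: F_def comult_cmap[OF y] cv_def)
  qed
  have pq: "pair ?P ?p ?q = ide (?a \<otimes>\<^sub>o ?a)" by simp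
  have pair_ide: "f = f \<odot> pair ?P ?p ?q" if "valid f" "dom f = ?a \<otimes>\<^sub>o ?a" for f
    using that by simp
  have cm: "cmap ?P ?P (F (ide ?a))"
  proof -
    have "F (ide ?a) = pair ?P (cv A ?P ?p ?q) ?q"
      by (subst pair_ide) (simp_all del: pair_p1_p2 add: F)
    then show ?thesis by (simp add: cmap_pair cmap_cv)
  qed
  have inv1: "F (ide ?a) \<odot> F (an A) = ide (?a \<otimes>\<^sub>o ?a)"
    by (subst pair_ide) (simp_all del: pair_p1_p2 add: F cv_assoc, simp add: pq)
  have inv2: "F (an A) \<odot> F (ide ?a) = ide (?a \<otimes>\<^sub>o ?a)"
    by (subst pair_ide) (simp_all del: pair_p1_p2 add: F cv_assoc, simp add: pq)
  have cm': "cmap ?P ?P (F (an A))"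
    by (rule cmap_inverse[OF cm]) (simp_all add: inv1 inv2)
  \<comment> \<open>Evaluate the inverse shear map at (1, y): its first component is 1 S(y) =
    S(y).\<close>
  have "an A = p1 A A \<odot> F (an A) \<odot> pair A (un A \<odot> \<epsilon> A) (ide ?a)"
    by (simp add: F')
  moreover have "cmap A A \<dots>"
    by (rule cmap_comp[OF cmap_comp[OF cmap_pair cm'] cmap_p1, unfolded comp_assoc]) simp_all
  ultimately show ?thesis by simp
qed

section \<open>Morphisms of Hopf monoids\<close>

definition hhom :: "('o, 'm, 'y) hopf_data_scheme \<Rightarrow> ('o, 'm, 'x) hopf_data_scheme \<Rightarrow> ('o, 'm) arrow \<Rightarrow> bool" where
  "hhom A B f \<longleftrightarrow> cmap A B f \<and> f \<odot> mm A = mm B \<odot> (f \<boxtimes> f) \<and> f \<odot> un A = un B"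

lemma hhom_cmap: "hhom A B f \<Longrightarrow> cmap A B f"
  by (simp add: hhom_def)

lemma hhomD:
  assumes "hhom A B f"
  shows "valid f" "dom f = ob A" "cod f = ob B" "f \<odot> mm A = mm B \<odot> (f \<boxtimes> f)" "f \<odot> un A = un B"
    "\<epsilon> B \<odot> f = \<epsilon> A"
  using assms cmapD[of A B f] by (simp_all add: hhom_def)

lemma hhom_ide [simp]: "hopf A \<Longrightarrow> hhom A A (ide (ob A))"
  by (simp add: hhom_def)

lemma hhom_comp:
  assumes "hhom A B f" "hhom B D g" and [simp]: "hopf A" "hopf B" "hopf D"
  shows "hhom A D (g \<odot> f)"
proof -
  note [simp] = hhomD[OF assms(1)] hhomD[OF assms(2)] hhomD(4,5)[OF assms(2), THEN comp_reassoc]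
  show ?thesis
    using cmap_comp[OF hhom_cmap[OF assms(1)] hhom_cmap[OF assms(2)]] by (simp add: hhom_def)
qed

lemma hhom_cv:
  assumes "hhom A B f" and [simp]: "hopf A" "hopf B" "coc T" "valid x" "dom x = ob T" "cod x = ob A"
    "valid y" "dom y = ob T" "cod y = ob A"
  shows "f \<odot> cv A T x y = cv B T (f \<odot> x) (f \<odot> y)"
proof -
  note [simp] = hhomD[OF assms(1)] hhomD(4)[OF assms(1), THEN comp_reassoc]
  show ?thesis by (simp add: cv_def)
qed

text \<open>Both arrows are inverse to f under convolution, \<open>f \<odot> an A\<close> on the
  left and \<open>an B \<odot> f\<close> on the right, so they agree by associativity.\<close>

lemma hhom_antipode:
  assumes "hhom A B f" and [simp]: "hopf A" "hopf B"
  shows "f \<odot> an A = an B \<odot> f"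
proof -
  note [simp] = hhomD[OF assms(1)] hhomD(5)[OF assms(1), THEN comp_reassoc]
  have "cv B A (f \<odot> an A) f = f \<odot> cv A A (an A) (ide (ob A))"
    by (simp add: hhom_cv[OF assms(1)])
  also have "\<dots> = un B \<odot> \<epsilon> A"
    using cv_inverse(1)[of A A "ide (ob A)"] by simp
  finally have *: "cv B A (f \<odot> an A) f = un B \<odot> \<epsilon> A" .
  have "f \<odot> an A = cv B A (f \<odot> an A) (cv B A f (an B \<odot> f))"
    using cv_inverse(2)[OF hhom_cmap[OF assms(1)]] by simp
  also have "\<dots> = an B \<odot> f"
    by (simp add: cv_assoc[symmetric] * del: cv_inverse)
  finally show ?thesis .
qed

lemma hhom_triv [simp]:
  assumes [simp]: "hopf A" "hopf B"
  shows "hhom A B (un B \<odot> \<epsilon> A)"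
proof -
  have e: "\<epsilon> A \<odot> mm A = lu \<one>\<^sub>o \<odot> (\<epsilon> A \<boxtimes> \<epsilon> A)"
    using cmapD(4)[OF hopfD(2), of A] by (simp add: counit_prod)
  have m: "mm B \<odot> (un B \<boxtimes> un B) = un B \<odot> lu \<one>\<^sub>o"
    using comp_reassoc[OF hopfD(4)[of B], of "ide \<one>\<^sub>o \<boxtimes> un B"] by (simp add: lu_natural)
  have "mm B \<odot> ((un B \<odot> \<epsilon> A) \<boxtimes> (un B \<odot> \<epsilon> A)) = (mm B \<odot> (un B \<boxtimes> un B)) \<odot> (\<epsilon> A \<boxtimes> \<epsilon> A)"
    by simp
  then show ?thesis
    unfolding m by (simp add: hhom_def e)
qed

section \<open>The category of cocommutative Hopf monoids and its zero object\<close>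

lemma Obj_Hopf_coc: "A \<in> Obj (Hopf_coc M) \<longleftrightarrow> hopf A"
  by (simp add: Hopf_coc_def hopf_def)

lemma Hom_Hopf_coc:
  assumes [simp]: "hopf A" "hopf B"
  shows "f \<in> Hom (Hopf_coc M) A B \<longleftrightarrow> hhom A B (Arr (ob A) (ob B) f)"
proof (cases "f \<in> Hom M (ob A) (ob B)")
  case True
  have v: "valid (Arr (ob A) (ob B) f)" using True by simp
  note raws = raw_comp raw_tens raw_structure raw_comon raw_hopf
  have "Arr (ob A) (ob B) f \<odot> mm A = mm B \<odot> (Arr (ob A) (ob B) f \<boxtimes> Arr (ob A) (ob B) f)
      \<longleftrightarrow> f \<cdot> mmult A = mmult B \<cdot> (f \<otimes>\<^sub>m f)"
    using v by (subst arrow_eq_iff) (simp_all add: raws del: valid_Arr)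
  moreover have "Arr (ob A) (ob B) f \<odot> un A = un B \<longleftrightarrow> f \<cdot> munit A = munit B"
    using v by (subst arrow_eq_iff) (simp_all add: raws del: valid_Arr)
  ultimately show ?thesis
    using True by (auto simp: Hopf_coc_def monoid_morphism_def comonoid_morphism_iff hhom_def)
next
  case False
  then show ?thesis
    by (auto simp: Hopf_coc_def monoid_morphism_def hhom_def cmap_def)
qed

lemma Hopf_coc_simps [simp]: "Id (Hopf_coc M) A = Id M (ob A)" "Comp (Hopf_coc M) = Comp M"
  by (simp_all add: Hopf_coc_def)

definition unit_hopf :: "('o, 'm) hopf_data" where
  "unit_hopf = \<lparr>ob = \<one>\<^sub>o, comult = raw (lu' \<one>\<^sub>o), counit = Id M \<one>\<^sub>o, mmult = lunit M \<one>\<^sub>o,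
     munit = Id M \<one>\<^sub>o, antipode = Id M \<one>\<^sub>o\<rparr>"

lemma unit_hopf [simp]:
  "ob unit_hopf = \<one>\<^sub>o" "\<Delta> unit_hopf = lu' \<one>\<^sub>o" "\<epsilon> unit_hopf = ide \<one>\<^sub>o"
  "mm unit_hopf = lu \<one>\<^sub>o" "un unit_hopf = ide \<one>\<^sub>o" "an unit_hopf = ide \<one>\<^sub>o"
  by (simp_all add: unit_hopf_def \<Delta>_def \<epsilon>_def ide_def mm_def lu_def un_def an_def valid_Arr_raw)

lemma hopf_unit_hopf [simp]: "hopf unit_hopf"
proof -
  have u: "coc unit_hopf"
    using coc_unit_comon unfolding coc_iff by simp
  have c: "cmap T unit_hopf f \<longleftrightarrow> cmap T unit_comon f" for T :: "('o, 'm) comon" and f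
    by (simp add: cmap_def)
  have "cmap (prod unit_hopf unit_hopf) unit_comon (\<epsilon> (prod unit_hopf unit_hopf))"
    using u by (intro cmap_counit coc_prod)
  then have "cmap (prod unit_hopf unit_hopf) unit_hopf (lu \<one>\<^sub>o)"
    using u by (simp add: c counit_prod)
  moreover have "lu \<one>\<^sub>o \<odot> (lu \<one>\<^sub>o \<boxtimes> ide \<one>\<^sub>o) = lu \<one>\<^sub>o \<odot> (ide \<one>\<^sub>o \<boxtimes> lu \<one>\<^sub>o) \<odot> \<alpha> \<one>\<^sub>o \<one>\<^sub>o \<one>\<^sub>o"
    by (simp add: triangle_arrow flip: lu_unit)
  ultimately show ?thesis
    unfolding hopf_iff using u cmap_ide[OF coc_unit_comon] by (simp add: c flip: lu_unit)
qed

lemma zero_object_Hopf_coc: "zero_object (Hopf_coc M) unit_hopf"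
  unfolding zero_object_def
proof (intro conjI ballI)
  show "unit_hopf \<in> Obj (Hopf_coc M)" by (simp add: Obj_Hopf_coc)
  fix A assume "A \<in> Obj (Hopf_coc M)"
  then have [simp]: "hopf A" by (simp add: Obj_Hopf_coc)
  show "\<exists>!f. f \<in> Hom (Hopf_coc M) unit_hopf A"
  proof (rule ex1I)
    show "raw (un A) \<in> Hom (Hopf_coc M) unit_hopf A"
      using hhom_triv[of unit_hopf A] by (simp add: Hom_Hopf_coc valid_Arr_raw)
    show "f = raw (un A)" if "f \<in> Hom (Hopf_coc M) unit_hopf A" for f
    proof -
      have h: "hhom unit_hopf A (Arr \<one>\<^sub>o (ob A) f)" using that by (simp add: Hom_Hopf_coc)
      then have "Arr \<one>\<^sub>o (ob A) f = un A" using hhomD[OF h] by simp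
      then show ?thesis by (metis arrow.sel(3))
    qed
  qed
  show "\<exists>!f. f \<in> Hom (Hopf_coc M) A unit_hopf"
  proof (rule ex1I)
    show "raw (\<epsilon> A) \<in> Hom (Hopf_coc M) A unit_hopf"
      using hhom_triv[of A unit_hopf] by (simp add: Hom_Hopf_coc valid_Arr_raw)
    show "f = raw (\<epsilon> A)" if "f \<in> Hom (Hopf_coc M) A unit_hopf" for f
    proof -
      have h: "hhom A unit_hopf (Arr (ob A) \<one>\<^sub>o f)" using that by (simp add: Hom_Hopf_coc)
      then have "Arr (ob A) \<one>\<^sub>o f = \<epsilon> A" using hhomD[OF h] by simp
      then show ?thesis by (metis arrow.sel(3))
    qed
  qed
qed

text \<open>\<open>zero_arrow\<close> allows any zero object as the intermediate one. Morphisms into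
  and out of it are unique, hence trivial, and the counit of that object cancels against its
  unit.\<close>

lemma zero_arrow_Hopf_coc:
  assumes [simp]: "hopf A" "hopf B"
  shows "zero_arrow (Hopf_coc M) A B z \<longleftrightarrow> z = raw (un B \<odot> \<epsilon> A)"
proof
  assume "zero_arrow (Hopf_coc M) A B z"
  then obtain Z f g where Z: "zero_object (Hopf_coc M) Z" and f: "f \<in> Hom (Hopf_coc M) A Z"
    and g: "g \<in> Hom (Hopf_coc M) Z B" and z: "z = g \<cdot> f"
    by (auto simp: zero_arrow_def)
  have [simp]: "hopf Z" using Z by (simp add: zero_object_def Obj_Hopf_coc)
  have "raw (un Z \<odot> \<epsilon> A) \<in> Hom (Hopf_coc M) A Z" "raw (un B \<odot> \<epsilon> Z) \<in> Hom (Hopf_coc M) Z B"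
    by (simp_all add: Hom_Hopf_coc valid_Arr_raw)
  then have "f = raw (un Z \<odot> \<epsilon> A)" "g = raw (un B \<odot> \<epsilon> Z)"
    using Z f g unfolding zero_object_def Obj_Hopf_coc by (metis Obj_Hopf_coc assms)+
  then have "z = raw ((un B \<odot> \<epsilon> Z) \<odot> (un Z \<odot> \<epsilon> A))"
    unfolding z by (subst raw_comp) simp_all
  then show "z = raw (un B \<odot> \<epsilon> A)" by simp
next
  assume z: "z = raw (un B \<odot> \<epsilon> A)"
  have "raw (un unit_hopf \<odot> \<epsilon> A) \<in> Hom (Hopf_coc M) A unit_hopf"
    "raw (un B \<odot> \<epsilon> unit_hopf) \<in> Hom (Hopf_coc M) unit_hopf B"
    using hhom_triv[OF assms(1) hopf_unit_hopf] hhom_triv[OF hopf_unit_hopf assms(2)]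
    by (simp_all add: Hom_Hopf_coc valid_Arr_raw)
  moreover have "z = raw (un B) \<cdot> raw (\<epsilon> A)"
    unfolding z by (simp add: raw_comp)
  ultimately show "zero_arrow (Hopf_coc M) A B z"
    unfolding zero_arrow_def using zero_object_Hopf_coc by (auto intro!: exI)
qed

end

section \<open>Kernels and images\<close>

context category
begin

text \<open>Uniqueness of the factorization is encoded by \<open>mono e\<close>, which leaves a bare
  existence clause to be checked; \<open>equalizer_iff\<close> relates this to
  \<open>equalizer\<close>.\<close>

definition iseq :: "('o, 'm) arrow \<Rightarrow> ('o, 'm) arrow \<Rightarrow> ('o, 'm) arrow \<Rightarrow> bool" where
  "iseq e f g \<longleftrightarrow> mono e \<and> valid f \<and> valid g \<and> dom f = cod e \<and> dom g = cod e \<and> cod f = cod g \<and>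
     f \<odot> e = g \<odot> e \<and>
     (\<forall>x. valid x \<longrightarrow> cod x = cod e \<longrightarrow> f \<odot> x = g \<odot> x \<longrightarrow> (\<exists>t. \<guillemotleft>t : dom x \<rightarrow> dom e\<guillemotright> \<and> e \<odot> t = x))"

lemma iseqI:
  assumes "mono e" "valid f" "valid g" "dom f = cod e" "dom g = cod e" "cod f = cod g" "f \<odot> e = g \<odot> e"
    "\<And>x. \<lbrakk>valid x; cod x = cod e; f \<odot> x = g \<odot> x\<rbrakk> \<Longrightarrow> \<exists>t. \<guillemotleft>t : dom x \<rightarrow> dom e\<guillemotright> \<and> e \<odot> t = x"
  shows "iseq e f g"
  using assms unfolding iseq_def by blast

lemma iseqD:
  assumes "iseq e f g"
  shows "mono e" "valid e" "valid f" "valid g" "dom f = cod e" "dom g = cod e" "cod f = cod g" "f \<odot> e = g \<odot> e"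
  using assms mono_valid unfolding iseq_def by blast+

lemma iseq_lift:
  assumes "iseq e f g" "valid x" "cod x = cod e" "f \<odot> x = g \<odot> x"
  obtains t where "valid t" "dom t = dom x" "cod t = dom e" "e \<odot> t = x"
  using assms unfolding iseq_def by blast

lemma iseq_ex:
  assumes "iseq e f g" "valid x" "cod x = cod e" "f \<odot> x = g \<odot> x"
  shows "\<exists>t. \<guillemotleft>t : dom x \<rightarrow> dom e\<guillemotright> \<and> e \<odot> t = x"
  using assms unfolding iseq_def by blast

lemma equalizer_iff:
  assumes [simp]: "A \<in> Obj C" "B \<in> Obj C"
  shows "equalizer C A B f g E e \<longleftrightarrow> iseq (Arr E A e) (Arr A B f) (Arr A B g)"
proof
  assume q: "equalizer C A B f g E e"
  then have t [simp]: "f \<in> Hom C A B" "g \<in> Hom C A B" "E \<in> Obj C" "e \<in> Hom C E A"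
    and eq: "f \<cdot> e = g \<cdot> e"
    and lift: "\<And>X x. \<lbrakk>X \<in> Obj C; x \<in> Hom C X A; f \<cdot> x = g \<cdot> x\<rbrakk> \<Longrightarrow> \<exists>!t. t \<in> Hom C X E \<and> e \<cdot> t = x"
    by (auto simp: equalizer_def)
  have m: "monic C E A e"
    unfolding monic_def
  proof (intro conjI ballI impI)
    fix X h k assume *: "X \<in> Obj C" "h \<in> Hom C X E" "k \<in> Hom C X E" "e \<cdot> h = e \<cdot> k"
    have "f \<cdot> e \<cdot> h = (f \<cdot> e) \<cdot> h"
      using * by (intro Comp_assoc[symmetric, of X E A B]) simp_all
    also have "\<dots> = g \<cdot> e \<cdot> h"
      unfolding eq using * by (intro Comp_assoc[of X E A B]) simp_all
    finally have "\<exists>!t. t \<in> Hom C X E \<and> e \<cdot> t = e \<cdot> h"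
      using * by (intro lift Comp_in_Hom[of X E A]) simp_all
    then show "h = k" using * by metis
  qed (rule t)
  show "iseq (Arr E A e) (Arr A B f) (Arr A B g)"
  proof (rule iseqI)
    show "mono (Arr E A e)" using m by (simp add: monic_iff)
    fix x assume x: "valid x" "cod x = cod (Arr E A e)" "Arr A B f \<odot> x = Arr A B g \<odot> x"
    then have o: "dom x \<in> Obj C" and h: "raw x \<in> Hom C (dom x) A"
      by (simp_all add: valid_in_Obj in_hom_raw)
    moreover have "f \<cdot> raw x = g \<cdot> raw x"
      using x by (simp add: comp_def)
    ultimately obtain t where "t \<in> Hom C (dom x) E" "e \<cdot> t = raw x"
      using lift by blast
    then show "\<exists>t. \<guillemotleft>t : dom x \<rightarrow> dom (Arr E A e)\<guillemotright> \<and> Arr E A e \<odot> t = x"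
      using o x by (intro exI[of _ "Arr (dom x) E t"]) (simp add: comp_Arr valid_Arr_raw)
  qed (simp_all add: comp_Arr eq)
next
  assume q: "iseq (Arr E A e) (Arr A B f) (Arr A B g)"
  have t [simp]: "f \<in> Hom C A B" "g \<in> Hom C A B" "E \<in> Obj C" "e \<in> Hom C E A"
    using iseqD(2-4)[OF q] by simp_all
  have "Arr E B (f \<cdot> e) = Arr E B (g \<cdot> e)"
    using iseqD(8)[OF q] by (simp add: comp_Arr)
  then have eq: "f \<cdot> e = g \<cdot> e" by simp
  show "equalizer C A B f g E e"
    unfolding equalizer_def
  proof (intro conjI ballI impI)
    fix X x assume x: "X \<in> Obj C" "x \<in> Hom C X A" "f \<cdot> x = g \<cdot> x"
    have "Arr A B f \<odot> Arr X A x = Arr A B g \<odot> Arr X A x"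
      using x by (simp add: comp_Arr)
    then obtain t where t: "valid t" "dom t = X" "cod t = E" "Arr E A e \<odot> t = Arr X A x"
      using x iseq_ex[OF q, of "Arr X A x"] by auto
    show "\<exists>!t. t \<in> Hom C X E \<and> e \<cdot> t = x"
    proof (rule ex1I[of _ "raw t"])
      show "raw t \<in> Hom C X E \<and> e \<cdot> raw t = x"
        using t in_hom_raw[of t] by (simp add: comp_def)
      have "monic C E A e"
        using iseqD(1)[OF q] by (simp add: monic_iff)
      then show "h = raw t" if "h \<in> Hom C X E \<and> e \<cdot> h = x" for h
        using that \<open>raw t \<in> Hom C X E \<and> e \<cdot> raw t = x\<close> x(1) unfolding monic_def by metis
    qed
  qed (simp_all add: eq)
qed

lemma coequalizer_epi:
  assumes q: "coequalizer C A B f g Q q" and [simp]: "A \<in> Obj C" "B \<in> Obj C"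
  shows "epi (Arr B Q q)"
proof -
  have [simp]: "f \<in> Hom C A B" "g \<in> Hom C A B" "Q \<in> Obj C" "q \<in> Hom C B Q" and eq: "q \<cdot> f = q \<cdot> g"
    and lift: "\<And>X x. \<lbrakk>X \<in> Obj C; x \<in> Hom C B X; x \<cdot> f = x \<cdot> g\<rbrakk> \<Longrightarrow> \<exists>!t. t \<in> Hom C Q X \<and> t \<cdot> q = x"
    using q by (auto simp: coequalizer_def)
  have "epic C B Q q"
    unfolding epic_def
  proof (intro conjI ballI impI)
    fix X h k assume *: "X \<in> Obj C" "h \<in> Hom C Q X" "k \<in> Hom C Q X" "h \<cdot> q = k \<cdot> q"
    have "(h \<cdot> q) \<cdot> f = h \<cdot> q \<cdot> f"
      using * by (intro Comp_assoc[of A B Q X]) simp_all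
    also have "\<dots> = (h \<cdot> q) \<cdot> g"
      unfolding eq using * by (intro Comp_assoc[of A B Q X, symmetric]) simp_all
    finally have "\<exists>!t. t \<in> Hom C Q X \<and> t \<cdot> q = h \<cdot> q"
      using * by (intro lift Comp_in_Hom[of B Q X]) simp_all
    then show "h = k" using * by metis
  qed simp
  then show ?thesis by (simp add: epic_iff)
qed

end

section \<open>Addition of typed arrows, kernels and cokernels\<close>

context preadditive_category
begin

notation comp (infixr "\<odot>" 55)
notation in_hom ("\<guillemotleft>_ : _ \<rightarrow> _\<guillemotright>")

definition add :: "('o, 'm) arrow \<Rightarrow> ('o, 'm) arrow \<Rightarrow> ('o, 'm) arrow" where
  "add f g = Arr (dom f) (cod f) (Add C (dom f) (cod f) (raw f) (raw g))"

definition zero :: "'o \<Rightarrow> 'o \<Rightarrow> ('o, 'm) arrow" where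
  "zero A B = Arr A B (Zero C A B)"

lemma zero_in_hom [simp]:
  "valid (zero A B) \<longleftrightarrow> A \<in> Obj C \<and> B \<in> Obj C" "dom (zero A B) = A" "cod (zero A B) = B"
  using monoid.one_closed[OF group.is_monoid[OF comm_group.axioms(2)[OF Hom_comm_group]], of A B]
  by (auto simp: zero_def)

lemma add_in_hom [simp]:
  assumes "valid f" "valid g" "dom f = dom g" "cod f = cod g"
  shows "valid (add f g)" "dom (add f g) = dom g" "cod (add f g) = cod g"
  using assms valid_in_Obj[of g] in_hom_raw[of f] in_hom_raw[of g]
    monoid.m_closed[OF group.is_monoid[OF comm_group.axioms(2)[OF Hom_comm_group]], of "dom g" "cod g" "raw f" "raw g"]
  by (auto simp: add_def)

lemma add_zero_left [simp]:
  assumes "valid f" "dom f = A" "cod f = B" shows "add (zero A B) f = f"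
  using assms valid_in_Obj[of f] in_hom_raw[of f]
    monoid.l_one[OF group.is_monoid[OF comm_group.axioms(2)[OF Hom_comm_group]], of "dom f" "cod f" "raw f"]
  by (auto simp: add_def zero_def valid_Arr_raw)

lemma add_right_cancel:
  assumes "add f h = add g h" "valid f" "valid g" "valid h" "dom f = dom h" "dom g = dom h" "cod f = cod h" "cod g = cod h"
  shows "f = g"
proof -
  let ?G = "\<lparr>carrier = Hom C (dom h) (cod h), monoid.mult = Add C (dom h) (cod h), one = Zero C (dom h) (cod h)\<rparr>"
  have G: "group ?G"
    using assms valid_in_Obj[of h] by (intro comm_group.axioms(2) Hom_comm_group) auto
  have "raw f \<otimes>\<^bsub>?G\<^esub> raw h = raw g \<otimes>\<^bsub>?G\<^esub> raw h"
    using assms by (simp add: add_def)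
  then have "raw f = raw g"
    using assms in_hom_raw[of f] in_hom_raw[of g] in_hom_raw[of h]
    by (subst (asm) group.right_cancel[OF G]) auto
  then show ?thesis using assms by (metis valid_Arr_raw)
qed

text \<open>Stands in for subtraction: a difference is introduced through the equation d + g = f and
  treated by cancellation (\<open>add_right_cancel\<close>), without a negation on typed
  arrows.\<close>

lemma ex_difference:
  assumes "valid f" "valid g" "dom f = dom g" "cod f = cod g"
  obtains d where "valid d" "dom d = dom g" "cod d = cod g" "add d g = f"
proof -
  let ?G = "\<lparr>carrier = Hom C (dom g) (cod g), monoid.mult = Add C (dom g) (cod g), one = Zero C (dom g) (cod g)\<rparr>"
  have G: "group ?G"
    using assms valid_in_Obj[of g] by (intro comm_group.axioms(2) Hom_comm_group) auto
  have h: "raw f \<in> carrier ?G" "raw g \<in> carrier ?G"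
    using assms in_hom_raw[of f] in_hom_raw[of g] by auto
  define d where "d = raw f \<otimes>\<^bsub>?G\<^esub> m_inv ?G (raw g)"
  have "d \<in> carrier ?G"
    unfolding d_def using h by (intro monoid.m_closed group.is_monoid[OF G] group.inv_closed[OF G])
  moreover have "d \<otimes>\<^bsub>?G\<^esub> raw g = raw f"
    unfolding d_def using h by (subst monoid.m_assoc[OF group.is_monoid[OF G]])
      (simp_all only: group.inv_closed[OF G] group.l_inv[OF G] monoid.r_one[OF group.is_monoid[OF G]])
  ultimately show ?thesis
    using assms valid_in_Obj[of g] by (intro that[of "Arr (dom g) (cod g) d"]) (auto simp: add_def valid_Arr_raw)
qed

lemma comp_add [simp]:
  assumes "valid f" "valid g" "valid h" "dom f = dom g" "cod f = cod g" "cod g = dom h"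
  shows "h \<odot> add f g = add (h \<odot> f) (h \<odot> g)"
proof -
  have "valid (add f g)" "dom (add f g) = dom g" "cod (add f g) = cod g" using assms by simp_all
  moreover have "raw h \<cdot> Add C (dom g) (cod g) (raw f) (raw g) = Add C (dom g) (cod h) (raw h \<cdot> raw f) (raw h \<cdot> raw g)"
    using assms valid_in_Obj[of g] valid_in_Obj[of h] in_hom_raw[of f] in_hom_raw[of g] in_hom_raw[of h]
    by (intro Comp_Add_right) auto
  ultimately show ?thesis
    using assms by (simp add: comp_def) (simp add: add_def)
qed

lemma add_comp [simp]:
  assumes "valid f" "valid g" "valid h" "dom f = dom g" "cod f = cod g" "cod h = dom g"
  shows "add f g \<odot> h = add (f \<odot> h) (g \<odot> h)"
proof -
  have "valid (add f g)" "dom (add f g) = dom g" "cod (add f g) = cod g" using assms by simp_all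
  moreover have "Add C (dom g) (cod g) (raw f) (raw g) \<cdot> raw h = Add C (dom h) (cod g) (raw f \<cdot> raw h) (raw g \<cdot> raw h)"
    using assms valid_in_Obj[of g] valid_in_Obj[of h] in_hom_raw[of f] in_hom_raw[of g] in_hom_raw[of h]
    by (intro Comp_Add_left) auto
  ultimately show ?thesis
    using assms by (simp add: comp_def) (simp add: add_def)
qed

text \<open>An additive operation sends a zero arrow to some z with z + z = z. Preservation of zero
  arrows by composition and by tensoring is derived from this.\<close>

lemma add_idem:
  assumes "add z z = z" "valid z" shows "z = zero (dom z) (cod z)"
  using assms valid_in_Obj[of z] by (intro add_right_cancel[of z z]) simp_all

lemma comp_zero [simp]:
  assumes [simp]: "valid f" "dom f = B" "A \<in> Obj C" shows "f \<odot> zero A B = zero A (cod f)"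
proof -
  have [simp]: "B \<in> Obj C" using valid_in_Obj(1)[of f] by simp
  show ?thesis
    using add_idem[of "f \<odot> zero A B"] comp_add[of "zero A B" "zero A B" f] by (simp del: comp_add)
qed

lemma zero_comp [simp]:
  assumes [simp]: "valid f" "cod f = A" "B \<in> Obj C" shows "zero A B \<odot> f = zero (dom f) B"
proof -
  have [simp]: "A \<in> Obj C" using valid_in_Obj(2)[of f] by simp
  show ?thesis
    using add_idem[of "zero A B \<odot> f"] add_comp[of "zero A B" "zero A B" f] by (simp del: add_comp)
qed

definition ker :: "('o, 'm) arrow \<Rightarrow> ('o, 'm) arrow \<Rightarrow> bool" where
  "ker k f \<longleftrightarrow> iseq k f (zero (dom f) (cod f))"

definition coker :: "('o, 'm) arrow \<Rightarrow> ('o, 'm) arrow \<Rightarrow> bool" where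
  "coker q f \<longleftrightarrow> epi q \<and> valid f \<and> dom q = cod f \<and> q \<odot> f = zero (dom f) (cod q) \<and>
     (\<forall>x. valid x \<longrightarrow> dom x = cod f \<longrightarrow> x \<odot> f = zero (dom f) (cod x) \<longrightarrow>
       (\<exists>t. \<guillemotleft>t : cod q \<rightarrow> cod x\<guillemotright> \<and> t \<odot> q = x))"

lemma kerD:
  assumes "ker k f"
  shows "mono k" "valid k" "valid f" "dom f = cod k" "f \<odot> k = zero (dom k) (cod f)"
proof -
  note q = assms[unfolded ker_def]
  show "mono k" "valid k" "valid f" "dom f = cod k" using iseqD[OF q] by simp_all
  then show "f \<odot> k = zero (dom k) (cod f)" using iseqD(8)[OF q] valid_in_Obj[of f] by simp
qed

lemma ker_ex:
  assumes k: "ker k f" and x: "valid x" "cod x = cod k" "f \<odot> x = zero (dom x) (cod f)"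
  shows "\<exists>t. \<guillemotleft>t : dom x \<rightarrow> dom k\<guillemotright> \<and> k \<odot> t = x"
proof (rule iseq_ex[OF k[unfolded ker_def] x(1,2)])
  have "zero (dom f) (cod f) \<odot> x = zero (dom x) (cod f)"
    using x kerD[OF k] valid_in_Obj(2)[of f] by (intro zero_comp) simp_all
  then show "f \<odot> x = zero (dom f) (cod f) \<odot> x" using x by simp
qed

lemma ker_lift:
  assumes "ker k f" "valid x" "cod x = cod k" "f \<odot> x = zero (dom x) (cod f)"
  obtains t where "valid t" "dom t = dom x" "cod t = dom k" "k \<odot> t = x"
  using ker_ex[OF assms] by blast

lemma kerI:
  assumes m: "mono k" and [simp]: "valid f" "dom f = cod k" "f \<odot> k = zero (dom k) (cod f)"
    and l: "\<And>x. \<lbrakk>valid x; cod x = cod k; f \<odot> x = zero (dom x) (cod f)\<rbrakk> \<Longrightarrow> \<exists>t. \<guillemotleft>t : dom x \<rightarrow> dom k\<guillemotright> \<and> k \<odot> t = x"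
  shows "ker k f"
proof -
  have [simp]: "valid k" by (rule mono_valid[OF m])
  have [simp]: "cod f \<in> Obj C" "cod k \<in> Obj C" using valid_in_Obj by auto
  show ?thesis
    unfolding ker_def using m l by (intro iseqI) simp_all
qed

lemma cokerD:
  assumes "coker q f"
  shows "epi q" "valid q" "valid f" "dom q = cod f" "q \<odot> f = zero (dom f) (cod q)"
  using assms epi_valid unfolding coker_def by blast+

lemma coker_ex:
  assumes "coker q f" "valid x" "dom x = cod f" "x \<odot> f = zero (dom f) (cod x)"
  shows "\<exists>t. \<guillemotleft>t : cod q \<rightarrow> cod x\<guillemotright> \<and> t \<odot> q = x"
  using assms unfolding coker_def by blast

lemma coker_lift:
  assumes "coker q f" "valid x" "dom x = cod f" "x \<odot> f = zero (dom f) (cod x)"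
  obtains t where "valid t" "dom t = cod q" "cod t = cod x" "t \<odot> q = x"
  using assms unfolding coker_def by blast

text \<open>An equalizer is the kernel of the difference \<open>d\<close>. Thus equalizers exist and
  are preserved by exact functors as soon as the same is known for kernels.\<close>

lemma iseq_iff_ker:
  assumes d: "add d g = f" and [simp]: "valid d" "valid g" "dom d = cod e" "dom g = cod e" "cod d = cod g"
  shows "iseq e f g \<longleftrightarrow> ker e d"
proof -
  have [simp]: "cod e \<in> Obj C" "cod g \<in> Obj C" using valid_in_Obj[of g] by auto
  have *: "f \<odot> x = g \<odot> x \<longleftrightarrow> d \<odot> x = zero (dom x) (cod g)" if [simp]: "valid x" "cod x = cod e" for x
  proof -
    have [simp]: "dom x \<in> Obj C" using valid_in_Obj[of x] by simp
    have fx: "f \<odot> x = add (d \<odot> x) (g \<odot> x)" unfolding d[symmetric] by simp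
    show ?thesis
    proof
      assume "f \<odot> x = g \<odot> x"
      then have "add (d \<odot> x) (g \<odot> x) = add (zero (dom x) (cod g)) (g \<odot> x)"
        unfolding fx by simp
      then show "d \<odot> x = zero (dom x) (cod g)"
        by (rule add_right_cancel) simp_all
    qed (simp add: fx)
  qed
  have [simp]: "valid f" "dom f = cod e" "cod f = cod g" unfolding d[symmetric] by simp_all
  show ?thesis
  proof
    assume q: "iseq e f g"
    note [simp] = iseqD(2)[OF q]
    show "ker e d"
      using iseqD(1,8)[OF q] by (intro kerI iseq_ex[OF q]) (auto simp: *)
  next
    assume q: "ker e d"
    note [simp] = kerD(2)[OF q]
    show "iseq e f g"
      using kerD(1,5)[OF q] by (intro iseqI ker_ex[OF q]) (auto simp: *)
  qed
qed

end

section \<open>Exactness and factorization in an abelian category\<close>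

context abelian_category
begin

text \<open>The only endomorphism of a zero object is both its identity and its additive zero, so
  whatever factors through a zero object is additively zero.\<close>

lemma zero_arrow_iff:
  assumes [simp]: "A \<in> Obj C" "B \<in> Obj C"
  shows "zero_arrow C A B z \<longleftrightarrow> z = Zero C A B"
proof -
  have *: "g \<cdot> f = Zero C A B" if Z: "zero_object C Z" and f: "f \<in> Hom C A Z" and g: "g \<in> Hom C Z B" for Z f g
  proof -
    have [simp]: "Z \<in> Obj C" using Z by (simp add: zero_object_def)
    have "Zero C Z Z \<in> Hom C Z Z" "Id C Z \<in> Hom C Z Z"
      using zero_in_hom(1)[of Z Z] by (simp_all add: zero_def Id_in_Hom)
    then have "Zero C Z Z = Id C Z" using Z unfolding zero_object_def by blast
    then have e: "ide Z = zero Z Z" by (simp add: ide_def zero_def)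
    have "Arr Z B g \<odot> Arr A Z f = Arr Z B g \<odot> ide Z \<odot> Arr A Z f" using f g by simp
    also have "\<dots> = zero A B" unfolding e using f g by simp
    finally show ?thesis using f g by (simp add: zero_def comp_Arr)
  qed
  obtain Z where Z: "zero_object C Z" using ex_zero_object by blast
  then obtain f g where "f \<in> Hom C A Z" "g \<in> Hom C Z B"
    unfolding zero_object_def by (metis assms)
  then show ?thesis
    unfolding zero_arrow_def using Z * by metis
qed

lemma kernel_iff:
  assumes [simp]: "A \<in> Obj C" "B \<in> Obj C"
  shows "kernel C A B f K k \<longleftrightarrow> ker (Arr K A k) (Arr A B f)"
  by (simp add: kernel_def zero_arrow_iff equalizer_iff ker_def zero_def)

lemma cokernel_iff:
  assumes [simp]: "A \<in> Obj C" "B \<in> Obj C"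
  shows "cokernel C A B f Q q \<longleftrightarrow> coker (Arr B Q q) (Arr A B f)"
proof
  assume "cokernel C A B f Q q"
  then have c: "coequalizer C A B f (Zero C A B) Q q"
    by (simp add: cokernel_def zero_arrow_iff)
  then have [simp]: "f \<in> Hom C A B" "Q \<in> Obj C" "q \<in> Hom C B Q" and e: "q \<cdot> f = q \<cdot> Zero C A B"
    and lift: "\<And>X x. \<lbrakk>X \<in> Obj C; x \<in> Hom C B X; x \<cdot> f = x \<cdot> Zero C A B\<rbrakk> \<Longrightarrow> \<exists>!t. t \<in> Hom C Q X \<and> t \<cdot> q = x"
    by (auto simp: coequalizer_def)
  have z: "x \<cdot> Zero C A B = Zero C A X" if "X \<in> Obj C" "x \<in> Hom C B X" for x X
    using comp_zero[of "Arr B X x" B A] zero_in_hom(1)[of A B] that by (simp add: zero_def comp_Arr)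
  show "coker (Arr B Q q) (Arr A B f)"
    unfolding coker_def
  proof (intro conjI allI impI)
    show "epi (Arr B Q q)" using c by (rule coequalizer_epi) simp_all
    show "Arr B Q q \<odot> Arr A B f = zero (dom (Arr A B f)) (cod (Arr B Q q))"
      by (simp add: comp_Arr e z[of Q] zero_def)
    fix x assume x: "valid x" "dom x = cod (Arr A B f)" "x \<odot> Arr A B f = zero (dom (Arr A B f)) (cod x)"
    then have o: "cod x \<in> Obj C" "raw x \<in> Hom C B (cod x)" by (simp_all add: valid_in_Obj in_hom_raw)
    moreover have "raw x \<cdot> f = raw x \<cdot> Zero C A B"
      using x o by (simp add: z[OF o] zero_def comp_def)
    ultimately obtain t where "t \<in> Hom C Q (cod x)" "t \<cdot> q = raw x" using lift by blast
    then show "\<exists>t. \<guillemotleft>t : cod (Arr B Q q) \<rightarrow> cod x\<guillemotright> \<and> t \<odot> Arr B Q q = x"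
      using o x by (intro exI[of _ "Arr Q (cod x) t"]) (simp add: comp_Arr valid_Arr_raw)
  qed simp_all
next
  assume c: "coker (Arr B Q q) (Arr A B f)"
  have [simp]: "f \<in> Hom C A B" "Q \<in> Obj C" "q \<in> Hom C B Q" using cokerD(2,3)[OF c] by simp_all
  have z: "x \<cdot> Zero C A B = Zero C A X" if "X \<in> Obj C" "x \<in> Hom C B X" for x X
    using comp_zero[of "Arr B X x" B A] zero_in_hom(1)[of A B] that by (simp add: zero_def comp_Arr)
  have "coequalizer C A B f (Zero C A B) Q q"
    unfolding coequalizer_def
  proof (intro conjI ballI impI)
    show "Zero C A B \<in> Hom C A B" using zero_in_hom(1)[of A B] by (simp add: zero_def)
    show "q \<cdot> f = q \<cdot> Zero C A B" using cokerD(5)[OF c] by (simp add: comp_Arr zero_def z[of Q])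
    fix X x assume x: "X \<in> Obj C" "x \<in> Hom C B X" "x \<cdot> f = x \<cdot> Zero C A B"
    obtain t where t: "valid t" "dom t = Q" "cod t = X" "t \<odot> Arr B Q q = Arr B X x"
      using coker_lift[OF c, of "Arr B X x"] x by (auto simp: comp_Arr zero_def z[of X])
    show "\<exists>!t. t \<in> Hom C Q X \<and> t \<cdot> q = x"
    proof (rule ex1I[of _ "raw t"])
      show "raw t \<in> Hom C Q X \<and> raw t \<cdot> q = x"
        using t in_hom_raw[of t] by (simp add: comp_def)
      have "epic C B Q q"
        using cokerD(1)[OF c] by (simp add: epic_iff)
      then show "h = raw t" if "h \<in> Hom C Q X \<and> h \<cdot> q = x" for h
        using that \<open>raw t \<in> Hom C Q X \<and> raw t \<cdot> q = x\<close> x(1) unfolding epic_def by metis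
    qed
  qed simp_all
  then show "cokernel C A B f Q q"
    by (simp add: cokernel_def zero_arrow_iff)
qed

lemma ex_ker: assumes "valid f" obtains k where "ker k f"
  using ex_kernel[of "dom f" "cod f" "raw f"] assms valid_in_Obj[of f] in_hom_raw[of f]
  by (auto simp: kernel_iff valid_Arr_raw)

lemma ex_coker: assumes "valid f" obtains q where "coker q f"
  using ex_cokernel[of "dom f" "cod f" "raw f"] assms valid_in_Obj[of f] in_hom_raw[of f]
  by (auto simp: cokernel_iff valid_Arr_raw)

text \<open>The axiom provides some f of which m is the kernel. As f factors through the cokernel c
  of m, everything killed by c is killed by f, so m is also the kernel of c. This makes (m, c) short
  exact, the form in which exactness of functors is assumed.\<close>

lemma mono_exact:
  assumes m: "mono m" obtains c where "ker m c" "coker c m"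
proof -
  have [simp]: "valid m" by (rule mono_valid[OF m])
  have [simp]: "dom m \<in> Obj C" "cod m \<in> Obj C" by (simp_all add: valid_in_Obj)
  have "is_kernel C (dom m) (cod m) (raw m)"
    using m by (intro monic_is_kernel) (simp_all add: monic_iff valid_Arr_raw)
  then obtain B f where "B \<in> Obj C" "ker m (Arr (cod m) B f)"
    by (auto simp: is_kernel_def kernel_iff valid_Arr_raw)
  then obtain f where f: "ker m f" by blast
  note [simp] = kerD(3-5)[OF f]
  obtain c where c: "coker c m" using ex_coker[of m] by auto
  note [simp] = cokerD(2-5)[OF c]
  obtain t where t: "valid t" "dom t = cod c" "cod t = cod f" "t \<odot> c = f"
    using coker_lift[OF c, of f] by auto
  have "ker m c"
  proof (rule kerI[OF m])
    fix x assume [simp]: "valid x" "cod x = cod m" and x: "c \<odot> x = zero (dom x) (cod c)"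
    have [simp]: "dom x \<in> Obj C" by (simp add: valid_in_Obj)
    have "f \<odot> x = zero (dom x) (cod f)" using comp_reassoc[OF t(4), of x] t by (simp add: x)
    then show "\<exists>u. \<guillemotleft>u : dom x \<rightarrow> dom m\<guillemotright> \<and> m \<odot> u = x" by (intro ker_ex[OF f]) auto
  qed simp_all
  then show ?thesis using c by (rule that)
qed

lemma epi_exact:
  assumes e: "epi e" obtains k where "ker k e" "coker e k"
proof -
  have [simp]: "valid e" by (rule epi_valid[OF e])
  have [simp]: "dom e \<in> Obj C" "cod e \<in> Obj C" by (simp_all add: valid_in_Obj)
  have "is_cokernel C (dom e) (cod e) (raw e)"
    using e by (intro epic_is_cokernel) (simp_all add: epic_iff valid_Arr_raw)
  then obtain A f where "A \<in> Obj C" "coker e (Arr A (dom e) f)"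
    by (auto simp: is_cokernel_def cokernel_iff valid_Arr_raw)
  then obtain f where f: "coker e f" by blast
  note [simp] = cokerD(3-5)[OF f]
  obtain k where k: "ker k e" using ex_ker[of e] by auto
  note [simp] = kerD(2)[OF k]
  have ck: "cod k = cod f" using kerD(4)[OF k] by simp
  have zk: "e \<odot> k = zero (dom k) (cod e)" by (rule kerD[OF k])
  obtain t where t: "valid t" "dom t = dom f" "cod t = dom k" "k \<odot> t = f"
    using ker_lift[OF k, of f] by (auto simp: ck)
  have "coker e k"
    unfolding coker_def
  proof (intro conjI allI impI)
    fix x assume x: "valid x" "dom x = cod k" "x \<odot> k = zero (dom k) (cod x)"
    have [simp]: "cod x \<in> Obj C" using x by (simp add: valid_in_Obj)
    have "x \<odot> f = (x \<odot> k) \<odot> t" by (simp add: t(4))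
    also have "\<dots> = zero (dom f) (cod x)" unfolding x(3) using t by simp
    finally have "x \<odot> f = zero (dom f) (cod x)" .
    then show "\<exists>u. \<guillemotleft>u : cod e \<rightarrow> cod x\<guillemotright> \<and> u \<odot> e = x"
      using x ck by (intro coker_ex[OF f]) simp_all
  qed (simp_all add: e ck zk)
  with k show ?thesis by (rule that)
qed

lemma monoI_zero:
  assumes [simp]: "valid m" and z: "\<And>x. \<lbrakk>valid x; cod x = dom m; m \<odot> x = zero (dom x) (cod m)\<rbrakk> \<Longrightarrow> x = zero (dom x) (dom m)"
  shows "mono m"
proof (rule monoI)
  have [simp]: "dom m \<in> Obj C" "cod m \<in> Obj C" by (simp_all add: valid_in_Obj)
  fix g h assume gh [simp]: "valid g" "valid h" "cod g = dom m" "cod h = dom m" and e: "m \<odot> g = m \<odot> h"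
  have "dom (m \<odot> g) = dom (m \<odot> h)" unfolding e ..
  then have [simp]: "dom g = dom h" by simp
  have [simp]: "dom h \<in> Obj C" by (simp add: valid_in_Obj)
  obtain d where [simp]: "valid d" "dom d = dom h" "cod d = dom m" and d: "add d h = g"
    using ex_difference[of g h] by auto
  have "add (m \<odot> d) (m \<odot> h) = add (zero (dom h) (cod m)) (m \<odot> h)"
    using e unfolding d[symmetric] by simp
  then have "m \<odot> d = zero (dom h) (cod m)"
    by (rule add_right_cancel) simp_all
  then have "d = zero (dom h) (dom m)" using z[of d] by simp
  then show "g = h" unfolding d[symmetric] by simp
qed simp

text \<open>Take e as the cokernel of the kernel of f, and let f = m e. If m x = 0, then m factors
  through the cokernel q of x, so the kernel l of q e is killed by f and hence by e. Since q e is
  the cokernel of l, e factors through it: y q e = e, so y q = 1 and x = y q x = 0.\<close>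

lemma epi_mono_factorization:
  assumes [simp]: "valid f"
  obtains e m where "epi e" "mono m" "cod e = dom m" "m \<odot> e = f"
proof -
  have [simp]: "dom f \<in> Obj C" "cod f \<in> Obj C" by (simp_all add: valid_in_Obj)
  obtain k where k: "ker k f" using ex_ker[of f] by auto
  note [simp] = kerD(2-5)[OF k]
  have [simp]: "dom k \<in> Obj C" by (simp add: valid_in_Obj)
  obtain e where e: "coker e k" using ex_coker[of k] by auto
  note [simp] = cokerD(2-5)[OF e]
  obtain m where m [simp]: "valid m" "dom m = cod e" "cod m = cod f" and f: "m \<odot> e = f"
    using coker_lift[OF e, of f] by auto
  have "mono m"
  proof (rule monoI_zero)
    fix x assume x [simp]: "valid x" "cod x = dom m" and z: "m \<odot> x = zero (dom x) (cod m)"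
    have [simp]: "dom x \<in> Obj C" "cod e \<in> Obj C" by (simp_all add: valid_in_Obj)
    obtain q where q: "coker q x" using ex_coker[of x] by auto
    note [simp] = cokerD(2-5)[OF q]
    obtain n where n [simp]: "valid n" "dom n = cod q" "cod n = cod f" and m: "n \<odot> q = m"
      using coker_lift[OF q, of m] z by auto
    obtain l where l: "ker l (q \<odot> e)" "coker (q \<odot> e) l"
      using epi_exact[of "q \<odot> e"] epi_comp[OF cokerD(1)[OF q] cokerD(1)[OF e]] by auto
    have [simp]: "valid l" "cod l = cod k"
      using kerD(2,4)[OF l(1)] by simp_all
    have ql: "q \<odot> e \<odot> l = zero (dom l) (cod q)"
      using kerD(5)[OF l(1)] by simp
    have [simp]: "dom l \<in> Obj C" by (simp add: valid_in_Obj)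
    have fe: "n \<odot> q \<odot> e = f" using m f by (simp flip: comp_assoc)
    have "f \<odot> l = zero (dom l) (cod f)"
      using comp_reassoc3[OF fe, of l] by (simp add: ql)
    then obtain s where s [simp]: "valid s" "dom s = dom l" "cod s = dom k" and ls: "k \<odot> s = l"
      using ker_lift[OF k, of l] by auto
    have "e \<odot> l = zero (dom l) (cod e)"
      using comp_reassoc[OF cokerD(5)[OF e], of s] by (simp add: ls)
    then obtain y where y [simp]: "valid y" "dom y = cod q" "cod y = cod e" and ye: "y \<odot> q \<odot> e = e"
      using coker_lift[OF l(2), of e] by auto
    have "y \<odot> q = ide (cod e)"
      by (rule epiD[OF cokerD(1)[OF e]]) (simp_all add: ye)
    then have "x = (y \<odot> q) \<odot> x" by simp
    also have "\<dots> = zero (dom x) (dom m)" by simp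
    finally show "x = zero (dom x) (dom m)" .
  qed simp
  then show ?thesis using cokerD(1)[OF e] f by (intro that) simp_all
qed

text \<open>e is the cokernel of its kernel k, and a k = 0 because m a k = b e k = 0 with m monic.
  Hence a factors through e.\<close>

lemma fill_in:
  assumes e: "epi e" and m: "mono m" and eq: "m \<odot> a = b \<odot> e"
    and [simp]: "valid a" "valid b" "cod a = dom m" "dom b = cod e"
  obtains d where "valid d" "dom d = cod e" "cod d = dom m" "d \<odot> e = a" "m \<odot> d = b"
proof -
  have [simp]: "valid e" "valid m" using epi_valid[OF e] mono_valid[OF m] by auto
  have "dom (m \<odot> a) = dom (b \<odot> e)" "cod (m \<odot> a) = cod (b \<odot> e)" unfolding eq by simp_all
  then have [simp]: "dom a = dom e" "cod m = cod b" by simp_all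
  obtain k where k: "ker k e" "coker e k" using epi_exact[OF e] .
  have [simp]: "valid k" "cod k = dom e" using kerD(2,4)[OF k(1)] by simp_all
  have ek: "e \<odot> k = zero (dom k) (cod e)" by (rule kerD[OF k(1)])
  have [simp]: "dom k \<in> Obj C" "dom m \<in> Obj C" "cod b \<in> Obj C" by (simp_all add: valid_in_Obj)
  have "m \<odot> a \<odot> k = m \<odot> zero (dom k) (dom m)"
    using comp_reassoc[OF eq, of k] by (simp add: ek)
  then have "a \<odot> k = zero (dom k) (dom m)"
    by (rule monoD[OF m]) simp_all
  then obtain d where d [simp]: "valid d" "dom d = cod e" "cod d = cod a" and de: "d \<odot> e = a"
    using coker_lift[OF k(2), of a] by auto
  have "m \<odot> d = b" by (rule epiD[OF e]) (simp_all add: de eq)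
  then show ?thesis using de by (intro that[of d]) simp_all
qed

lemma ex_equalizer:
  assumes [simp]: "valid f" "valid g" "dom f = dom g" "cod f = cod g"
  obtains e where "iseq e f g" "cod e = dom g"
proof -
  obtain d where [simp]: "valid d" "dom d = dom g" "cod d = cod g" and d: "add d g = f"
    using ex_difference[of f g] by auto
  obtain k where k: "ker k d" using ex_ker[of d] by auto
  have c: "cod k = dom g" using kerD(4)[OF k] by simp
  have "iseq k f g"
    using k c by (subst iseq_iff_ker[OF d]) simp_all
  then show ?thesis using c by (rule that)
qed

section \<open>Exact functors\<close>

definition exact_functor :: "('o \<Rightarrow> 'o) \<Rightarrow> (('o, 'm) arrow \<Rightarrow> ('o, 'm) arrow) \<Rightarrow> bool" where
  "exact_functor Fo F \<longleftrightarrow>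
     (\<forall>f. valid f \<longrightarrow> \<guillemotleft>F f : Fo (dom f) \<rightarrow> Fo (cod f)\<guillemotright>) \<and>
     (\<forall>f g. valid f \<longrightarrow> valid g \<longrightarrow> cod f = dom g \<longrightarrow> F (g \<odot> f) = F g \<odot> F f) \<and>
     (\<forall>f g. valid f \<longrightarrow> valid g \<longrightarrow> dom f = dom g \<longrightarrow> cod f = cod g \<longrightarrow> F (add f g) = add (F f) (F g)) \<and>
     (\<forall>k c. ker k c \<longrightarrow> coker c k \<longrightarrow> ker (F k) (F c) \<and> coker (F c) (F k))"

context
  fixes Fo F assumes F: "exact_functor Fo F"
begin

lemma exact_functor_hom [simp]:
  "valid f \<Longrightarrow> valid (F f)" "valid f \<Longrightarrow> dom (F f) = Fo (dom f)" "valid f \<Longrightarrow> cod (F f) = Fo (cod f)"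
  using F by (auto simp: exact_functor_def)

lemma exact_functor_mono: assumes "mono m" shows "mono (F m)"
proof -
  obtain c where "ker m c" "coker c m" using mono_exact[OF assms] .
  then have "ker (F m) (F c)" using F unfolding exact_functor_def by blast
  then show ?thesis by (rule kerD)
qed

lemma exact_functor_epi: assumes "epi e" shows "epi (F e)"
proof -
  obtain k where "ker k e" "coker e k" using epi_exact[OF assms] .
  then have "coker (F e) (F k)" using F unfolding exact_functor_def by blast
  then show ?thesis by (rule cokerD)
qed

text \<open>By definition only short exact sequences are preserved, but f need not be epic. Write f
  = m e with m monic: then (k, e) is short exact, and as F m is again monic, the kernel of F f is
  that of F e.\<close>

lemma exact_functor_ker: assumes k: "ker k f" shows "ker (F k) (F f)"
proof -
  note [simp] = kerD(2-5)[OF k]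
  have [simp]: "cod f \<in> Obj C" "dom k \<in> Obj C" by (simp_all add: valid_in_Obj)
  obtain e m where e: "epi e" and m: "mono m" and [simp]: "cod e = dom m" and f: "m \<odot> e = f"
    using epi_mono_factorization[of f] by auto
  have [simp]: "valid e" "valid m" using e m by (simp_all add: epi_valid mono_valid)
  have dc: "dom (m \<odot> e) = dom f" "cod (m \<odot> e) = cod f" unfolding f by simp_all
  then have [simp]: "dom e = cod k" "cod m = cod f" by simp_all
  have [simp]: "dom m \<in> Obj C" by (simp add: valid_in_Obj)
  have z: "e \<odot> x = zero (dom x) (dom m)" if [simp]: "valid x" "cod x = cod k" and "f \<odot> x = zero (dom x) (cod f)" for x
  proof (rule monoD[OF m])
    have [simp]: "dom x \<in> Obj C" by (simp add: valid_in_Obj)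
    show "valid (zero (dom x) (dom m))" "m \<odot> e \<odot> x = m \<odot> zero (dom x) (dom m)"
      using that comp_reassoc[OF f, of x] by simp_all
  qed simp_all
  have ke: "ker k e"
  proof (rule kerI[OF kerD(1)[OF k]])
    fix x assume [simp]: "valid x" "cod x = cod k" and x: "e \<odot> x = zero (dom x) (cod e)"
    have [simp]: "dom x \<in> Obj C" by (simp add: valid_in_Obj)
    have "f \<odot> x = zero (dom x) (cod f)" using comp_reassoc[OF f, of x] x by simp
    then show "\<exists>t. \<guillemotleft>t : dom x \<rightarrow> dom k\<guillemotright> \<and> k \<odot> t = x" by (intro ker_ex[OF k]) auto
  qed (simp_all add: z)
  obtain k' where k': "ker k' e" "coker e k'" using epi_exact[OF e] .
  have k'_simps: "valid k'" "cod k' = cod k" "e \<odot> k' = zero (dom k') (cod e)"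
    using kerD(2,4,5)[OF k'(1)] by simp_all
  obtain t where t: "valid t" "dom t = dom k'" "cod t = dom k" "k \<odot> t = k'"
    using ker_lift[OF ke, of k'] k'_simps by auto
  have "coker e k"
    unfolding coker_def
  proof (intro conjI allI impI)
    fix x assume x: "valid x" "dom x = cod k" "x \<odot> k = zero (dom k) (cod x)"
    have [simp]: "cod x \<in> Obj C" using x by (simp add: valid_in_Obj)
    have "x \<odot> k' = (x \<odot> k) \<odot> t" by (simp add: t(4))
    also have "\<dots> = zero (dom k') (cod x)" unfolding x(3) using t by simp
    finally show "\<exists>u. \<guillemotleft>u : cod e \<rightarrow> cod x\<guillemotright> \<and> u \<odot> e = x"
      using x k'_simps by (intro coker_ex[OF k'(2)]) simp_all
  qed (simp_all add: e z)
  then have Fk: "ker (F k) (F e)" using F ke unfolding exact_functor_def by blast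
  have Ff: "F f = F m \<odot> F e"
    using F f unfolding exact_functor_def by (metis \<open>valid e\<close> \<open>valid m\<close> \<open>cod e = dom m\<close>)
  note mF = exact_functor_mono[OF m]
  have [simp]: "Fo (dom m) \<in> Obj C" "Fo (cod f) \<in> Obj C" "Fo (dom k) \<in> Obj C"
    using valid_in_Obj[of "F m"] valid_in_Obj(1)[of "F k"] by auto
  show ?thesis
    unfolding Ff
  proof (rule kerI[OF kerD(1)[OF Fk]])
    show "(F m \<odot> F e) \<odot> F k = zero (dom (F k)) (cod (F m \<odot> F e))"
      using kerD(5)[OF Fk] by simp
    fix x assume [simp]: "valid x" "cod x = cod (F k)" and x: "(F m \<odot> F e) \<odot> x = zero (dom x) (cod (F m \<odot> F e))"
    have [simp]: "dom x \<in> Obj C" by (simp add: valid_in_Obj)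
    have "F e \<odot> x = zero (dom x) (cod (F e))"
      by (rule monoD[OF mF]) (use x in simp_all)
    then show "\<exists>t. \<guillemotleft>t : dom x \<rightarrow> dom (F k)\<guillemotright> \<and> F k \<odot> t = x" by (intro ker_ex[OF Fk]) auto
  qed simp_all
qed

lemma exact_functor_iseq: assumes q: "iseq e f g" shows "iseq (F e) (F f) (F g)"
proof -
  note [simp] = iseqD(2-7)[OF q]
  obtain d where [simp]: "valid d" "dom d = cod e" "cod d = cod g" and d: "add d g = f"
    using ex_difference[of f g] by auto
  have "ker e d" using q by (subst (asm) iseq_iff_ker[OF d]) simp_all
  then have "ker (F e) (F d)" by (rule exact_functor_ker)
  moreover have "add (F d) (F g) = F f"
    using F d unfolding exact_functor_def by (metis \<open>valid d\<close> \<open>valid g\<close> \<open>dom d = cod e\<close> \<open>dom g = cod e\<close> \<open>cod d = cod g\<close>)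
  ultimately show ?thesis by (subst iseq_iff_ker) simp_all
qed

end

end

section \<open>Images and kernels of Hopf monoid morphisms\<close>

context abelian_symmetric_monoidal_category
begin

section \<open>Exactness of tensoring\<close>

lemma exact_functor_left: assumes X: "X \<in> Obj M" shows "exact_functor (\<lambda>A. X \<otimes>\<^sub>o A) (\<lambda>f. ide X \<boxtimes> f)"
  unfolding exact_functor_def
proof (intro conjI allI impI)
  note [simp] = X
  have raw: "raw (ide X \<boxtimes> f) = Id M X \<otimes>\<^sub>m raw f" if "valid f" for f
    using that by (simp add: raw_tens raw_structure)
  fix f g assume v [simp]: "valid f" "valid g"
  { assume [simp]: "cod f = dom g"
    show "ide X \<boxtimes> (g \<odot> f) = (ide X \<boxtimes> g) \<odot> (ide X \<boxtimes> f)" by simp }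
  { assume [simp]: "dom f = dom g" "cod f = cod g"
    have "Id M X \<otimes>\<^sub>m Add M (dom g) (cod g) (raw f) (raw g)
       = Add M (X \<otimes>\<^sub>o dom g) (X \<otimes>\<^sub>o cod g) (Id M X \<otimes>\<^sub>m raw f) (Id M X \<otimes>\<^sub>m raw g)"
      using tensor_left_additive[OF X] valid_in_Obj[of g] in_hom_raw[of f] in_hom_raw[of g]
      by (simp add: additive_endofunctor_def)
    then show "ide X \<boxtimes> add f g = add (ide X \<boxtimes> f) (ide X \<boxtimes> g)"
      by (subst arrow_eq_iff) (simp_all add: raw, simp add: add_def raw_tens raw_structure) }
next
  fix k c assume k: "ker k c" and c: "coker c k"
  note [simp] = X kerD(2-4)[OF k]
  have o: "dom k \<in> Obj M" "cod k \<in> Obj M" "cod c \<in> Obj M" by (simp_all add: valid_in_Obj)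
  have Arr: "Arr (X \<otimes>\<^sub>o dom f) (X \<otimes>\<^sub>o cod f) (Id M X \<otimes>\<^sub>m raw f) = ide X \<boxtimes> f" if "valid f" for f
    using that by (simp add: tens_def raw_structure)
  have "short_exact M (dom k) (cod k) (cod c) (raw k) (raw c)"
    unfolding short_exact_def kernel_iff[OF o(2,3)] cokernel_iff[OF o(1,2)] using k c by (simp add: valid_Arr_raw)
  then have "short_exact M (X \<otimes>\<^sub>o dom k) (X \<otimes>\<^sub>o cod k) (X \<otimes>\<^sub>o cod c) (Id M X \<otimes>\<^sub>m raw k) (Id M X \<otimes>\<^sub>m raw c)"
    using tensor_left_exact[OF X] o in_hom_raw[of k] in_hom_raw[of c] unfolding exact_endofunctor_def by simp
  then show "ker (ide X \<boxtimes> k) (ide X \<boxtimes> c)" "coker (ide X \<boxtimes> c) (ide X \<boxtimes> k)"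
    using o Arr[of k] Arr[of c] by (simp_all add: short_exact_def kernel_iff cokernel_iff)
qed (use X in simp_all)

lemma exact_functor_right: assumes X: "X \<in> Obj M" shows "exact_functor (\<lambda>A. A \<otimes>\<^sub>o X) (\<lambda>f. f \<boxtimes> ide X)"
  unfolding exact_functor_def
proof (intro conjI allI impI)
  note [simp] = X
  have raw: "raw (f \<boxtimes> ide X) = raw f \<otimes>\<^sub>m Id M X" if "valid f" for f
    using that by (simp add: raw_tens raw_structure)
  fix f g assume v [simp]: "valid f" "valid g"
  { assume [simp]: "cod f = dom g"
    show "(g \<odot> f) \<boxtimes> ide X = (g \<boxtimes> ide X) \<odot> (f \<boxtimes> ide X)" by simp }
  { assume [simp]: "dom f = dom g" "cod f = cod g"
    have "Add M (dom g) (cod g) (raw f) (raw g) \<otimes>\<^sub>m Id M X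
       = Add M (dom g \<otimes>\<^sub>o X) (cod g \<otimes>\<^sub>o X) (raw f \<otimes>\<^sub>m Id M X) (raw g \<otimes>\<^sub>m Id M X)"
      using tensor_right_additive[OF X] valid_in_Obj[of g] in_hom_raw[of f] in_hom_raw[of g]
      by (simp add: additive_endofunctor_def)
    then show "add f g \<boxtimes> ide X = add (f \<boxtimes> ide X) (g \<boxtimes> ide X)"
      by (subst arrow_eq_iff) (simp_all add: raw, simp add: add_def raw_tens raw_structure) }
next
  fix k c assume k: "ker k c" and c: "coker c k"
  note [simp] = X kerD(2-4)[OF k]
  have o: "dom k \<in> Obj M" "cod k \<in> Obj M" "cod c \<in> Obj M" by (simp_all add: valid_in_Obj)
  have Arr: "Arr (dom f \<otimes>\<^sub>o X) (cod f \<otimes>\<^sub>o X) (raw f \<otimes>\<^sub>m Id M X) = f \<boxtimes> ide X" if "valid f" for f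
    using that by (simp add: tens_def raw_structure)
  have "short_exact M (dom k) (cod k) (cod c) (raw k) (raw c)"
    unfolding short_exact_def kernel_iff[OF o(2,3)] cokernel_iff[OF o(1,2)] using k c by (simp add: valid_Arr_raw)
  then have "short_exact M (dom k \<otimes>\<^sub>o X) (cod k \<otimes>\<^sub>o X) (cod c \<otimes>\<^sub>o X) (raw k \<otimes>\<^sub>m Id M X) (raw c \<otimes>\<^sub>m Id M X)"
    using tensor_right_exact[OF X] o in_hom_raw[of k] in_hom_raw[of c] unfolding exact_endofunctor_def by simp
  then show "ker (k \<boxtimes> ide X) (c \<boxtimes> ide X)" "coker (c \<boxtimes> ide X) (k \<boxtimes> ide X)"
    using o Arr[of k] Arr[of c] by (simp_all add: short_exact_def kernel_iff cokernel_iff)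
qed (use X in simp_all)

lemma add_tens_ide:
  assumes "valid f" "valid g" "dom f = dom g" "cod f = cod g" "X \<in> Obj M"
  shows "add f g \<boxtimes> ide X = add (f \<boxtimes> ide X) (g \<boxtimes> ide X)"
  using exact_functor_right[of X] assms unfolding exact_functor_def by blast

lemma zero_tens_ide:
  assumes [simp]: "A \<in> Obj M" "B \<in> Obj M" "X \<in> Obj M"
  shows "zero A B \<boxtimes> ide X = zero (A \<otimes>\<^sub>o X) (B \<otimes>\<^sub>o X)"
  using add_tens_ide[of "zero A B" "zero A B" X] add_idem[of "zero A B \<boxtimes> ide X"] by simp

lemma mono_tens: assumes f: "mono f" and g: "mono g" shows "mono (f \<boxtimes> g)"
proof -
  have [simp]: "valid f" "valid g" using f g by (simp_all add: mono_valid)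
  have o [simp]: "dom f \<in> Obj M" "cod g \<in> Obj M" by (simp_all add: valid_in_Obj)
  have "mono ((f \<boxtimes> ide (cod g)) \<odot> (ide (dom f) \<boxtimes> g))"
    using exact_functor_mono[OF exact_functor_right[OF o(2)] f] exact_functor_mono[OF exact_functor_left[OF o(1)] g]
    by (rule mono_comp) simp
  then show ?thesis by simp
qed

lemma epi_tens: assumes f: "epi f" and g: "epi g" shows "epi (f \<boxtimes> g)"
proof -
  have [simp]: "valid f" "valid g" using f g by (simp_all add: epi_valid)
  have o [simp]: "dom f \<in> Obj M" "cod g \<in> Obj M" by (simp_all add: valid_in_Obj)
  have "epi ((f \<boxtimes> ide (cod g)) \<odot> (ide (dom f) \<boxtimes> g))"
    using exact_functor_epi[OF exact_functor_right[OF o(2)] f] exact_functor_epi[OF exact_functor_left[OF o(1)] g]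
    by (rule epi_comp) simp
  then show ?thesis by simp
qed

lemma mono_ide [simp]: "A \<in> Obj M \<Longrightarrow> mono (ide A)" and epi_ide [simp]: "A \<in> Obj M \<Longrightarrow> epi (ide A)"
  by (simp_all add: iso_imp_mono iso_imp_epi)

text \<open>Tensor powers of the monomorphism i are monic because tensoring is exact. Each comonoid
  law for \<open>T\<close> can therefore be tested after composing with such a power, where it is
  the law in \<open>B\<close>.\<close>

lemma coc_sub:
  assumes [simp]: "coc B" and i: "mono i" "cod i = ob B" and d [simp]: "\<guillemotleft>d : dom i \<rightarrow> dom i \<otimes>\<^sub>o dom i\<guillemotright>"
    and di: "(i \<boxtimes> i) \<odot> d = \<Delta> B \<odot> i"
    and T: "ob T = dom i" "\<Delta> T = d" "\<epsilon> T = \<epsilon> B \<odot> i"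
  shows "coc T" "cmap T B i"
proof -
  have [simp]: "valid i" using i by (simp add: mono_valid)
  have [simp]: "dom i \<in> Obj M" by (simp add: valid_in_Obj)
  note [simp] = i T
  have dx: "((f \<odot> i) \<boxtimes> (g \<odot> i)) \<odot> d = (f \<boxtimes> g) \<odot> \<Delta> B \<odot> i"
    if "valid f" "valid g" "dom f = ob B" "dom g = ob B" for f g
    using that tens_comp[of i i f g, THEN comp_reassoc, of d] by (simp add: di)
  show "coc T"
  proof (rule cocI)
    have "(i \<boxtimes> (i \<boxtimes> i)) \<odot> \<alpha> (dom i) (dom i) (dom i) \<odot> (d \<boxtimes> ide (dom i)) \<odot> d
       = \<alpha> (ob B) (ob B) (ob B) \<odot> ((i \<boxtimes> i) \<boxtimes> i) \<odot> (d \<boxtimes> ide (dom i)) \<odot> d"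
      by (simp add: \<alpha>_natural[THEN comp_reassoc] del: interchange)
    also have "\<dots> = \<alpha> (ob B) (ob B) (ob B) \<odot> (\<Delta> B \<boxtimes> ide (ob B)) \<odot> \<Delta> B \<odot> i"
      using dx[of "\<Delta> B" "ide (ob B)"] by (simp add: di)
    also have "\<dots> = (ide (ob B) \<boxtimes> \<Delta> B) \<odot> \<Delta> B \<odot> i"
      using comp_reassoc3[OF cocD(4)[of B], of i] by simp
    also have "\<dots> = (i \<boxtimes> (i \<boxtimes> i)) \<odot> (ide (dom i) \<boxtimes> d) \<odot> d"
      using dx[of "ide (ob B)" "\<Delta> B"] by (simp add: di)
    finally show "\<alpha> (ob T) (ob T) (ob T) \<odot> (\<Delta> T \<boxtimes> ide (ob T)) \<odot> \<Delta> T = (ide (ob T) \<boxtimes> \<Delta> T) \<odot> \<Delta> T"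
      using mono_tens[OF i(1) mono_tens[OF i(1) i(1)]] by (elim monoD) simp_all
    have "i \<odot> lu (dom i) \<odot> (\<epsilon> T \<boxtimes> ide (dom i)) \<odot> d = lu (ob B) \<odot> (ide \<one>\<^sub>o \<boxtimes> i) \<odot> (\<epsilon> T \<boxtimes> ide (dom i)) \<odot> d"
      by (simp add: lu_natural[THEN comp_reassoc] del: interchange)
    also have "\<dots> = lu (ob B) \<odot> (\<epsilon> B \<boxtimes> ide (ob B)) \<odot> \<Delta> B \<odot> i"
      using dx[of "\<epsilon> B" "ide (ob B)"] by simp
    also have "\<dots> = i \<odot> ide (dom i)"
      using comp_reassoc3[OF cocD(5)[of B], of i] by simp
    finally show "lu (ob T) \<odot> (\<epsilon> T \<boxtimes> ide (ob T)) \<odot> \<Delta> T = ide (ob T)"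
      using i(1) by (elim monoD) simp_all
    have "(i \<boxtimes> i) \<odot> br (dom i) (dom i) \<odot> d = br (ob B) (ob B) \<odot> (i \<boxtimes> i) \<odot> d"
      using br_natural[of i i, THEN comp_reassoc, of "ob B" "ob B" d] by simp
    also have "\<dots> = (i \<boxtimes> i) \<odot> d"
      using comp_reassoc[OF cocD(7)[of B], of i] by (simp add: di)
    finally show "br (ob T) (ob T) \<odot> \<Delta> T = \<Delta> T"
      using mono_tens[OF i(1) i(1)] by (elim monoD) simp_all
  qed simp_all
  show "cmap T B i" by (simp add: cmap_def di)
qed

lemma cmap_cancel_mono:
  assumes i: "mono i" "cmap K B i" and x: "cmap T B (i \<odot> x)" and [simp]: "coc K" "coc B" "coc T"
  shows "cmap T K x"
proof -
  have v [simp]: "valid x" "cod x = ob K" "valid i" "dom i = ob K" "dom x = ob T" "cod i = ob B"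
    using cmapD[OF x] cmapD[OF i(2)] by auto
  have iK: "\<Delta> B \<odot> i = (i \<boxtimes> i) \<odot> \<Delta> K" "\<epsilon> B \<odot> i = \<epsilon> K" using i(2) by (simp_all add: cmap_def)
  have "(i \<boxtimes> i) \<odot> \<Delta> K \<odot> x = (i \<boxtimes> i) \<odot> (x \<boxtimes> x) \<odot> \<Delta> T"
    using x comp_reassoc[OF iK(1), of x] by (simp add: cmap_def)
  then have "\<Delta> K \<odot> x = (x \<boxtimes> x) \<odot> \<Delta> T"
    using mono_tens[OF i(1) i(1)] by (elim monoD) simp_all
  moreover have "\<epsilon> K \<odot> x = \<epsilon> T" using x comp_reassoc[OF iK(2), of x] by (simp add: cmap_def)
  ultimately show ?thesis by (simp add: cmap_def)
qed

text \<open>It suffices that all operations of \<open>B\<close> restrict along the monomorphism i;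
  the axioms are inherited by cancelling i or its tensor powers. This builds both images, with
  operations from diagonal fill-ins, and kernels, with operations from a universal property.\<close>

lemma ex_sub_hopf:
  assumes [simp]: "hopf B" and i: "mono i" "cod i = ob B"
    and m: "\<guillemotleft>m : dom i \<otimes>\<^sub>o dom i \<rightarrow> dom i\<guillemotright>" "i \<odot> m = mm B \<odot> (i \<boxtimes> i)"
    and u: "\<guillemotleft>u : \<one>\<^sub>o \<rightarrow> dom i\<guillemotright>" "i \<odot> u = un B"
    and d: "\<guillemotleft>d : dom i \<rightarrow> dom i \<otimes>\<^sub>o dom i\<guillemotright>" "(i \<boxtimes> i) \<odot> d = \<Delta> B \<odot> i"
    and s: "\<guillemotleft>s : dom i \<rightarrow> dom i\<guillemotright>" "i \<odot> s = an B \<odot> i"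
  obtains K :: "('o, 'm) hopf_data" where "hopf K" "ob K = dom i" "mm K = m" "un K = u" "cmap K B i" "hhom K B i"
proof -
  have [simp]: "valid i" using i by (simp add: mono_valid)
  have [simp]: "dom i \<in> Obj M" by (simp add: valid_in_Obj)
  note [simp] = i(2) m(1) u(1) d(1) s(1)
  define K :: "('o, 'm) hopf_data" where "K = \<lparr>ob = dom i, comult = raw d, counit = raw (\<epsilon> B \<odot> i),
     mmult = raw m, munit = raw u, antipode = raw s\<rparr>"
  have [simp]: "ob K = dom i" "\<Delta> K = d" "\<epsilon> K = \<epsilon> B \<odot> i" "mm K = m" "un K = u" "an K = s"
    by (simp_all add: \<Delta>_def[of K] \<epsilon>_def[of K] mm_def[of K] un_def[of K] an_def[of K], simp_all add: K_def valid_Arr_raw)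
  have c [simp]: "coc K" and ci: "cmap K B i"
    using coc_sub[OF hopfD(1) i(1,2) d, of K] by simp_all
  have m': "cmap (prod K K) K m"
    by (rule cmap_cancel_mono[OF i(1) ci])
      (simp_all add: m cmap_comp[OF cmap_tens[OF ci ci]])
  have u': "cmap unit_comon K u"
    by (rule cmap_cancel_mono[OF i(1) ci]) (simp_all add: u)
  have mx: "i \<odot> m \<odot> x = mm B \<odot> (i \<boxtimes> i) \<odot> x" for x
    using comp_reassoc[OF m(2), of x] by simp
  have assoc: "m \<odot> (m \<boxtimes> ide (dom i)) = m \<odot> (ide (dom i) \<boxtimes> m) \<odot> \<alpha> (dom i) (dom i) (dom i)"
  proof (rule monoD[OF i(1)])
    have "i \<odot> m \<odot> (m \<boxtimes> ide (dom i)) = (mm B \<odot> (mm B \<boxtimes> ide (ob B))) \<odot> ((i \<boxtimes> i) \<boxtimes> i)"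
      by (simp add: mx m del: hopf_assoc)
    also have "\<dots> = mm B \<odot> (ide (ob B) \<boxtimes> mm B) \<odot> (i \<boxtimes> (i \<boxtimes> i)) \<odot> \<alpha> (dom i) (dom i) (dom i)"
      unfolding hopf_assoc[OF assms(1)] by (simp add: \<alpha>_natural del: interchange)
    also have "\<dots> = i \<odot> m \<odot> (ide (dom i) \<boxtimes> m) \<odot> \<alpha> (dom i) (dom i) (dom i)"
      by (simp add: mx m)
    finally show "i \<odot> m \<odot> (m \<boxtimes> ide (dom i)) = i \<odot> m \<odot> (ide (dom i) \<boxtimes> m) \<odot> \<alpha> (dom i) (dom i) (dom i)" .
  qed simp_all
  have lu: "m \<odot> (u \<boxtimes> ide (dom i)) = lu (dom i)"
  proof (rule monoD[OF i(1)])
    have "i \<odot> m \<odot> (u \<boxtimes> ide (dom i)) = (mm B \<odot> (un B \<boxtimes> ide (ob B))) \<odot> (ide \<one>\<^sub>o \<boxtimes> i)"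
      by (simp add: mx u del: hopfD(4))
    also have "\<dots> = i \<odot> lu (dom i)" unfolding hopfD(4)[OF assms(1)] by (simp add: lu_natural)
    finally show "i \<odot> m \<odot> (u \<boxtimes> ide (dom i)) = i \<odot> lu (dom i)" .
  qed simp_all
  have ru: "m \<odot> (ide (dom i) \<boxtimes> u) = ru (dom i)"
  proof (rule monoD[OF i(1)])
    have "i \<odot> m \<odot> (ide (dom i) \<boxtimes> u) = (mm B \<odot> (ide (ob B) \<boxtimes> un B)) \<odot> (i \<boxtimes> ide \<one>\<^sub>o)"
      by (simp add: mx u del: hopfD(5))
    also have "\<dots> = i \<odot> ru (dom i)" unfolding hopfD(5)[OF assms(1)] by (simp add: ru_natural)
    finally show "i \<odot> m \<odot> (ide (dom i) \<boxtimes> u) = i \<odot> ru (dom i)" .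
  qed simp_all
  have dx: "((f \<odot> i) \<boxtimes> (g \<odot> i)) \<odot> d = (f \<boxtimes> g) \<odot> \<Delta> B \<odot> i"
    if "valid f" "valid g" "dom f = ob B" "dom g = ob B" for f g
    using that tens_comp[of i i f g, THEN comp_reassoc, of d] by (simp add: d)
  have s1: "m \<odot> (s \<boxtimes> ide (dom i)) \<odot> d = u \<odot> \<epsilon> K"
  proof (rule monoD[OF i(1)])
    have "i \<odot> m \<odot> (s \<boxtimes> ide (dom i)) \<odot> d = mm B \<odot> (an B \<boxtimes> ide (ob B)) \<odot> \<Delta> B \<odot> i"
      using dx[of "an B" "ide (ob B)"] by (simp add: mx s)
    also have "\<dots> = i \<odot> u \<odot> \<epsilon> K"
      using comp_reassoc3[OF hopfD(7)[OF assms(1)], of i] comp_reassoc[OF u(2), of "\<epsilon> K"] by simp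
    finally show "i \<odot> m \<odot> (s \<boxtimes> ide (dom i)) \<odot> d = i \<odot> u \<odot> \<epsilon> K" .
  qed simp_all
  have s2: "m \<odot> (ide (dom i) \<boxtimes> s) \<odot> d = u \<odot> \<epsilon> K"
  proof (rule monoD[OF i(1)])
    have "i \<odot> m \<odot> (ide (dom i) \<boxtimes> s) \<odot> d = mm B \<odot> (ide (ob B) \<boxtimes> an B) \<odot> \<Delta> B \<odot> i"
      using dx[of "ide (ob B)" "an B"] by (simp add: mx s)
    also have "\<dots> = i \<odot> u \<odot> \<epsilon> K"
      using comp_reassoc3[OF hopfD(8)[OF assms(1)], of i] comp_reassoc[OF u(2), of "\<epsilon> K"] by simp
    finally show "i \<odot> m \<odot> (ide (dom i) \<boxtimes> s) \<odot> d = i \<odot> u \<odot> \<epsilon> K" .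
  qed simp_all
  have "hopf K"
    unfolding hopf_iff using m' u' assoc lu ru s1 s2 by simp
  moreover have "hhom K B i"
    unfolding hhom_def using ci m u by simp
  ultimately show ?thesis using ci by (intro that[of K]) simp_all
qed

text \<open>In the factorization f = i e in \<open>M\<close>, exactness makes e \<otimes> e epic and
  i \<otimes> i monic. Multiplication, comultiplication and antipode of the image arise as diagonals
  between these, and its unit is that of \<open>A\<close> followed by e.\<close>

lemma hopf_image:
  assumes f: "hhom A B f" and [simp]: "hopf A" "hopf B"
  obtains I :: "('o, 'm) hopf_data" and e i where "hopf I" "hhom A I e" "hhom I B i" "epi e" "mono i" "i \<odot> e = f"
proof -
  note f_simps [simp] = hhomD[OF f]
  obtain e i where e: "epi e" and i: "mono i" and [simp]: "cod e = dom i" and ie: "i \<odot> e = f"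
    using epi_mono_factorization[of f] by auto
  have [simp]: "valid e" "valid i" using e i by (simp_all add: epi_valid mono_valid)
  have "dom (i \<odot> e) = ob A" "cod (i \<odot> e) = ob B" unfolding ie by simp_all
  then have [simp]: "dom e = ob A" "cod i = ob B" by simp_all
  have [simp]: "dom i \<in> Obj M" by (simp add: valid_in_Obj)
  have iex: "i \<odot> e \<odot> x = f \<odot> x" for x using comp_reassoc[OF ie, of x] .
  have ee: "epi (e \<boxtimes> e)" and ii: "mono (i \<boxtimes> i)" using e i by (simp_all add: epi_tens mono_tens)
  obtain m where m: "valid m" "dom m = dom i \<otimes>\<^sub>o dom i" "cod m = dom i" "m \<odot> (e \<boxtimes> e) = e \<odot> mm A"
      "i \<odot> m = mm B \<odot> (i \<boxtimes> i)"
    using fill_in[OF ee i, of "e \<odot> mm A" "mm B \<odot> (i \<boxtimes> i)"] by (auto simp: iex ie)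
  obtain d where d: "valid d" "dom d = dom i" "cod d = dom i \<otimes>\<^sub>o dom i" "d \<odot> e = (e \<boxtimes> e) \<odot> \<Delta> A"
      "(i \<boxtimes> i) \<odot> d = \<Delta> B \<odot> i"
    using fill_in[OF e ii, of "(e \<boxtimes> e) \<odot> \<Delta> A" "\<Delta> B \<odot> i"] hhom_cmap[OF f] by (auto simp: ie cmap_def)
  obtain s where s: "valid s" "dom s = dom i" "cod s = dom i" "s \<odot> e = e \<odot> an A" "i \<odot> s = an B \<odot> i"
    using fill_in[OF e i, of "e \<odot> an A" "an B \<odot> i"] by (auto simp: iex ie hhom_antipode[OF f])
  have u: "valid (e \<odot> un A)" "i \<odot> e \<odot> un A = un B" by (simp_all add: iex)
  obtain I :: "('o, 'm) hopf_data" where [simp]: "hopf I" "ob I = dom i" "mm I = m" "un I = e \<odot> un A"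
      and ci: "cmap I B i" and hi: "hhom I B i"
    using ex_sub_hopf[OF assms(3) i, of m "e \<odot> un A" d s] m d s u by auto
  have "cmap A I e"
    by (rule cmap_cancel_mono[OF i ci]) (simp_all add: ie hhom_cmap[OF f])
  then have "hhom A I e" by (simp add: hhom_def m)
  then show ?thesis using e i ie hi by (intro that) simp_all
qed

text \<open>The equalized arrows are <1, f> and <1, g> because, by coassociativity, an element
  satisfying this equation has a comultiplication whose second leg satisfies it too. Exactness of
  tensoring then lets \<Delta> factor through the equalizer leg by leg, and cocommutativity handles
  the other leg.\<close>

lemma comonoid_equalizer:
  assumes f: "cmap T U f" and g: "cmap T U g" and [simp]: "coc T" "coc U"
  obtains e d where "mono e" "cod e = ob T" "\<guillemotleft>d : dom e \<rightarrow> dom e \<otimes>\<^sub>o dom e\<guillemotright>" "(e \<boxtimes> e) \<odot> d = \<Delta> T \<odot> e"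
    "f \<odot> e = g \<odot> e" "iseq e (pair T (ide (ob T)) f) (pair T (ide (ob T)) g)"
proof -
  let ?t = "ob T" and ?u = "ob U"
  note [simp] = cmapD[OF f] cmapD[OF g]
  let ?f = "pair T (ide ?t) f" and ?g = "pair T (ide ?t) g"
  obtain e where e: "iseq e ?f ?g" and [simp]: "cod e = ?t"
    using ex_equalizer[of ?f ?g] by auto
  have m: "mono e" and [simp]: "valid e" and fge: "?f \<odot> e = ?g \<odot> e" by (rule iseqD[OF e])+
  have o [simp]: "dom e \<in> Obj M" by (simp add: valid_in_Obj)
  have pair_ide: "\<Delta> T = pair T (ide ?t) (ide ?t)" by (simp add: pair_def)
  \<comment> \<open>Coassociativity: <1, <1, h>> is \<open>\<Delta> T \<boxtimes> ide\<close>
    applied to <1, h>, so agreement of <1, f> and <1, g> on \<open>e\<close> propagates to the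
    triples.\<close>
  have *: "pair T (ide ?t) (pair T (ide ?t) h) \<odot> e = \<alpha> ?t ?t ?u \<odot> (\<Delta> T \<boxtimes> ide ?u) \<odot> pair T (ide ?t) h \<odot> e"
    if [simp]: "valid h" "dom h = ?t" "cod h = ?u" for h
    using \<alpha>_pair[of T "ide ?t" "ide ?t" h ?t ?t ?u, THEN comp_reassoc, of e]
    by (simp add: pair_ide)
  have H: "pair T (ide ?t) ?f \<odot> e = pair T (ide ?t) ?g \<odot> e"
    by (simp add: * fge)
  have "(ide ?t \<boxtimes> ?f) \<odot> \<Delta> T \<odot> e = (ide ?t \<boxtimes> ?g) \<odot> \<Delta> T \<odot> e"
    using H by (simp add: pair_ide)
  then obtain x where [simp]: "valid x" "dom x = dom e" "cod x = ?t \<otimes>\<^sub>o dom e" and x: "(ide ?t \<boxtimes> e) \<odot> x = \<Delta> T \<odot> e"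
    using iseq_lift[OF exact_functor_iseq[OF exact_functor_left e], of ?t "\<Delta> T \<odot> e"] by auto
  have mt: "mono (ide (?t \<otimes>\<^sub>o ?u) \<boxtimes> e)" using m by (simp add: mono_tens)
  \<comment> \<open>Cocommutativity brings the condition on the first leg back to the one on the
    second leg, which is \<open>H\<close>.\<close>
  have r: "(ide (?t \<otimes>\<^sub>o ?u) \<boxtimes> e) \<odot> (pair T (ide ?t) h \<boxtimes> ide (dom e)) \<odot> x = br ?t (?t \<otimes>\<^sub>o ?u) \<odot> pair T (ide ?t) (pair T (ide ?t) h) \<odot> e"
    if [simp]: "valid h" "dom h = ?t" "cod h = ?u" for h
  proof -
    have "(ide (?t \<otimes>\<^sub>o ?u) \<boxtimes> e) \<odot> (pair T (ide ?t) h \<boxtimes> ide (dom e)) \<odot> x = (pair T (ide ?t) h \<boxtimes> ide ?t) \<odot> (ide ?t \<boxtimes> e) \<odot> x"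
      by simp
    also have "\<dots> = pair T (pair T (ide ?t) h) (ide ?t) \<odot> e"
      unfolding x by (simp add: pair_ide)
    also have "\<dots> = br ?t (?t \<otimes>\<^sub>o ?u) \<odot> pair T (ide ?t) (pair T (ide ?t) h) \<odot> e"
      using br_pair[of T "ide ?t" "pair T (ide ?t) h" ?t "?t \<otimes>\<^sub>o ?u", THEN comp_reassoc, of e] by simp
    finally show ?thesis .
  qed
  have "(?f \<boxtimes> ide (dom e)) \<odot> x = (?g \<boxtimes> ide (dom e)) \<odot> x"
    by (rule monoD[OF mt]) (simp_all only: r cmapD[OF f] cmapD[OF g] H, simp_all)
  then obtain d where d: "valid d" "dom d = dom e" "cod d = dom e \<otimes>\<^sub>o dom e" "(e \<boxtimes> ide (dom e)) \<odot> d = x"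
    using iseq_lift[OF exact_functor_iseq[OF exact_functor_right[OF o] e], of x] by auto
  have "(e \<boxtimes> e) \<odot> d = (ide ?t \<boxtimes> e) \<odot> (e \<boxtimes> ide (dom e)) \<odot> d" using d(1-3) by simp
  also have "\<dots> = \<Delta> T \<odot> e" unfolding d(4) x ..
  finally have de: "(e \<boxtimes> e) \<odot> d = \<Delta> T \<odot> e" .
  have "f \<odot> e = p2 T U \<odot> ?f \<odot> e" "g \<odot> e = p2 T U \<odot> ?g \<odot> e"
    by (simp_all add: p2_pair[THEN comp_reassoc])
  then have "f \<odot> e = g \<odot> e" unfolding fge by simp
  then show ?thesis using m d de e by (intro that) simp_all
qed

text \<open>For a comonoid morphism x, <1, f> x = <x, f x>, so the plain condition f x = g x already
  implies the stronger equation that defines the equalizer.\<close>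

lemma comonoid_equalizer_lift:
  assumes e: "iseq e (pair T (ide (ob T)) f) (pair T (ide (ob T)) g)"
    and x: "cmap S T x" "f \<odot> x = g \<odot> x" and [simp]: "coc S" "coc T" "cmap T U f" "cmap T U g" "cod e = ob T"
  obtains t where "\<guillemotleft>t : ob S \<rightarrow> dom e\<guillemotright>" "e \<odot> t = x"
proof -
  note [simp] = cmapD[OF x(1)] cmapD[of T U f] cmapD[of T U g]
  have "pair T (ide (ob T)) f \<odot> x = pair T (ide (ob T)) g \<odot> x"
    by (simp add: pair_cmap[OF x(1)] x(2))
  then show ?thesis using iseq_lift[OF e, of x] that by auto
qed

text \<open>The kernel is the comonoid equalizer of p and the trivial morphism; its operations lift
  because both are Hopf morphisms. The universal property ranges over all cocommutative comonoids
  \<open>S\<close>, since it will be applied to the element y S(z) of a fibre product, which is only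
  a comonoid morphism.\<close>

lemma hopf_kernel:
  assumes p: "hhom A B p" and [simp]: "hopf A" "hopf B"
  obtains K :: "('o, 'm) hopf_data" and k where "hopf K" "hhom K A k" "mono k" "p \<odot> k = un B \<odot> \<epsilon> K"
    "\<And>(S :: ('o, 'm) comon) x. \<lbrakk>coc S; cmap S A x; p \<odot> x = un B \<odot> \<epsilon> S\<rbrakk> \<Longrightarrow> \<exists>t. cmap S K t \<and> k \<odot> t = x"
proof -
  note [simp] = hhomD[OF p] hhomD(4-5)[OF p, THEN comp_reassoc]
  let ?z = "un B \<odot> \<epsilon> A"
  have z: "hhom A B ?z" by simp
  obtain k d where k: "mono k" and [simp]: "cod k = ob A" and d: "\<guillemotleft>d : dom k \<rightarrow> dom k \<otimes>\<^sub>o dom k\<guillemotright>"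
      "(k \<boxtimes> k) \<odot> d = \<Delta> A \<odot> k" and pk: "p \<odot> k = ?z \<odot> k" and q: "iseq k (pair A (ide (ob A)) p) (pair A (ide (ob A)) ?z)"
    using comonoid_equalizer[OF hhom_cmap[OF p] cmap_triv[of A B]] by auto
  have [simp]: "valid k" using k by (simp add: mono_valid)
  have [simp]: "dom k \<in> Obj M" by (simp add: valid_in_Obj)
  define E :: "('o, 'm) comon" where "E = \<lparr>ob = dom k, comult = raw d, counit = raw (\<epsilon> A \<odot> k)\<rparr>"
  have [simp]: "ob E = dom k" "\<Delta> E = d" "\<epsilon> E = \<epsilon> A \<odot> k"
    using d by (simp_all add: \<Delta>_def[of E] \<epsilon>_def[of E], simp_all add: E_def valid_Arr_raw)
  have [simp]: "coc E" and ck: "cmap E A k"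
    using coc_sub[OF hopfD(1)[OF assms(2)] k _ d, of E] by simp_all
  have lift: "\<exists>t. \<guillemotleft>t : ob S \<rightarrow> dom k\<guillemotright> \<and> k \<odot> t = x" if "coc S" "cmap S A x" "p \<odot> x = ?z \<odot> x" for S :: "('o, 'm) comon" and x
    using comonoid_equalizer_lift[OF q that(2,3) that(1), of B] hhom_cmap[OF p] by auto
  have "\<exists>m. \<guillemotleft>m : ob (prod E E) \<rightarrow> dom k\<guillemotright> \<and> k \<odot> m = mm A \<odot> (k \<boxtimes> k)"
  proof (rule lift)
    show "cmap (prod E E) A (mm A \<odot> (k \<boxtimes> k))" by (rule cmap_comp[OF cmap_tens[OF ck ck]]) simp_all
    have "p \<odot> mm A \<odot> (k \<boxtimes> k) = mm B \<odot> ((p \<odot> k) \<boxtimes> (p \<odot> k))" by simp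
    also have "\<dots> = (mm B \<odot> (?z \<boxtimes> ?z)) \<odot> (k \<boxtimes> k)" unfolding pk by simp
    also have "\<dots> = ?z \<odot> mm A \<odot> (k \<boxtimes> k)" unfolding hhomD(4)[OF z, symmetric] by simp
    finally show "p \<odot> mm A \<odot> (k \<boxtimes> k) = ?z \<odot> mm A \<odot> (k \<boxtimes> k)" .
  qed simp
  then obtain m where m: "\<guillemotleft>m : dom k \<otimes>\<^sub>o dom k \<rightarrow> dom k\<guillemotright>" "k \<odot> m = mm A \<odot> (k \<boxtimes> k)" by auto
  have "\<exists>u. \<guillemotleft>u : ob unit_comon \<rightarrow> dom k\<guillemotright> \<and> k \<odot> u = un A"
    by (rule lift) simp_all
  then obtain u where u: "\<guillemotleft>u : \<one>\<^sub>o \<rightarrow> dom k\<guillemotright>" "k \<odot> u = un A" by auto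
  have "\<exists>s. \<guillemotleft>s : ob E \<rightarrow> dom k\<guillemotright> \<and> k \<odot> s = an A \<odot> k"
  proof (rule lift)
    show "cmap E A (an A \<odot> k)" by (rule cmap_comp[OF ck]) simp
    have "p \<odot> an A \<odot> k = an B \<odot> ?z \<odot> k"
      using hhom_antipode[OF p assms(2,3), THEN comp_reassoc, of k] pk by simp
    also have "\<dots> = ?z \<odot> an A \<odot> k"
      using hhom_antipode[OF z assms(2,3), THEN comp_reassoc, of k] by simp
    finally show "p \<odot> an A \<odot> k = ?z \<odot> an A \<odot> k" .
  qed simp
  then obtain s where s: "\<guillemotleft>s : dom k \<rightarrow> dom k\<guillemotright>" "k \<odot> s = an A \<odot> k" by auto
  obtain K :: "('o, 'm) hopf_data" where K [simp]: "hopf K" "ob K = dom k" "mm K = m" "un K = u"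
      and cK: "cmap K A k" and hk: "hhom K A k"
    using ex_sub_hopf[OF assms(2) k _ m u d s] by auto
  show ?thesis
  proof (rule that[OF K(1) hk k])
    show "p \<odot> k = un B \<odot> \<epsilon> K" using pk cmapD(4)[OF cK] by simp
    fix S :: "('o, 'm) comon" and x assume S [simp]: "coc S" and x: "cmap S A x" "p \<odot> x = un B \<odot> \<epsilon> S"
    have "p \<odot> x = ?z \<odot> x" using x cmapD[OF x(1)] by simp
    then obtain t where t: "k \<odot> t = x" using lift[OF S x(1)] by blast
    then have "cmap S K t" using x by (intro cmap_cancel_mono[OF k cK]) simp_all
    then show "\<exists>t. cmap S K t \<and> k \<odot> t = x" using t by blast
  qed
qed

end

section \<open>Faithful coflatness\<close>

context abelian_symmetric_monoidal_category
begin

lemma add_zero_right: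
  assumes "valid f" "dom f = A" "cod f = B" shows "add f (zero A B) = f"
  using assms valid_in_Obj[of f] in_hom_raw[of f]
    monoid.r_one[OF group.is_monoid[OF comm_group.axioms(2)[OF Hom_comm_group]], of "dom f" "cod f" "raw f"]
  by (auto simp: add_def zero_def valid_Arr_raw)

text \<open>\<open>A\<close> acts on \<open>B\<close> through p and multiplication. This action is a
  comonoid morphism from the product of \<open>A\<close> and \<open>B\<close>, which is precisely
  linearity of \<Delta> and \<epsilon>. So p is an instance to which the faithful coflatness
  condition applies.\<close>

lemma quotient_module_comonoid:
  fixes A B :: "('o, 'm) hopf_data"
  assumes p: "hhom A B p" and [simp]: "hopf A" "hopf B"
  defines "Q \<equiv> \<lparr>ob = ob B, comult = comult B, counit = counit B, act = raw (mm B \<odot> (p \<boxtimes> ide (ob B)))\<rparr>"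
  shows "Q \<in> Obj (Comon_coc_mod M A)"
    "raw p \<in> Hom (Comon_coc_mod M A) (regular_module_comon A) Q"
proof -
  note p_simps [simp] = hhomD[OF p] hhomD(4,5)[OF p, THEN comp_reassoc]
  let ?a = "ob A" and ?b = "ob B"
  define \<mu> where "\<mu> = mm B \<odot> (p \<boxtimes> ide ?b)"
  have Q: "ob Q = ?b" "comult Q = comult B" "counit Q = counit B" "act Q = raw \<mu>"
    by (simp_all add: Q_def \<mu>_def)
  have [simp]: "valid \<mu>" "dom \<mu> = ?a \<otimes>\<^sub>o ?b" "cod \<mu> = ?b" by (simp_all add: \<mu>_def)
  have \<mu>_raw: "raw \<mu> \<in> Hom M (?a \<otimes>\<^sub>o ?b) ?b" by (rule in_hom_raw) simp
  note raws = raw_comp raw_tens raw_structure raw_comon raw_hopf raw_ms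
  have cm: "cmap (prod A B) B \<mu>"
    unfolding \<mu>_def by (rule cmap_comp[OF cmap_tens[OF hhom_cmap[OF p] cmap_ide]]) simp_all
  have coc_B: "comonoid M B" "cocommutative M B" using hopfD(1)[of B] by (simp_all add: coc_def)
  have cQ: "comonoid M Q" "cocommutative M Q"
    using coc_B by (simp_all add: comonoid_def cocommutative_def Q)
  have "\<mu> \<odot> (mm A \<boxtimes> ide ?b) = \<mu> \<odot> (ide ?a \<boxtimes> \<mu>) \<odot> \<alpha> ?a ?a ?b"
  proof -
    have "\<mu> \<odot> (mm A \<boxtimes> ide ?b) = (mm B \<odot> (mm B \<boxtimes> ide ?b)) \<odot> ((p \<boxtimes> p) \<boxtimes> ide ?b)"
      by (simp add: \<mu>_def del: hopf_assoc)
    also have "\<dots> = mm B \<odot> (ide ?b \<boxtimes> mm B) \<odot> (p \<boxtimes> (p \<boxtimes> ide ?b)) \<odot> \<alpha> ?a ?a ?b"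
      unfolding hopf_assoc[OF assms(3)] by (simp add: \<alpha>_natural del: interchange)
    also have "\<dots> = \<mu> \<odot> (ide ?a \<boxtimes> \<mu>) \<odot> \<alpha> ?a ?a ?b"
      by (simp add: \<mu>_def)
    finally show ?thesis .
  qed
  then have act1: "raw \<mu> \<cdot> (mmult A \<otimes>\<^sub>m Id M ?b) = raw \<mu> \<cdot> (Id M ?a \<otimes>\<^sub>m raw \<mu>) \<cdot> assoc M ?a ?a ?b"
    by (subst (asm) arrow_eq_iff) (simp_all add: raws)
  have "\<mu> \<odot> (un A \<boxtimes> ide ?b) = lu ?b"
    by (simp add: \<mu>_def)
  then have act2: "raw \<mu> \<cdot> (munit A \<otimes>\<^sub>m Id M ?b) = lunit M ?b"
    by (subst (asm) arrow_eq_iff) (simp_all add: raws)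
  have la: "left_action M A ?b (raw \<mu>)"
    using \<mu>_raw act1 act2 by (simp add: left_action_def)
  have "\<Delta> B \<odot> \<mu> = (\<mu> \<boxtimes> \<mu>) \<odot> \<Delta> (prod A B)"
    using cm by (simp add: cmap_def)
  then have "\<Delta> B \<odot> \<mu> = ((\<mu> \<boxtimes> \<mu>) \<odot> ms ?a ?a ?b ?b \<odot> (\<Delta> A \<boxtimes> ide (?b \<otimes>\<^sub>o ?b))) \<odot> (ide ?a \<boxtimes> \<Delta> B)"
    by (simp add: comult_prod)
  then have "raw (\<Delta> B \<odot> \<mu>) = raw (((\<mu> \<boxtimes> \<mu>) \<odot> ms ?a ?a ?b ?b \<odot> (\<Delta> A \<boxtimes> ide (?b \<otimes>\<^sub>o ?b))) \<odot> (ide ?a \<boxtimes> \<Delta> B))"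
    by (rule arg_cong)
  then have lin1: "comult B \<cdot> raw \<mu> = tensor_action M A ?b (raw \<mu>) ?b (raw \<mu>) \<cdot> (Id M ?a \<otimes>\<^sub>m comult B)"
    by (simp add: raws tensor_action_def del: comp_assoc tens_comp tens_comp_comp)
  have "\<epsilon> B \<odot> \<mu> = (\<epsilon> A \<odot> ru ?a) \<odot> (ide ?a \<boxtimes> \<epsilon> B)"
  proof -
    have "\<epsilon> B \<odot> \<mu> = lu \<one>\<^sub>o \<odot> (\<epsilon> A \<boxtimes> ide \<one>\<^sub>o) \<odot> (ide ?a \<boxtimes> \<epsilon> B)"
      using cmapD(4)[OF cm] by (simp add: counit_prod)
    also have "\<dots> = \<epsilon> A \<odot> ru ?a \<odot> (ide ?a \<boxtimes> \<epsilon> B)"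
      unfolding lu_unit using ru_natural[of "\<epsilon> A" "\<one>\<^sub>o", THEN comp_reassoc, of "ide ?a \<boxtimes> \<epsilon> B"] by simp
    finally show ?thesis by simp
  qed
  then have "raw (\<epsilon> B \<odot> \<mu>) = raw ((\<epsilon> A \<odot> ru ?a) \<odot> (ide ?a \<boxtimes> \<epsilon> B))"
    by (rule arg_cong)
  then have lin2: "counit B \<cdot> raw \<mu> = trivial_action M A \<cdot> (Id M ?a \<otimes>\<^sub>m counit B)"
    by (simp add: raws trivial_action_def del: comp_assoc tens_comp tens_comp_comp)
  have hom: "comult B \<in> Hom M ?b (?b \<otimes>\<^sub>o ?b)" "counit B \<in> Hom M ?b \<one>\<^sub>o"
    using coc_B by (simp_all add: comonoid_def)
  show "Q \<in> Obj (Comon_coc_mod M A)"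
    unfolding Comon_coc_mod_def module_comonoid_def left_linear_def
    using cQ la lin1 lin2 hom by (simp add: Q)
  have "p \<odot> mm A = \<mu> \<odot> (ide ?a \<boxtimes> p)"
    by (simp add: \<mu>_def)
  then have "raw (p \<odot> mm A) = raw (\<mu> \<odot> (ide ?a \<boxtimes> p))"
    by (rule arg_cong)
  then have lp: "raw p \<cdot> mmult A = raw \<mu> \<cdot> (Id M ?a \<otimes>\<^sub>m raw p)"
    by (simp add: raws del: hhomD(4)[OF p])
  have "comonoid_morphism M A B (raw p)"
    using hhom_cmap[OF p] by (simp add: comonoid_morphism_iff valid_Arr_raw)
  then have "comonoid_morphism M (regular_module_comon A) Q (raw p)"
    by (simp add: comonoid_morphism_def Q regular_module_comon_def)
  moreover have "raw p \<in> Hom M ?a ?b" by (rule in_hom_raw) simp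
  ultimately show "raw p \<in> Hom (Comon_coc_mod M A) (regular_module_comon A) Q"
    unfolding Comon_coc_mod_def left_linear_def using lp by (simp add: Q regular_module_comon_def)
qed

section \<open>Comodules and cotensor products in terms of typed arrows\<close>

definition coaction :: "('o, 'm, 'y) comon_scheme \<Rightarrow> ('o, 'm) arrow \<Rightarrow> bool" where
  "coaction Q r \<longleftrightarrow> valid r \<and> cod r = dom r \<otimes>\<^sub>o ob Q \<and>
     \<alpha> (dom r) (ob Q) (ob Q) \<odot> (r \<boxtimes> ide (ob Q)) \<odot> r = (ide (dom r) \<boxtimes> \<Delta> Q) \<odot> r \<and>
     ru (dom r) \<odot> (ide (dom r) \<boxtimes> \<epsilon> Q) \<odot> r = ide (dom r)"

lemma right_comoduleI:
  assumes r: "coaction Q r" and [simp]: "coc Q"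
  shows "right_comodule M Q \<lparr>cob = dom r, coact = raw r\<rparr>"
proof -
  have [simp]: "valid r" "cod r = dom r \<otimes>\<^sub>o ob Q" using r by (simp_all add: coaction_def)
  have [simp]: "dom r \<in> Obj M" by (simp add: valid_in_Obj)
  note raws = raw_comp raw_tens raw_structure raw_comon
  have "\<alpha> (dom r) (ob Q) (ob Q) \<odot> (r \<boxtimes> ide (ob Q)) \<odot> r = (ide (dom r) \<boxtimes> \<Delta> Q) \<odot> r"
    "ru (dom r) \<odot> (ide (dom r) \<boxtimes> \<epsilon> Q) \<odot> r = ide (dom r)"
    using r by (simp_all add: coaction_def)
  note this[THEN arg_cong[where f = raw]]
  then have "assoc M (dom r) (ob Q) (ob Q) \<cdot> (raw r \<otimes>\<^sub>m Id M (ob Q)) \<cdot> raw r = (Id M (dom r) \<otimes>\<^sub>m comult Q) \<cdot> raw r"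
    "runit M (dom r) \<cdot> (Id M (dom r) \<otimes>\<^sub>m counit Q) \<cdot> raw r = Id M (dom r)"
    by (simp_all add: raws)
  then show ?thesis
    by (simp add: right_comodule_def in_hom_raw)
qed

text \<open>The cofree comodule on an object \<open>X\<close>; it serves as test object when an
  epimorphism of comodules is compared with one in \<open>M\<close>.\<close>

lemma cofree_coaction:
  assumes [simp]: "coc Q" "X \<in> Obj M"
  shows "coaction Q (\<alpha>' X (ob Q) (ob Q) \<odot> (ide X \<boxtimes> \<Delta> Q))" (is "coaction Q ?r")
proof -
  let ?q = "ob Q"
  have "\<alpha> (X \<otimes>\<^sub>o ?q) ?q ?q \<odot> (?r \<boxtimes> ide ?q) \<odot> ?r
     = \<alpha> (X \<otimes>\<^sub>o ?q) ?q ?q \<odot> (\<alpha>' X ?q ?q \<boxtimes> ide ?q) \<odot> (((ide X \<boxtimes> \<Delta> Q) \<boxtimes> ide ?q) \<odot> \<alpha>' X ?q ?q) \<odot> (ide X \<boxtimes> \<Delta> Q)"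
    by simp
  also have "\<dots> = (\<alpha> (X \<otimes>\<^sub>o ?q) ?q ?q \<odot> (\<alpha>' X ?q ?q \<boxtimes> ide ?q) \<odot> \<alpha>' X (?q \<otimes>\<^sub>o ?q) ?q) \<odot> (ide X \<boxtimes> (\<Delta> Q \<boxtimes> ide ?q)) \<odot> (ide X \<boxtimes> \<Delta> Q)"
    using \<alpha>'_natural[of "ide X" "\<Delta> Q" "ide ?q" X "?q \<otimes>\<^sub>o ?q" ?q, THEN comp_reassoc, of "ide X \<boxtimes> \<Delta> Q"]
    by (simp del: interchange)
  also have "\<dots> = \<alpha>' X ?q (?q \<otimes>\<^sub>o ?q) \<odot> (ide X \<boxtimes> (ide ?q \<boxtimes> \<Delta> Q)) \<odot> (ide X \<boxtimes> \<Delta> Q)"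
    unfolding pentagon_inverse[OF assms(2) cocD(1)[OF assms(1)] cocD(1)[OF assms(1)] cocD(1)[OF assms(1)]] by simp
  also have "\<dots> = (ide (X \<otimes>\<^sub>o ?q) \<boxtimes> \<Delta> Q) \<odot> ?r"
    using \<alpha>'_natural[of "ide X" "ide ?q" "\<Delta> Q" X ?q "?q \<otimes>\<^sub>o ?q", THEN comp_reassoc, of "ide X \<boxtimes> \<Delta> Q"]
    by simp
  finally have 1: "\<alpha> (X \<otimes>\<^sub>o ?q) ?q ?q \<odot> (?r \<boxtimes> ide ?q) \<odot> ?r = (ide (X \<otimes>\<^sub>o ?q) \<boxtimes> \<Delta> Q) \<odot> ?r" .
  have "ru (X \<otimes>\<^sub>o ?q) \<odot> (ide (X \<otimes>\<^sub>o ?q) \<boxtimes> \<epsilon> Q) \<odot> ?r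
     = (ru (X \<otimes>\<^sub>o ?q) \<odot> \<alpha>' X ?q \<one>\<^sub>o) \<odot> (ide X \<boxtimes> (ide ?q \<boxtimes> \<epsilon> Q)) \<odot> (ide X \<boxtimes> \<Delta> Q)"
    using \<alpha>'_natural[of "ide X" "ide ?q" "\<epsilon> Q" X ?q "\<one>\<^sub>o", THEN comp_reassoc, of "ide X \<boxtimes> \<Delta> Q"]
    by simp
  also have "ru (X \<otimes>\<^sub>o ?q) \<odot> \<alpha>' X ?q \<one>\<^sub>o = ide X \<boxtimes> ru ?q"
    by (simp flip: ru_tensor)
  finally have 2: "ru (X \<otimes>\<^sub>o ?q) \<odot> (ide (X \<otimes>\<^sub>o ?q) \<boxtimes> \<epsilon> Q) \<odot> ?r = ide (X \<otimes>\<^sub>o ?q)"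
    by simp
  show ?thesis unfolding coaction_def using 1 2 by simp
qed

text \<open>The forgetful functor from comodules preserves epimorphisms, as it has the cofree comodule
  functor as a right adjoint.\<close>

lemma comodule_epi:
  assumes e: "epic (right_comodules M Q) \<lparr>cob = dom r, coact = raw r\<rparr> \<lparr>cob = dom r', coact = raw r'\<rparr> (raw d)"
    and r: "coaction Q r" "coaction Q r'" and [simp]: "coc Q"
    and d [simp]: "valid d" "dom d = dom r" "cod d = dom r'" and rd: "r' \<odot> d = (d \<boxtimes> ide (ob Q)) \<odot> r"
  shows "epi d"
proof (rule epiI)
  let ?q = "ob Q"
  have v [simp]: "valid r" "valid r'" "cod r = dom r \<otimes>\<^sub>o ?q" "cod r' = dom r' \<otimes>\<^sub>o ?q"
    using r by (simp_all add: coaction_def)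
  have [simp]: "dom r \<in> Obj M" "dom r' \<in> Obj M" by (simp_all add: valid_in_Obj)
  have co: "\<alpha> (dom r') ?q ?q \<odot> (r' \<boxtimes> ide ?q) \<odot> r' = (ide (dom r') \<boxtimes> \<Delta> Q) \<odot> r'"
    "ru (dom r') \<odot> (ide (dom r') \<boxtimes> \<epsilon> Q) \<odot> r' = ide (dom r')"
    using r by (simp_all add: coaction_def)
  fix x y assume [simp]: "valid x" "valid y" "dom x = cod d" "dom y = cod d" and xy: "x \<odot> d = y \<odot> d"
  have "cod (x \<odot> d) = cod (y \<odot> d)" unfolding xy ..
  then have [simp]: "cod y = cod x" by simp
  have [simp]: "cod x \<in> Obj M" by (simp add: valid_in_Obj)
  let ?c = "\<alpha>' (cod x) ?q ?q \<odot> (ide (cod x) \<boxtimes> \<Delta> Q)"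
  let ?X = "\<lparr>cob = dom ?c, coact = raw ?c\<rparr>"
  have X: "?X \<in> Obj (right_comodules M Q)"
    using right_comoduleI[OF cofree_coaction[of Q "cod x"]] by (simp add: right_comodules_def)
  \<comment> \<open>The adjunct of \<open>z\<close>: the colinear map into the cofree comodule that
    corresponds to a linear map out of the comodule given by \<open>r'\<close>.\<close>
  have hom: "raw ((z \<boxtimes> ide ?q) \<odot> r') \<in> Hom (right_comodules M Q) \<lparr>cob = dom r', coact = raw r'\<rparr> ?X"
    if [simp]: "valid z" "dom z = dom r'" "cod z = cod x" for z
  proof -
    have "?c \<odot> (z \<boxtimes> ide ?q) \<odot> r' = (\<alpha>' (cod x) ?q ?q \<odot> (z \<boxtimes> ide (?q \<otimes>\<^sub>o ?q))) \<odot> (ide (dom r') \<boxtimes> \<Delta> Q) \<odot> r'"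
      by simp
    also have "\<dots> = ((z \<boxtimes> ide ?q) \<boxtimes> ide ?q) \<odot> \<alpha>' (dom r') ?q ?q \<odot> \<alpha> (dom r') ?q ?q \<odot> (r' \<boxtimes> ide ?q) \<odot> r'"
      unfolding co(1) by (subst \<alpha>'_natural_ide) simp_all
    also have "\<dots> = (((z \<boxtimes> ide ?q) \<odot> r') \<boxtimes> ide ?q) \<odot> r'"
      by simp
    finally have "raw (?c \<odot> ((z \<boxtimes> ide ?q) \<odot> r')) = raw ((((z \<boxtimes> ide ?q) \<odot> r') \<boxtimes> ide ?q) \<odot> r')"
      by (rule arg_cong)
    then have "raw ?c \<cdot> raw ((z \<boxtimes> ide ?q) \<odot> r') = (raw ((z \<boxtimes> ide ?q) \<odot> r') \<otimes>\<^sub>m Id M ?q) \<cdot> raw r'"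
      by (subst (asm) raw_comp, simp, simp, simp, subst (asm) raw_comp, simp, simp, simp, subst (asm) raw_tens, simp, simp)
        (simp only: raw_structure)
    then show ?thesis
      using in_hom_raw[of "(z \<boxtimes> ide ?q) \<odot> r'"] by (simp add: right_comodules_def)
  qed
  \<comment> \<open>Applying the counit of \<open>Q\<close> recovers \<open>z\<close> from its
    adjunct, so distinct linear maps have distinct adjuncts.\<close>
  have counit_cancel: "ru (cod x) \<odot> (ide (cod x) \<boxtimes> \<epsilon> Q) \<odot> (z \<boxtimes> ide ?q) \<odot> r' = z"
    if [simp]: "valid z" "dom z = dom r'" "cod z = cod x" for z
  proof -
    have "ru (cod x) \<odot> (ide (cod x) \<boxtimes> \<epsilon> Q) \<odot> (z \<boxtimes> ide ?q) \<odot> r' = ru (cod x) \<odot> (z \<boxtimes> ide \<one>\<^sub>o) \<odot> (ide (dom r') \<boxtimes> \<epsilon> Q) \<odot> r'"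
      by simp
    also have "\<dots> = z \<odot> ru (dom r') \<odot> (ide (dom r') \<boxtimes> \<epsilon> Q) \<odot> r'"
      using comp_reassoc[OF ru_natural[OF that(1,3)], of "(ide (dom r') \<boxtimes> \<epsilon> Q) \<odot> r'"] by (simp del: interchange)
    also have "\<dots> = z" unfolding co(2) by simp
    finally show ?thesis .
  qed
  have "((x \<boxtimes> ide ?q) \<odot> r') \<odot> d = ((x \<odot> d) \<boxtimes> ide ?q) \<odot> r" by (simp add: rd)
  also have "\<dots> = ((y \<boxtimes> ide ?q) \<odot> r') \<odot> d" unfolding xy by (simp add: rd)
  finally have "raw (((x \<boxtimes> ide ?q) \<odot> r') \<odot> d) = raw (((y \<boxtimes> ide ?q) \<odot> r') \<odot> d)" by (rule arg_cong)
  then have "raw ((x \<boxtimes> ide ?q) \<odot> r') \<cdot> raw d = raw ((y \<boxtimes> ide ?q) \<odot> r') \<cdot> raw d"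
    by (subst (asm) raw_comp, simp, simp, simp, subst (asm) raw_comp, simp, simp, simp)
  moreover have "Comp (right_comodules M Q) = Comp M" by (simp add: right_comodules_def)
  moreover have "raw ((x \<boxtimes> ide ?q) \<odot> r') \<in> Hom (right_comodules M Q) \<lparr>cob = dom r', coact = raw r'\<rparr> ?X"
    "raw ((y \<boxtimes> ide ?q) \<odot> r') \<in> Hom (right_comodules M Q) \<lparr>cob = dom r', coact = raw r'\<rparr> ?X"
    by (rule hom; simp)+
  ultimately have "raw ((x \<boxtimes> ide ?q) \<odot> r') = raw ((y \<boxtimes> ide ?q) \<odot> r')"
    using e X unfolding epic_def by metis
  then have "(x \<boxtimes> ide ?q) \<odot> r' = (y \<boxtimes> ide ?q) \<odot> r'"
    by (subst arrow_eq_iff) simp_all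
  moreover have "ru (cod x) \<odot> (ide (cod x) \<boxtimes> \<epsilon> Q) \<odot> (x \<boxtimes> ide ?q) \<odot> r' = x"
    "ru (cod x) \<odot> (ide (cod x) \<boxtimes> \<epsilon> Q) \<odot> (y \<boxtimes> ide ?q) \<odot> r' = y"
    by (rule counit_cancel; simp)+
  ultimately show "x = y" by metis
qed (rule d)

text \<open>Equalizers exist in an abelian category, so the choice made in \<open>cotensor\<close>
  really selects one. Only this property of the chosen pair is used from here on.\<close>

lemma cotensor_equalizer:
  assumes [simp]: "valid r" "cod r = dom r \<otimes>\<^sub>o ob Q" "valid l" "cod l = ob Q \<otimes>\<^sub>o dom l" "ob Q \<in> Obj M"
  defines "V \<equiv> \<lparr>cob = dom r, coact = raw r\<rparr>" and "W \<equiv> \<lparr>cob = dom l, coact = raw l\<rparr>"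
  shows "iseq (Arr (cotensor_obj M Q W V) (dom r \<otimes>\<^sub>o dom l) (snd (cotensor M Q W V)))
     (\<alpha> (dom r) (ob Q) (dom l) \<odot> (r \<boxtimes> ide (dom l))) (ide (dom r) \<boxtimes> l)"
proof -
  have [simp]: "dom r \<in> Obj M" "dom l \<in> Obj M" by (simp_all add: valid_in_Obj)
  let ?f = "\<alpha> (dom r) (ob Q) (dom l) \<odot> (r \<boxtimes> ide (dom l))" and ?g = "ide (dom r) \<boxtimes> l"
  let ?P = "\<lambda>E e. equalizer M (dom r \<otimes>\<^sub>o dom l) (dom r \<otimes>\<^sub>o (ob Q \<otimes>\<^sub>o dom l))
      (assoc M (dom r) (ob Q) (dom l) \<cdot> (raw r \<otimes>\<^sub>m Id M (dom l))) (Id M (dom r) \<otimes>\<^sub>m raw l) E e"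
  have raw: "assoc M (dom r) (ob Q) (dom l) \<cdot> (raw r \<otimes>\<^sub>m Id M (dom l)) = raw ?f" "Id M (dom r) \<otimes>\<^sub>m raw l = raw ?g"
    by (simp_all add: raw_comp raw_tens raw_structure)
  have P: "?P E e \<longleftrightarrow> iseq (Arr E (dom r \<otimes>\<^sub>o dom l) e) ?f ?g" for E e
    unfolding raw by (subst equalizer_iff) (simp_all add: valid_Arr_raw)
  obtain e where e: "iseq e ?f ?g" "cod e = dom r \<otimes>\<^sub>o dom l"
    using ex_equalizer[of ?f ?g] by auto
  have "Arr (dom e) (dom r \<otimes>\<^sub>o dom l) (raw e) = e"
    using e(2) iseqD(2)[OF e(1)] by (simp add: valid_Arr_raw)
  then have "?P (dom e) (raw e)"
    unfolding P using e(1) by simp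
  then have "case (dom e, raw e) of (E, e) \<Rightarrow> ?P E e" by simp
  then have "case cotensor M Q W V of (E, e) \<Rightarrow> ?P E e"
    unfolding cotensor_def V_def W_def comod.simps by (rule someI)
  then show ?thesis
    unfolding P cotensor_obj_def by (simp add: case_prod_beta)
qed

text \<open>The coflatness condition freed from chosen objects: the premise on t quantifies over all
  equalizers c and c' that represent the two cotensor products with \<open>A\<close>, and t is the
  map induced by d. A reflected epimorphism is at first epic only among comodules;
  \<open>comodule_epi\<close> makes it epic in \<open>M\<close>.\<close>

lemma coflat_reflects_epi:
  fixes A B :: "('o, 'm) hopf_data"
  assumes fcc: "faithful_coflatness_condition M"
    and p: "hhom A B p" "epi p" and [simp]: "hopf A" "hopf B"
    and r: "coaction B r" and r': "coaction B r'"
    and d: "\<guillemotleft>d : dom r \<rightarrow> dom r'\<guillemotright>" "r' \<odot> d = (d \<boxtimes> ide (ob B)) \<odot> r"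
    and epi: "\<And>c c' t. \<lbrakk>iseq c (\<alpha> (dom r) (ob B) (ob A) \<odot> (r \<boxtimes> ide (ob A))) (ide (dom r) \<boxtimes> pair A p (ide (ob A)));
        iseq c' (\<alpha> (dom r') (ob B) (ob A) \<odot> (r' \<boxtimes> ide (ob A))) (ide (dom r') \<boxtimes> pair A p (ide (ob A)));
        \<guillemotleft>t : dom c \<rightarrow> dom c'\<guillemotright>; c' \<odot> t = (d \<boxtimes> ide (ob A)) \<odot> c\<rbrakk> \<Longrightarrow> epi t"
  shows "epi d"
proof -
  note [simp] = hhomD(1-3)[OF p(1)] d(1)
  let ?a = "ob A" and ?b = "ob B"
  define Q :: "('o, 'm) module_comon" where
    "Q = \<lparr>ob = ob B, comult = comult B, counit = counit B, act = raw (mm B \<odot> (p \<boxtimes> ide (ob B)))\<rparr>"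
  have Q [simp]: "ob Q = ?b" "\<Delta> Q = \<Delta> B" "\<epsilon> Q = \<epsilon> B"
    by (simp_all add: Q_def \<Delta>_def \<epsilon>_def)
  have [simp]: "coc Q" using hopfD(1)[of B] unfolding coc_iff Q by simp
  have v [simp]: "valid r" "valid r'" "cod r = dom r \<otimes>\<^sub>o ?b" "cod r' = dom r' \<otimes>\<^sub>o ?b"
    using r r' by (simp_all add: coaction_def)
  have [simp]: "dom r \<in> Obj M" "dom r' \<in> Obj M" by (simp_all add: valid_in_Obj)
  let ?l = "pair A p (ide ?a)"
  let ?V = "\<lparr>cob = dom r, coact = raw r\<rparr>" and ?V' = "\<lparr>cob = dom r', coact = raw r'\<rparr>"
  define W where "W = \<lparr>cob = dom ?l, coact = raw ?l\<rparr>"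
  have W: "W = induced_comodule M A (raw p)"
    unfolding W_def induced_comodule_def by simp (simp add: pair_def raw_comp raw_tens raw_structure raw_comon)
  have "epic M (ob A) (ob Q) (raw p)"
    using p(2) by (simp add: epic_iff valid_Arr_raw)
  then have refl: "reflects_epis (right_comodules M Q) M (cotensor_obj M Q W) (cotensor_arr M Q W)"
    using fcc quotient_module_comonoid[OF p(1) assms(4,5), folded Q_def]
    unfolding faithful_coflatness_condition_def W by (simp add: Obj_Hopf_coc)
  have V: "?V \<in> Obj (right_comodules M Q)" "?V' \<in> Obj (right_comodules M Q)"
    using right_comoduleI[of Q r] right_comoduleI[of Q r'] r r' by (simp_all add: right_comodules_def coaction_def)
  have "raw (r' \<odot> d) = raw ((d \<boxtimes> ide ?b) \<odot> r)" unfolding d(2) ..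
  then have D: "raw d \<in> Hom (right_comodules M Q) ?V ?V'"
    using d(1) in_hom_raw[of d] by (simp add: right_comodules_def raw_comp raw_tens raw_structure)
  define c where "c = Arr (cotensor_obj M Q W ?V) (dom r \<otimes>\<^sub>o ?a) (snd (cotensor M Q W ?V))"
  define c' where "c' = Arr (cotensor_obj M Q W ?V') (dom r' \<otimes>\<^sub>o ?a) (snd (cotensor M Q W ?V'))"
  have c: "iseq c (\<alpha> (dom r) ?b ?a \<odot> (r \<boxtimes> ide ?a)) (ide (dom r) \<boxtimes> ?l)"
    using cotensor_equalizer[of r Q ?l] unfolding c_def W_def by simp
  have c': "iseq c' (\<alpha> (dom r') ?b ?a \<odot> (r' \<boxtimes> ide ?a)) (ide (dom r') \<boxtimes> ?l)"
    using cotensor_equalizer[of r' Q ?l] unfolding c'_def W_def by simp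
  have [simp]: "valid c" "valid c'" using iseqD(2)[OF c] iseqD(2)[OF c'] .
  have [simp]: "cod c = dom r \<otimes>\<^sub>o ?a" "cod c' = dom r' \<otimes>\<^sub>o ?a"
      "dom c = cotensor_obj M Q W ?V" "dom c' = cotensor_obj M Q W ?V'"
    by (simp_all add: c_def c'_def)
  \<comment> \<open>Colinearity of \<open>d\<close> is what makes
    \<open>d \<boxtimes> ide ?a\<close> restrict to the cotensor products.\<close>
  have "(\<alpha> (dom r') ?b ?a \<odot> (r' \<boxtimes> ide ?a)) \<odot> (d \<boxtimes> ide ?a) \<odot> c = (\<alpha> (dom r') ?b ?a \<odot> ((d \<boxtimes> ide ?b) \<boxtimes> ide ?a)) \<odot> (r \<boxtimes> ide ?a) \<odot> c"
    by (simp add: d(2))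
  also have "\<dots> = (d \<boxtimes> ide (?b \<otimes>\<^sub>o ?a)) \<odot> \<alpha> (dom r) ?b ?a \<odot> (r \<boxtimes> ide ?a) \<odot> c"
    by (subst \<alpha>_natural) simp_all
  also have "\<dots> = (ide (dom r') \<boxtimes> ?l) \<odot> (d \<boxtimes> ide ?a) \<odot> c"
    using iseqD(8)[OF c] by simp
  finally obtain t where t: "valid t" "dom t = dom c" "cod t = dom c'" "c' \<odot> t = (d \<boxtimes> ide ?a) \<odot> c"
    using iseq_lift[OF c', of "(d \<boxtimes> ide ?a) \<odot> c"] by auto
  have cob: "cob W = ?a" by (simp add: W_def)
  have cv: "Arr (dom c) (cod c) (snd (cotensor M Q W ?V)) = c" "Arr (dom c') (cod c') (snd (cotensor M Q W ?V')) = c'"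
    by (simp_all add: c_def c'_def)
  have raw_c: "snd (cotensor M Q W ?V) = raw c" "snd (cotensor M Q W ?V') = raw c'"
    by (simp_all add: c_def c'_def)
  \<comment> \<open>As \<open>c'\<close> is monic, \<open>t\<close> is the only candidate for the
    definite description.\<close>
  have "cotensor_arr M Q W ?V ?V' (raw d) = raw t"
    unfolding cotensor_arr_def cob raw_c
  proof (rule the_equality)
    have "raw (c' \<odot> t) = raw ((d \<boxtimes> ide ?a) \<odot> c)" unfolding t(4) ..
    then show "raw t \<in> Hom M (cotensor_obj M Q W ?V) (cotensor_obj M Q W ?V') \<and>
        raw c' \<cdot> raw t = (raw d \<otimes>\<^sub>m Id M ?a) \<cdot> raw c"
      using t(1-3) in_hom_raw[of t] by (simp add: raw_comp raw_tens raw_structure)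
    then have e: "raw c' \<cdot> raw t = (raw d \<otimes>\<^sub>m Id M ?a) \<cdot> raw c" by simp
    fix s assume s: "s \<in> Hom M (cotensor_obj M Q W ?V) (cotensor_obj M Q W ?V') \<and>
        raw c' \<cdot> s = (raw d \<otimes>\<^sub>m Id M ?a) \<cdot> raw c"
    have [simp]: "cotensor_obj M Q W ?V \<in> Obj M" "cotensor_obj M Q W ?V' \<in> Obj M"
      using valid_in_Obj(1)[of c] valid_in_Obj(1)[of c'] by simp_all
    have "Arr (dom c) (dom c') s = t"
    proof (rule monoD[OF iseqD(1)[OF c']])
      show "c' \<odot> Arr (dom c) (dom c') s = c' \<odot> t"
        using s t(1-3) e by (subst arrow_eq_iff) (simp_all add: raw_comp)
    qed (use s t in simp_all)
    then show "s = raw t" by auto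
  qed
  moreover have "epi t" using epi[OF c c' _ t(4)] t by simp
  ultimately have "epic M (cotensor_obj M Q W ?V) (cotensor_obj M Q W ?V') (cotensor_arr M Q W ?V ?V' (raw d))"
    using t valid_in_Obj(1)[of c] valid_in_Obj(1)[of c'] by (subst epic_iff) (simp_all add: valid_Arr_raw)
  then have "epic (right_comodules M Q) ?V ?V' (raw d)"
    using refl V D unfolding reflects_epis_def by blast
  then show "epi d"
    using r r' d by (intro comodule_epi[of Q r r']) (simp_all add: coaction_def)
qed

end

section \<open>Surjections of Hopf monoids are cokernels of their kernels\<close>

context abelian_symmetric_monoidal_category
begin

lemmas structure_pair_comp [simp] = \<alpha>_pair[THEN comp_reassoc] \<alpha>'_pair[THEN comp_reassoc]
  br_pair[THEN comp_reassoc] lu_pair[THEN comp_reassoc] ru_pair[THEN comp_reassoc]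

text \<open>A comonoid morphism f makes its source coact by x -> <x, f(x)>; coassociativity holds
  because f respects \<Delta>.\<close>

lemma cmap_coaction:
  assumes f: "cmap T Q f" and [simp]: "coc T" "coc Q"
  shows "coaction Q (pair T (ide (ob T)) f)"
proof -
  note [simp] = cmapD[OF f] comult_cmap[OF f]
  have "\<alpha> (ob T) (ob Q) (ob Q) \<odot> (pair T (ide (ob T)) f \<boxtimes> ide (ob Q)) \<odot> pair T (ide (ob T)) f
     = (ide (ob T) \<boxtimes> \<Delta> Q) \<odot> pair T (ide (ob T)) f"
    by simp
  then show ?thesis unfolding coaction_def by simp
qed

text \<open>(p \<otimes> 1) <1, p> = \<Delta> p vanishes on the linear kernel. Tensoring with
  \<open>B\<close> keeps that kernel a kernel, so <1, p> restricts to it; the comodule laws are then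
  tested after composing with monomorphisms into \<open>A\<close>.\<close>

lemma ker_coaction:
  assumes p: "cmap A B p" and k: "ker k p" and [simp]: "coc A" "coc B"
  obtains r where "coaction B r" "dom r = dom k" "(k \<boxtimes> ide (ob B)) \<odot> r = pair A (ide (ob A)) p \<odot> k"
proof -
  let ?a = "ob A" and ?b = "ob B"
  let ?r = "pair A (ide ?a) p"
  note [simp] = cmapD[OF p] comult_cmap[OF p]
  have [simp]: "valid k" "cod k = ?a" using kerD(2,4)[OF k] by simp_all
  have [simp]: "dom k \<in> Obj M" by (simp add: valid_in_Obj)
  have pk: "p \<odot> k = zero (dom k) ?b" using kerD(5)[OF k] by simp
  have "(p \<boxtimes> ide ?b) \<odot> ?r \<odot> k = \<Delta> B \<odot> p \<odot> k"
    using comp_reassoc[OF comult_cmap[OF p], of k] by simp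
  also have "\<dots> = zero (dom k) (?b \<otimes>\<^sub>o ?b)" unfolding pk by simp
  finally obtain r where [simp]: "valid r" "dom r = dom k" "cod r = dom k \<otimes>\<^sub>o ?b" and kr: "(k \<boxtimes> ide ?b) \<odot> r = ?r \<odot> k"
    using ker_lift[OF exact_functor_ker[OF exact_functor_right k], of ?b "?r \<odot> k"] by auto
  have m: "mono k" by (rule kerD[OF k])
  have "(k \<boxtimes> ide (?b \<otimes>\<^sub>o ?b)) \<odot> \<alpha> (dom k) ?b ?b \<odot> (r \<boxtimes> ide ?b) \<odot> r
     = \<alpha> ?a ?b ?b \<odot> (((k \<boxtimes> ide ?b) \<odot> r) \<boxtimes> ide ?b) \<odot> r"
    using \<alpha>_natural[of k "ide ?b" "ide ?b" ?a ?b ?b, THEN comp_reassoc, of "(r \<boxtimes> ide ?b) \<odot> r"] by simp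
  also have "\<dots> = \<alpha> ?a ?b ?b \<odot> ((?r \<odot> k) \<boxtimes> ide ?b) \<odot> r"
    by (simp only: kr)
  also have "\<dots> = \<alpha> ?a ?b ?b \<odot> (?r \<boxtimes> ide ?b) \<odot> ((k \<boxtimes> ide ?b) \<odot> r)"
    by simp
  also have "\<dots> = (\<alpha> ?a ?b ?b \<odot> (?r \<boxtimes> ide ?b) \<odot> ?r) \<odot> k"
    by (simp only: kr comp_assoc)
  also have "\<dots> = ((ide ?a \<boxtimes> \<Delta> B) \<odot> ?r) \<odot> k"
    by simp
  also have "\<dots> = (ide ?a \<boxtimes> \<Delta> B) \<odot> (k \<boxtimes> ide ?b) \<odot> r"
    by (simp only: kr comp_assoc)
  finally have e1: "(k \<boxtimes> ide (?b \<otimes>\<^sub>o ?b)) \<odot> \<alpha> (dom k) ?b ?b \<odot> (r \<boxtimes> ide ?b) \<odot> r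
      = (k \<boxtimes> ide (?b \<otimes>\<^sub>o ?b)) \<odot> (ide (dom k) \<boxtimes> \<Delta> B) \<odot> r"
    by simp
  have "\<alpha> (dom k) ?b ?b \<odot> (r \<boxtimes> ide ?b) \<odot> r = (ide (dom k) \<boxtimes> \<Delta> B) \<odot> r"
    by (rule monoD[OF mono_tens[OF m mono_ide] e1]) simp_all
  moreover have "ru (dom k) \<odot> (ide (dom k) \<boxtimes> \<epsilon> B) \<odot> r = ide (dom k)"
  proof (rule monoD[OF m])
    have "k \<odot> ru (dom k) \<odot> (ide (dom k) \<boxtimes> \<epsilon> B) \<odot> r = ru ?a \<odot> (ide ?a \<boxtimes> \<epsilon> B) \<odot> (k \<boxtimes> ide ?b) \<odot> r"
      using ru_natural[of k ?a, THEN comp_reassoc, of "(ide (dom k) \<boxtimes> \<epsilon> B) \<odot> r"] by simp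
    also have "\<dots> = k" unfolding kr by simp
    finally show "k \<odot> ru (dom k) \<odot> (ide (dom k) \<boxtimes> \<epsilon> B) \<odot> r = k \<odot> ide (dom k)" by simp
  qed simp_all
  ultimately have "coaction B r" unfolding coaction_def by simp
  then show ?thesis using kr by (intro that) simp_all
qed

text \<open>
  Let \<open>p : A \<rightarrow> B\<close> be epic in \<open>M\<close> with Hopf kernel \<open>k : K \<rightarrow> A\<close> and linear kernel \<open>i : P \<rightarrow> A\<close>. The
  comodule map \<open>d : K \<otimes> A \<rightarrow> P\<close>, \<open>x \<otimes> y \<mapsto> k(x) y - \<epsilon>(x) y\<close>, becomes a split epimorphism after
  applying \<open>(-) \<box>\<^sub>B A\<close>: a section is \<open>y \<otimes> z \<mapsto> y S(z) \<otimes> z \<otimes> z\<close>. Hence \<open>d\<close> is epic, so that a linear map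
  which does not distinguish \<open>k(x) y\<close> from \<open>\<epsilon>(x) y\<close> vanishes on \<open>P\<close>.
\<close>

lemma hopf_epi_factor:
  fixes A B K :: "('o, 'm) hopf_data"
  assumes fcc: "faithful_coflatness_condition M"
    and p: "hhom A B p" "epi p" and [simp]: "hopf A" "hopf B" "hopf K"
    and k: "hhom K A k" "mono k" "p \<odot> k = un B \<odot> \<epsilon> K"
      "\<And>(S :: ('o, 'm) comon) x. \<lbrakk>coc S; cmap S A x; p \<odot> x = un B \<odot> \<epsilon> S\<rbrakk> \<Longrightarrow> \<exists>t. cmap S K t \<and> k \<odot> t = x"
    and g: "valid g" "dom g = ob A" "g \<odot> cv A (prod K A) (k \<odot> p1 K A) (p2 K A) = g \<odot> p2 K A"
  obtains h where "valid h" "dom h = ob B" "cod h = cod g" "h \<odot> p = g"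
proof -
  let ?a = "ob A" and ?b = "ob B" and ?T = "prod K A" and ?AA = "prod A A"
  note [simp] = hhomD(1-3)[OF p(1)] hhomD(1-3)[OF k(1)] hhomD(6)[OF p(1)] hhomD(6)[OF k(1)]
    hhomD(6)[OF p(1), THEN comp_reassoc] hhomD(6)[OF k(1), THEN comp_reassoc] g(1,2)
  have cp: "cmap A B p" and ck: "cmap K A k" using p(1) k(1) by (simp_all add: hhom_cmap)
  note [simp] = comult_cmap[OF cp]
  obtain i where i: "ker i p" "coker p i" using epi_exact[OF p(2)] .
  have im: "mono i" and [simp]: "valid i" "cod i = ?a" using kerD(1,2,4)[OF i(1)] by simp_all
  have [simp]: "dom i \<in> Obj M" "cod g \<in> Obj M" by (simp_all add: valid_in_Obj)
  have pi: "p \<odot> i = zero (dom i) ?b" using kerD(5)[OF i(1)] by simp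
  obtain r where r: "coaction B r" "dom r = dom i" "(i \<boxtimes> ide ?b) \<odot> r = pair A (ide ?a) p \<odot> i"
    using ker_coaction[OF cp i(1)] by auto
  note [simp] = r(2)
  have [simp]: "valid r" "cod r = dom i \<otimes>\<^sub>o ?b" using r(1) by (simp_all add: coaction_def)
  \<comment> \<open>On elements \<open>a\<close> is (x, y) -> k(x) y and \<open>b\<close> is (x, y)
    -> y. Their difference \<open>D\<close> is merely linear, so facts about it are reduced to
    \<open>a\<close> and \<open>b\<close> by \<open>add_D\<close> and cancellation.\<close>
  define a where "a = cv A ?T (k \<odot> p1 K A) (p2 K A)"
  define b where "b = p2 K A"
  have ca: "cmap ?T A a" and cb: "cmap ?T A b"
    unfolding a_def b_def by (simp_all add: cmap_cv cmap_comp[OF _ ck])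
  note [simp] = cmapD[OF ca] cmapD[OF cb]
  have \<epsilon>p1: "\<epsilon> K \<odot> p1 K A = \<epsilon> ?T" using cmapD(4)[of ?T K "p1 K A"] by simp
  have pab: "p \<odot> a = p \<odot> b"
    using comp_reassoc[OF k(3), of "p1 K A"]
    by (simp add: a_def b_def hhom_cv[OF p(1)] \<epsilon>p1)
  obtain D where [simp]: "valid D" "dom D = ob K \<otimes>\<^sub>o ?a" "cod D = ?a" and D: "add D b = a"
    using ex_difference[of a b] by auto
  have add_D: "add (x \<odot> D) (x \<odot> b) = x \<odot> a" if "valid x" "dom x = ?a" for x
    unfolding D[symmetric] using that by simp
  have zero_D: "x \<odot> D = zero (ob K \<otimes>\<^sub>o ?a) (cod x)" if "valid x" "dom x = ?a" "x \<odot> a = x \<odot> b" for x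
  proof (rule add_right_cancel)
    have "cod x \<in> Obj M" using that by (simp add: valid_in_Obj)
    then show "add (x \<odot> D) (x \<odot> b) = add (zero (ob K \<otimes>\<^sub>o ?a) (cod x)) (x \<odot> b)" "valid (zero (ob K \<otimes>\<^sub>o ?a) (cod x))"
      using add_D that by simp_all
  qed (use that in simp_all)
  have "p \<odot> D = zero (ob K \<otimes>\<^sub>o ?a) ?b" using zero_D[of p] pab by simp
  then obtain d where [simp]: "valid d" "dom d = ob K \<otimes>\<^sub>o ?a" "cod d = dom i" and d: "i \<odot> d = D"
    using ker_lift[OF i(1), of D] by auto
  \<comment> \<open>K \<otimes> A coacts through its second factor, by p(y).\<close>
  define c where "c = pair ?T (ide (ob K \<otimes>\<^sub>o ?a)) (p \<odot> b)"
  have c_hom [simp]: "valid c" "dom c = ob K \<otimes>\<^sub>o ?a" "cod c = (ob K \<otimes>\<^sub>o ?a) \<otimes>\<^sub>o ?b"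
    by (simp_all add: c_def)
  have "coaction B c"
    unfolding c_def using cmap_coaction[OF cmap_comp[OF cb cp]] by simp
  have "epi d"
  proof (rule coflat_reflects_epi[OF fcc p assms(4,5) \<open>coaction B c\<close> r(1)])
    show "\<guillemotleft>d : dom c \<rightarrow> dom r\<guillemotright>" by simp
    show "r \<odot> d = (d \<boxtimes> ide ?b) \<odot> c"
    proof (rule monoD[OF mono_tens[OF im mono_ide[of ?b]]])
      let ?r = "pair A (ide ?a) p"
      \<comment> \<open>A comonoid morphism that p does not distinguish from \<open>b\<close> is
        colinear for \<open>c\<close>. This covers \<open>a\<close> as well as \<open>b\<close>, and
        \<open>D\<close> follows by cancelling the \<open>b\<close> part.\<close>
      have ra: "?r \<odot> x = (x \<boxtimes> ide ?b) \<odot> c" if "cmap ?T A x" "p \<odot> x = p \<odot> b" for x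
        using that cmapD[OF that(1)] by (simp add: pair_cmap[OF that(1)] c_def)
      have "(D \<boxtimes> ide ?b) \<odot> c = ?r \<odot> D"
      proof (rule add_right_cancel)
        have "add ((D \<boxtimes> ide ?b) \<odot> c) ((b \<boxtimes> ide ?b) \<odot> c) = (add D b \<boxtimes> ide ?b) \<odot> c"
          by (simp add: add_tens_ide)
        also have "\<dots> = add (?r \<odot> D) ((b \<boxtimes> ide ?b) \<odot> c)"
          unfolding D using ra[OF ca pab] ra[OF cb] add_D[of ?r] by simp
        finally show "add ((D \<boxtimes> ide ?b) \<odot> c) ((b \<boxtimes> ide ?b) \<odot> c) = add (?r \<odot> D) ((b \<boxtimes> ide ?b) \<odot> c)" .
      qed simp_all
      moreover have "(i \<boxtimes> ide ?b) \<odot> r \<odot> d = ?r \<odot> i \<odot> d"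
        using comp_reassoc[OF r(3), of d] by simp
      ultimately show "(i \<boxtimes> ide ?b) \<odot> r \<odot> d = (i \<boxtimes> ide ?b) \<odot> (d \<boxtimes> ide ?b) \<odot> c"
        by (simp add: d)
    qed simp_all
    let ?l = "pair A p (ide ?a)"
    fix e e' t
    assume e: "iseq e (\<alpha> (dom c) ?b ?a \<odot> (c \<boxtimes> ide ?a)) (ide (dom c) \<boxtimes> ?l)"
      and e': "iseq e' (\<alpha> (dom r) ?b ?a \<odot> (r \<boxtimes> ide ?a)) (ide (dom r) \<boxtimes> ?l)"
      and t: "\<guillemotleft>t : dom e \<rightarrow> dom e'\<guillemotright>" and te: "e' \<odot> t = (d \<boxtimes> ide ?a) \<odot> e"
    note [simp] = t
    have [simp]: "valid e" "valid e'" using iseqD(2)[OF e] iseqD(2)[OF e'] .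
    have [simp]: "cod e = (ob K \<otimes>\<^sub>o ?a) \<otimes>\<^sub>o ?a" "cod e' = dom i \<otimes>\<^sub>o ?a"
      using iseqD(6)[OF e] iseqD(6)[OF e'] by simp_all
    have [simp]: "dom e' \<in> Obj M" by (simp add: valid_in_Obj)
    let ?p = "p1 A A" and ?q = "p2 A A" and ?I = "ide (?a \<otimes>\<^sub>o ?a)"
    have cpp: "cmap ?AA B (p \<odot> ?p)" and cpq: "cmap ?AA B (p \<odot> ?q)"
      by (rule cmap_comp[OF _ cp]; simp)+
    \<comment> \<open>Construction of the fibre product A x_B A: \<open>w\<close> is its inclusion
      into A \<otimes> A, and below \<open>w1\<close> and \<open>w2\<close> are its projections,
      with p w1 = p w2.\<close>
    obtain w dw where w: "mono w" "cod w = ob ?AA" "\<guillemotleft>dw : dom w \<rightarrow> dom w \<otimes>\<^sub>o dom w\<guillemotright>"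
      "(w \<boxtimes> w) \<odot> dw = \<Delta> ?AA \<odot> w" "(p \<odot> ?p) \<odot> w = (p \<odot> ?q) \<odot> w"
      "iseq w (pair ?AA (ide (ob ?AA)) (p \<odot> ?p)) (pair ?AA (ide (ob ?AA)) (p \<odot> ?q))"
      using comonoid_equalizer[OF cpp cpq] by auto
    have [simp]: "valid w" using w(1) by (rule mono_valid)
    have [simp]: "dom w \<in> Obj M" by (simp add: valid_in_Obj)
    define W :: "('o, 'm) comon" where "W = \<lparr>ob = dom w, comult = raw dw, counit = raw (\<epsilon> ?AA \<odot> w)\<rparr>"
    have obW [simp]: "ob W = dom w" and "\<Delta> W = dw" "\<epsilon> W = \<epsilon> ?AA \<odot> w"
      using w(2,3) by (simp_all add: \<Delta>_def[of W] \<epsilon>_def[of W], simp_all add: W_def valid_Arr_raw)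
    then have W [simp]: "coc W" and cw: "cmap W ?AA w"
      using coc_sub[OF _ w(1,2,3,4), of W] by simp_all
    define w1 where "w1 = ?p \<odot> w"
    define w2 where "w2 = ?q \<odot> w"
    have cw1: "cmap W A w1" and cw2: "cmap W A w2"
      unfolding w1_def w2_def by (rule cmap_comp[OF cw]; simp)+
    note [simp] = cmapD[OF cw1] cmapD[OF cw2] comult_cmap[OF cw2] cmapD(4)[OF cw] w(2)
    have pw: "p \<odot> w1 = p \<odot> w2" using w(5) by (simp add: w1_def w2_def)
    have wpair: "w = pair W w1 w2"
    proof -
      have "w = pair ?AA ?p ?q \<odot> w" by simp
      also have "\<dots> = pair W w1 w2"
        unfolding w1_def w2_def by (simp add: pair_cmap[OF cw] del: pair_p1_p2)
      finally show ?thesis .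
    qed

    let ?e0 = "(i \<boxtimes> ide ?a) \<odot> e'"
    have pq: "x = x \<odot> pair ?AA ?p ?q" if "valid x" "dom x = ?a \<otimes>\<^sub>o ?a" for x
      using that by simp
    have f1: "\<alpha> ?a ?b ?a \<odot> (pair A (ide ?a) p \<boxtimes> ide ?a) = pair ?AA ?p (pair ?AA (p \<odot> ?p) ?q)"
      by (subst pq) (simp_all add: pair_cmap[of ?AA A ?p] del: pair_p1_p2)
    have f2: "ide ?a \<boxtimes> ?l = pair ?AA ?p (pair ?AA (p \<odot> ?q) ?q)"
      by (subst pq) (simp_all add: pair_cmap[of ?AA A ?q] del: pair_p1_p2)
    \<comment> \<open>The cotensor condition places the \<open>B\<close>-component in the middle,
      the equation defining the fibre product places it last; \<open>\<theta>\<close> moves it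
      there. This is what lets the cotensor product of P and \<open>A\<close> map into the fibre
      product, by \<open>n\<close>.\<close>
    define \<theta> where "\<theta> = \<alpha>' ?a ?a ?b \<odot> (ide ?a \<boxtimes> br ?b ?a)"
    have \<theta>: "\<theta> \<odot> pair ?AA ?p (pair ?AA x ?q) = pair ?AA ?I x"
      if "valid x" "dom x = ?a \<otimes>\<^sub>o ?a" "cod x = ?b" for x
      using that by (simp add: \<theta>_def)
    have "(\<alpha> ?a ?b ?a \<odot> (pair A (ide ?a) p \<boxtimes> ide ?a)) \<odot> ?e0 = (ide ?a \<boxtimes> ?l) \<odot> ?e0"
    proof -
      have "(\<alpha> ?a ?b ?a \<odot> (pair A (ide ?a) p \<boxtimes> ide ?a)) \<odot> ?e0 = \<alpha> ?a ?b ?a \<odot> ((pair A (ide ?a) p \<odot> i) \<boxtimes> ide ?a) \<odot> e'"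
        by simp
      also have "\<dots> = (\<alpha> ?a ?b ?a \<odot> ((i \<boxtimes> ide ?b) \<boxtimes> ide ?a)) \<odot> (r \<boxtimes> ide ?a) \<odot> e'"
        unfolding r(3)[symmetric] by simp
      also have "\<dots> = (i \<boxtimes> ide (?b \<otimes>\<^sub>o ?a)) \<odot> (\<alpha> (dom i) ?b ?a \<odot> (r \<boxtimes> ide ?a)) \<odot> e'"
        by (subst \<alpha>_natural) simp_all
      also have "\<dots> = (i \<boxtimes> ide (?b \<otimes>\<^sub>o ?a)) \<odot> (ide (dom i) \<boxtimes> ?l) \<odot> e'"
        using iseqD(8)[OF e'] by simp
      finally show ?thesis by simp
    qed
    then have "\<theta> \<odot> pair ?AA ?p (pair ?AA (p \<odot> ?p) ?q) \<odot> ?e0 = \<theta> \<odot> pair ?AA ?p (pair ?AA (p \<odot> ?q) ?q) \<odot> ?e0"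
      unfolding f1 f2 by simp
    then have "pair ?AA ?I (p \<odot> ?p) \<odot> ?e0 = pair ?AA ?I (p \<odot> ?q) \<odot> ?e0"
      using comp_reassoc[OF \<theta>[of "p \<odot> ?p"], of ?e0] comp_reassoc[OF \<theta>[of "p \<odot> ?q"], of ?e0] by simp
    then obtain n where [simp]: "valid n" "dom n = dom e'" "cod n = dom w" and n: "w \<odot> n = ?e0"
      using iseq_lift[OF w(6), of ?e0] by auto

    have can: "cmap W A (an A \<odot> w2)" by (rule cmap_comp[OF cw2]) simp
    note [simp] = cmapD[OF can]
    have "p \<odot> an A \<odot> w2 = an B \<odot> p \<odot> w2"
      using comp_reassoc[OF hhom_antipode[OF p(1)], of w2] by simp
    \<comment> \<open>p(w1 S(w2)) = p(w1) p(w2)^-1 = 1, so w1 S(w2) lifts to the Hopf kernel, as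
      \<open>\<kappa>\<close>.\<close>
    then have "p \<odot> cv A W w1 (an A \<odot> w2) = un B \<odot> \<epsilon> W"
      using cv_inverse(2)[OF cmap_comp[OF cw2 cp]] by (simp add: hhom_cv[OF p(1)] pw)
    then obtain \<kappa> where \<kappa>: "cmap W K \<kappa>" "k \<odot> \<kappa> = cv A W w1 (an A \<odot> w2)"
      using k(4)[OF W cmap_cv[OF cw1 can]] by auto
    note [simp] = cmapD[OF \<kappa>(1)]
    let ?s = "pair W (pair W \<kappa> w2) w2"
    have cs: "cmap W ?T (pair W \<kappa> w2)" by (rule cmap_pair[OF \<kappa>(1) cw2]) simp_all
    have bs: "b \<odot> pair W \<kappa> w2 = w2" by (simp add: b_def)
    have as: "a \<odot> pair W \<kappa> w2 = w1"
    proof -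
      have "a \<odot> pair W \<kappa> w2 = cv A W (cv A W w1 (an A \<odot> w2)) w2"
        unfolding a_def by (subst cv_comp[OF cs]) (simp_all add: \<kappa>(2))
      also have "\<dots> = w1"
        using cv_inverse(1)[OF cw2] by (simp add: cv_assoc)
      finally show ?thesis .
    qed
    \<comment> \<open>Both coactions insert p(w2) in the middle, so \<open>?s\<close> takes values
      in the cotensor product of K \<otimes> A with \<open>A\<close>.\<close>
    have "(\<alpha> (dom c) ?b ?a \<odot> (c \<boxtimes> ide ?a)) \<odot> ?s = (ide (dom c) \<boxtimes> ?l) \<odot> ?s"
      unfolding c_def by (simp add: pair_cmap[OF cs] pair_cmap[OF cw2] bs)
    then have "(\<alpha> (dom c) ?b ?a \<odot> (c \<boxtimes> ide ?a)) \<odot> ?s \<odot> n = (ide (dom c) \<boxtimes> ?l) \<odot> ?s \<odot> n"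
      by (simp only: comp_assoc[symmetric])
    then obtain u where [simp]: "valid u" "dom u = dom e'" "cod u = dom e" and u: "e \<odot> u = ?s \<odot> n"
      using iseq_lift[OF e, of "?s \<odot> n"] by auto
    \<comment> \<open>On P the counit vanishes, being \<open>\<epsilon> B\<close> composed with p.
      Hence the projection of P \<otimes> A to its second factor, which discards the first one by
      the counit, is zero.\<close>
    have w2n: "w2 \<odot> n = zero (dom e') ?a"
    proof -
      have \<epsilon>i: "\<epsilon> A \<odot> i = zero (dom i) \<one>\<^sub>o"
        using comp_reassoc[OF hhomD(6)[OF p(1)], of i] by (simp add: pi)
      have "w2 \<odot> n = ?q \<odot> ?e0"
        unfolding w2_def using n by simp
      also have "\<dots> = lu ?a \<odot> ((\<epsilon> A \<odot> i) \<boxtimes> ide ?a) \<odot> e'"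
        by (simp add: p2_def)
      also have "\<dots> = zero (dom e') ?a"
        unfolding \<epsilon>i by (simp add: zero_tens_ide)
      finally show ?thesis .
    qed
    \<comment> \<open>The \<open>a\<close> part of \<open>D\<close> turns the section into <w1, w2>,
      the inclusion of the fibre product; the \<open>b\<close> part gives <w2, w2>, which is
      \<Delta> after w2 and so vanishes along \<open>n\<close> by \<open>w2n\<close>.\<close>
    have "(D \<boxtimes> ide ?a) \<odot> ?s \<odot> n = ?e0"
    proof -
      have "add ((D \<boxtimes> ide ?a) \<odot> ?s \<odot> n) ((b \<boxtimes> ide ?a) \<odot> ?s \<odot> n) = (add D b \<boxtimes> ide ?a) \<odot> ?s \<odot> n"
        by (simp add: add_tens_ide del: tens_pair tens_pair_comp)
      also have "\<dots> = pair W w1 w2 \<odot> n"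
        unfolding D using as by simp
      also have "\<dots> = ?e0" unfolding wpair[symmetric] by (rule n)
      finally have *: "add ((D \<boxtimes> ide ?a) \<odot> ?s \<odot> n) ((b \<boxtimes> ide ?a) \<odot> ?s \<odot> n) = ?e0" .
      have "(b \<boxtimes> ide ?a) \<odot> ?s \<odot> n = \<Delta> A \<odot> w2 \<odot> n"
        using comp_reassoc[OF comult_cmap[OF cw2], of n] bs by simp
      also have "\<dots> = zero (dom e') (?a \<otimes>\<^sub>o ?a)" unfolding w2n by simp
      finally show ?thesis
        using * by (simp add: add_zero_right)
    qed
    moreover have "(i \<boxtimes> ide ?a) \<odot> e' \<odot> t \<odot> u = (D \<boxtimes> ide ?a) \<odot> ?s \<odot> n"
      using comp_reassoc[OF te, of u] comp_reassoc[OF d, of "pair W \<kappa> w2"] u by simp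
    ultimately have "(i \<boxtimes> ide ?a) \<odot> e' \<odot> t \<odot> u = (i \<boxtimes> ide ?a) \<odot> e' \<odot> ide (dom e')"
      by simp
    then have "e' \<odot> t \<odot> u = e' \<odot> ide (dom e')"
      by (rule monoD[OF mono_tens[OF im mono_ide[of ?a]], rotated]) simp_all
    then have "t \<odot> u = ide (dom e')"
      by (rule monoD[OF iseqD(1)[OF e']]) simp_all
    then show "epi t"
      using epi_cancel[of t u] by simp
  qed
  have "g \<odot> i \<odot> d = zero (ob K \<otimes>\<^sub>o ?a) (cod g)"
    using zero_D[of g] g(3) by (simp add: d a_def b_def)
  then have "(g \<odot> i) \<odot> d = zero (dom i) (cod g) \<odot> d" by simp
  then have "g \<odot> i = zero (dom i) (cod g)"
    by (rule epiD[OF \<open>epi d\<close>]) simp_all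
  then show ?thesis
    using coker_lift[OF i(2), of g] that by auto
qed

text \<open>Multiplicativity of x turns triviality of x on the Hopf kernel into x(k(u) y) = x(y) for
  u in \<open>K\<close>, the linear condition that \<open>hopf_epi_factor\<close> asks for.\<close>

lemma hopf_epi_is_cokernel:
  fixes A B :: "('o, 'm) hopf_data"
  assumes fcc: "faithful_coflatness_condition M"
    and p: "hhom A B p" "epi p" and [simp]: "hopf A" "hopf B"
  obtains K :: "('o, 'm) hopf_data" and k where "hopf K" "hhom K A k" "p \<odot> k = un B \<odot> \<epsilon> K"
    "\<And>(X :: ('o, 'm) hopf_data) x. \<lbrakk>hopf X; cmap A X x; x \<odot> mm A = mm X \<odot> (x \<boxtimes> x); x \<odot> k = un X \<odot> \<epsilon> K\<rbrakk>
       \<Longrightarrow> \<exists>h. \<guillemotleft>h : ob B \<rightarrow> ob X\<guillemotright> \<and> h \<odot> p = x"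
proof -
  obtain K :: "('o, 'm) hopf_data" and k where [simp]: "hopf K" and k: "hhom K A k" "mono k" "p \<odot> k = un B \<odot> \<epsilon> K"
    and lift: "\<And>(S :: ('o, 'm) comon) x. \<lbrakk>coc S; cmap S A x; p \<odot> x = un B \<odot> \<epsilon> S\<rbrakk> \<Longrightarrow> \<exists>t. cmap S K t \<and> k \<odot> t = x"
    by (rule hopf_kernel[OF p(1) assms(4,5)]) blast
  note [simp] = hhomD(1-3)[OF k(1)] hhomD(1-3)[OF p(1)]
  have "\<exists>h. \<guillemotleft>h : ob B \<rightarrow> ob X\<guillemotright> \<and> h \<odot> p = x"
    if [simp]: "hopf X" and cx: "cmap A X x" and xm: "x \<odot> mm A = mm X \<odot> (x \<boxtimes> x)" and xk: "x \<odot> k = un X \<odot> \<epsilon> K"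
    for X :: "('o, 'm) hopf_data" and x
  proof -
    note [simp] = cmapD[OF cx]
    have "\<epsilon> K \<odot> p1 K A = \<epsilon> (prod K A)" using cmapD(4)[of "prod K A" K "p1 K A"] by simp
    then have "x \<odot> cv A (prod K A) (k \<odot> p1 K A) (p2 K A) = cv X (prod K A) (un X \<odot> \<epsilon> (prod K A)) (x \<odot> p2 K A)"
      using comp_reassoc[OF xm] comp_reassoc[OF xk, of "p1 K A"] by (simp add: cv_def)
    then have eq: "x \<odot> cv A (prod K A) (k \<odot> p1 K A) (p2 K A) = x \<odot> p2 K A" by simp
    have x: "valid x" "dom x = ob A" by simp_all
    obtain h where "valid h" "dom h = ob B" "cod h = cod x" "h \<odot> p = x"
      by (rule hopf_epi_factor[OF fcc p assms(4,5) \<open>hopf K\<close> k lift x eq])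
    then show ?thesis by (intro exI[of _ h]) simp
  qed
  then show ?thesis using k by (intro that) simp_all
qed

end

section \<open>Regular epimorphisms and monomorphisms of Hopf monoids\<close>

context abelian_symmetric_monoidal_category
begin

text \<open>The factorizations obtained so far are only arrows of \<open>M\<close>. Since p and p
  \<otimes> p are epic, the laws for h can be tested after composing with them, where they become
  laws for x.\<close>

lemma hhom_factor_epi:
  assumes p: "hhom A B p" "epi p" and x: "hhom A X x" and h: "\<guillemotleft>h : ob B \<rightarrow> ob X\<guillemotright>" "h \<odot> p = x"
    and [simp]: "hopf A" "hopf B" "hopf X"
  shows "hhom B X h"
proof -
  note [simp] = hhomD(1-3)[OF p(1)] hhomD(1-3)[OF x] h(1)
  have pp: "epi (p \<boxtimes> p)" using p(2) by (simp add: epi_tens)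
  have cp: "\<Delta> B \<odot> p = (p \<boxtimes> p) \<odot> \<Delta> A" and cx: "\<Delta> X \<odot> x = (x \<boxtimes> x) \<odot> \<Delta> A"
    using hhom_cmap[OF p(1)] hhom_cmap[OF x] by (simp_all add: cmap_def)
  have "\<Delta> X \<odot> h = (h \<boxtimes> h) \<odot> \<Delta> B"
    by (rule epiD[OF p(2)]) (simp_all add: h(2) cp cx)
  moreover have "\<epsilon> X \<odot> h = \<epsilon> B"
    by (rule epiD[OF p(2)]) (simp_all add: h(2) hhomD(6)[OF p(1)] hhomD(6)[OF x])
  moreover have "h \<odot> mm B = mm X \<odot> (h \<boxtimes> h)"
  proof (rule epiD[OF pp])
    have "(h \<odot> mm B) \<odot> (p \<boxtimes> p) = h \<odot> p \<odot> mm A"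
      using hhomD(4)[OF p(1)] by simp
    also have "\<dots> = x \<odot> mm A"
      by (rule comp_reassoc[OF h(2)])
    also have "\<dots> = (mm X \<odot> (h \<boxtimes> h)) \<odot> (p \<boxtimes> p)"
      using hhomD(4)[OF x] by (simp add: h(2))
    finally show "(h \<odot> mm B) \<odot> (p \<boxtimes> p) = (mm X \<odot> (h \<boxtimes> h)) \<odot> (p \<boxtimes> p)" .
  qed simp_all
  moreover have "h \<odot> un B = un X"
    using comp_reassoc[OF h(2), of "un A"] hhomD(5)[OF p(1)] hhomD(5)[OF x] by simp
  ultimately show ?thesis by (simp add: hhom_def cmap_def)
qed

lemma Hom_Hopf_coc_raw: "\<lbrakk>hopf A; hopf B; hhom A B f\<rbrakk> \<Longrightarrow> raw f \<in> Hom (Hopf_coc M) A B"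
  using hhomD[of A B f] by (simp add: Hom_Hopf_coc valid_Arr_raw)

lemma is_cokernel_Hopf_coc:
  fixes A B :: "('o, 'm) hopf_data"
  assumes fcc: "faithful_coflatness_condition M"
    and p: "hhom A B p" "epi p" and [simp]: "hopf A" "hopf B"
  shows "is_cokernel (Hopf_coc M) A B (raw p)"
proof -
  obtain K :: "('o, 'm) hopf_data" and k where [simp]: "hopf K" and k: "hhom K A k" "p \<odot> k = un B \<odot> \<epsilon> K"
    and factor: "\<And>(X :: ('o, 'm) hopf_data) x. \<lbrakk>hopf X; cmap A X x; x \<odot> mm A = mm X \<odot> (x \<boxtimes> x); x \<odot> k = un X \<odot> \<epsilon> K\<rbrakk>
       \<Longrightarrow> \<exists>h. \<guillemotleft>h : ob B \<rightarrow> ob X\<guillemotright> \<and> h \<odot> p = x"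
    by (rule hopf_epi_is_cokernel[OF fcc p assms(4,5)]) blast
  note [simp] = hhomD(1-3)[OF k(1)] hhomD(1-3)[OF p(1)]
  let ?z = "un A \<odot> \<epsilon> K"
  have z: "hhom K A ?z" by simp
  have xz: "x \<odot> ?z = un X \<odot> \<epsilon> K" if "hhom A X x" for X :: "('o, 'm) hopf_data" and x
    using comp_reassoc[OF hhomD(5)[OF that], of "\<epsilon> K"] by simp
  have "coequalizer (Hopf_coc M) K A (raw k) (raw ?z) B (raw p)"
    unfolding coequalizer_def Hopf_coc_simps
  proof (intro conjI ballI impI)
    show "raw k \<in> Hom (Hopf_coc M) K A" "raw ?z \<in> Hom (Hopf_coc M) K A" "raw p \<in> Hom (Hopf_coc M) A B"
      using k(1) z p(1) by (simp_all add: Hom_Hopf_coc_raw)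
    show "B \<in> Obj (Hopf_coc M)" by (simp add: Obj_Hopf_coc)
    show "raw p \<cdot> raw k = raw p \<cdot> raw ?z"
      using xz[OF p(1)] k(2) by (simp flip: raw_comp)
    fix X x assume X: "X \<in> Obj (Hopf_coc M)" and x: "x \<in> Hom (Hopf_coc M) A X" and e: "x \<cdot> raw k = x \<cdot> raw ?z"
    have [simp]: "hopf X" using X by (simp add: Obj_Hopf_coc)
    let ?x = "Arr (ob A) (ob X) x"
    have hx: "hhom A X ?x" using x by (simp add: Hom_Hopf_coc)
    note [simp] = hhomD(1)[OF hx, unfolded valid_Arr]
    have "raw (?x \<odot> k) = raw (?x \<odot> ?z)"
      using e by (subst (1 2) raw_comp) simp_all
    then have "?x \<odot> k = ?x \<odot> ?z"
      by (subst arrow_eq_iff) simp_all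
    then have "?x \<odot> k = un X \<odot> \<epsilon> K" using xz[OF hx] by simp
    then obtain h where h: "\<guillemotleft>h : ob B \<rightarrow> ob X\<guillemotright>" "h \<odot> p = ?x"
      using factor[of X ?x] hhomD(4)[OF hx] hhom_cmap[OF hx] by auto
    have hh: "hhom B X h" by (rule hhom_factor_epi[OF p hx h]) simp_all
    show "\<exists>!t. t \<in> Hom (Hopf_coc M) B X \<and> t \<cdot> raw p = x"
    proof (rule ex1I[of _ "raw h"])
      have "raw (h \<odot> p) = x" unfolding h(2) by simp
      then show "raw h \<in> Hom (Hopf_coc M) B X \<and> raw h \<cdot> raw p = x"
        using hh h(1) by (simp add: Hom_Hopf_coc_raw raw_comp)
      fix t assume t: "t \<in> Hom (Hopf_coc M) B X \<and> t \<cdot> raw p = x"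
      then have ht: "hhom B X (Arr (ob B) (ob X) t)" by (simp add: Hom_Hopf_coc)
      have "Arr (ob B) (ob X) t \<odot> p = h \<odot> p"
        unfolding h(2) using t hhomD(1)[OF ht] by (subst arrow_eq_iff) (simp_all add: raw_comp)
      then have "Arr (ob B) (ob X) t = h"
        by (rule epiD[OF p(2)]) (use hhomD(1)[OF ht] h in simp_all)
      then show "t = raw h" by auto
    qed
  qed
  then have "cokernel (Hopf_coc M) K A (raw k) B (raw p)"
    unfolding cokernel_def by (auto simp: zero_arrow_Hopf_coc)
  then show ?thesis
    unfolding is_cokernel_def using k(1) by (intro bexI[of _ K] bexI[of _ "raw k"]) (simp_all add: Obj_Hopf_coc Hom_Hopf_coc_raw)
qed

lemma is_cokernel_imp_regular_epi:
  assumes "is_cokernel (Hopf_coc M) A B f" "hopf A"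
  shows "regular_epi (Hopf_coc M) A B f"
proof -
  obtain K k z where K: "K \<in> Obj (Hopf_coc M)" "k \<in> Hom (Hopf_coc M) K A"
    and c: "coequalizer (Hopf_coc M) K A k z B f"
    using assms(1) by (auto simp: is_cokernel_def cokernel_def)
  moreover have "z \<in> Hom (Hopf_coc M) K A" using c by (simp add: coequalizer_def)
  ultimately show ?thesis unfolding regular_epi_def by blast
qed

text \<open>Let f = i e be the image factorization of a coequalizer of u and v. As i is monic, e
  also coequalizes u and v, so e = t f for some t. Then i t f = f, and uniqueness in the coequalizer
  property gives i t = 1; so i is a split epimorphism and f = i e is epic.\<close>

lemma regular_epi_imp_epi:
  fixes A B :: "('o, 'm) hopf_data"
  assumes q: "regular_epi (Hopf_coc M) A B (raw f)" and f: "hhom A B f" and [simp]: "hopf A" "hopf B"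
  shows "epi f"
proof -
  note [simp] = hhomD(1-3)[OF f]
  obtain X u v where X: "X \<in> Obj (Hopf_coc M)" and uv: "u \<in> Hom (Hopf_coc M) X A" "v \<in> Hom (Hopf_coc M) X A"
    and fuv: "raw f \<cdot> u = raw f \<cdot> v"
    and lift: "\<And>Y x. \<lbrakk>Y \<in> Obj (Hopf_coc M); x \<in> Hom (Hopf_coc M) A Y; x \<cdot> u = x \<cdot> v\<rbrakk>
        \<Longrightarrow> \<exists>!t. t \<in> Hom (Hopf_coc M) B Y \<and> t \<cdot> raw f = x"
    using q by (auto simp: regular_epi_def coequalizer_def)
  have [simp]: "hopf X" using X by (simp add: Obj_Hopf_coc)
  let ?u = "Arr (ob X) (ob A) u" and ?v = "Arr (ob X) (ob A) v"
  have hu: "hhom X A ?u" and hv: "hhom X A ?v" using uv by (simp_all add: Hom_Hopf_coc)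
  note [simp] = hhomD(1)[OF hu, unfolded valid_Arr] hhomD(1)[OF hv, unfolded valid_Arr]
  obtain I :: "('o, 'm) hopf_data" and e i where [simp]: "hopf I" and e: "hhom A I e" "epi e"
    and i: "hhom I B i" "mono i" and ie: "i \<odot> e = f"
    using hopf_image[OF f assms(3,4)] by metis
  note [simp] = hhomD(1-3)[OF e(1)] hhomD(1-3)[OF i(1)]
  have "raw (f \<odot> ?u) = raw (f \<odot> ?v)"
    using fuv by (subst (1 2) raw_comp) simp_all
  then have fe: "f \<odot> ?u = f \<odot> ?v"
    by (subst arrow_eq_iff) simp_all
  have "i \<odot> e \<odot> ?u = i \<odot> e \<odot> ?v"
    using comp_reassoc[OF ie, of ?u] comp_reassoc[OF ie, of ?v] fe by simp
  then have "e \<odot> ?u = e \<odot> ?v"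
    by (rule monoD[OF i(2)]) simp_all
  then have "raw (e \<odot> ?u) = raw (e \<odot> ?v)" by simp
  then have "raw e \<cdot> u = raw e \<cdot> v"
    by (subst (asm) (1 2) raw_comp) simp_all
  then obtain t where t: "t \<in> Hom (Hopf_coc M) B I" "t \<cdot> raw f = raw e"
    using lift[of I "raw e"] e(1) by (auto simp: Obj_Hopf_coc Hom_Hopf_coc_raw)
  let ?t = "Arr (ob B) (ob I) t"
  have ht: "hhom B I ?t" using t(1) by (simp add: Hom_Hopf_coc)
  note [simp] = hhomD(1)[OF ht, unfolded valid_Arr]
  have "raw (?t \<odot> f) = raw e" using t(2) by (subst raw_comp) simp_all
  then have tf: "?t \<odot> f = e" by (subst arrow_eq_iff) simp_all
  have itf: "(i \<odot> ?t) \<odot> f = f" by (simp add: tf ie)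
  have "\<exists>!s. s \<in> Hom (Hopf_coc M) B B \<and> s \<cdot> raw f = raw f"
    using f fuv by (intro lift) (simp_all add: Obj_Hopf_coc Hom_Hopf_coc_raw)
  moreover have "raw (i \<odot> ?t) \<in> Hom (Hopf_coc M) B B" "raw (ide (ob B)) \<in> Hom (Hopf_coc M) B B"
    using hhom_comp[OF ht i(1)] by (simp_all only: Hom_Hopf_coc_raw hhom_ide assms \<open>hopf I\<close>)
  moreover have "raw (i \<odot> ?t) \<cdot> raw f = raw ((i \<odot> ?t) \<odot> f)" "raw (ide (ob B)) \<cdot> raw f = raw (ide (ob B) \<odot> f)"
    by (rule raw_comp[symmetric]; simp)+
  ultimately have "raw (i \<odot> ?t) = raw (ide (ob B))"
    unfolding itf by (simp del: Hopf_coc_simps) metis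
  then have "i \<odot> ?t = ide (ob B)" by (subst arrow_eq_iff) simp_all
  then have "epi i" using epi_cancel[of i ?t] by simp
  then have "epi (i \<odot> e)" using e(2) by (rule epi_comp) simp
  then show ?thesis unfolding ie .
qed

text \<open>With f = i e the image factorization, f does not distinguish the Hopf kernel k of e from
  the trivial morphism, so k is trivial. Hence the identity of \<open>A\<close> meets the condition
  for factoring through e, which makes e a split monomorphism.\<close>

lemma monic_Hopf_coc_imp_mono:
  fixes A B :: "('o, 'm) hopf_data"
  assumes fcc: "faithful_coflatness_condition M" and m: "monic (Hopf_coc M) A B (raw f)"
    and f: "hhom A B f" and [simp]: "hopf A" "hopf B"
  shows "mono f"
proof -
  note [simp] = hhomD(1-3)[OF f]
  obtain I :: "('o, 'm) hopf_data" and e i where [simp]: "hopf I" and e: "hhom A I e" "epi e"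
    and i: "hhom I B i" "mono i" and ie: "i \<odot> e = f"
    using hopf_image[OF f assms(4,5)] by metis
  note [simp] = hhomD(1-3)[OF e(1)] hhomD(1-3)[OF i(1)]
  obtain K :: "('o, 'm) hopf_data" and k where [simp]: "hopf K" and k: "hhom K A k" "e \<odot> k = un I \<odot> \<epsilon> K"
    and factor: "\<And>(X :: ('o, 'm) hopf_data) x. \<lbrakk>hopf X; cmap A X x; x \<odot> mm A = mm X \<odot> (x \<boxtimes> x); x \<odot> k = un X \<odot> \<epsilon> K\<rbrakk>
       \<Longrightarrow> \<exists>h. \<guillemotleft>h : ob I \<rightarrow> ob X\<guillemotright> \<and> h \<odot> e = x"
    by (rule hopf_epi_is_cokernel[OF fcc e assms(4) \<open>hopf I\<close>]) blast
  note [simp] = hhomD(1-3)[OF k(1)]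
  let ?z = "un A \<odot> \<epsilon> K"
  have z: "hhom K A ?z" by simp
  have "e \<odot> ?z = e \<odot> k"
    using comp_reassoc[OF hhomD(5)[OF e(1)], of "\<epsilon> K"] k(2) by simp
  then have fz: "f \<odot> ?z = f \<odot> k" unfolding ie[symmetric] by simp
  have "raw f \<cdot> raw k = raw f \<cdot> raw ?z"
    using arg_cong[OF fz, of raw] by (subst (1 2) raw_comp[symmetric]) simp_all
  moreover have "raw k \<in> Hom (Hopf_coc M) K A" "raw ?z \<in> Hom (Hopf_coc M) K A"
    using k(1) z by (simp_all add: Hom_Hopf_coc_raw)
  ultimately have "raw k = raw ?z"
    using m unfolding monic_def Hopf_coc_simps by (metis Obj_Hopf_coc \<open>hopf K\<close>)
  then have "k = ?z" by (subst arrow_eq_iff) simp_all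
  then obtain h where h: "valid h" "dom h = ob I" "cod h = ob A" "h \<odot> e = ide (ob A)"
    using factor[of A "ide (ob A)"] by auto
  then have "mono e" using mono_cancel[of h e] by simp
  then have "mono (i \<odot> e)" using i(2) by (intro mono_comp) simp_all
  then show ?thesis unfolding ie .
qed

lemma mono_imp_monic_Hopf_coc:
  fixes A B :: "('o, 'm) hopf_data"
  assumes m: "mono f" and f: "hhom A B f" and [simp]: "hopf A" "hopf B"
  shows "monic (Hopf_coc M) A B (raw f)"
  unfolding monic_def Hopf_coc_simps
proof (intro conjI ballI impI)
  note [simp] = hhomD(1-3)[OF f]
  show "raw f \<in> Hom (Hopf_coc M) A B" using f by (simp add: Hom_Hopf_coc_raw)
  fix X g h assume X: "X \<in> Obj (Hopf_coc M)" and gh: "g \<in> Hom (Hopf_coc M) X A" "h \<in> Hom (Hopf_coc M) X A"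
    and e: "raw f \<cdot> g = raw f \<cdot> h"
  have [simp]: "hopf X" using X by (simp add: Obj_Hopf_coc)
  have "hhom X A (Arr (ob X) (ob A) g)" "hhom X A (Arr (ob X) (ob A) h)" using gh by (simp_all add: Hom_Hopf_coc)
  note [simp] = this[THEN hhomD(1), unfolded valid_Arr]
  have "Arr (ob X) (ob A) g = Arr (ob X) (ob A) h"
  proof (rule monoD[OF m])
    show "f \<odot> Arr (ob X) (ob A) g = f \<odot> Arr (ob X) (ob A) h"
      using e by (subst arrow_eq_iff) (simp_all add: raw_comp)
  qed simp_all
  then show "g = h" by simp
qed

end

theorem corollary7p10:
  fixes M :: "('o, 'm) asm_cat"
  assumes "abelian_symmetric_monoidal_category M"
    and "faithful_coflatness_condition M"
  shows "(\<forall>A\<in>Obj (Hopf_coc M). \<forall>B\<in>Obj (Hopf_coc M). \<forall>f\<in>Hom (Hopf_coc M) A B.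
            (regular_epi (Hopf_coc M) A B f \<longleftrightarrow> is_cokernel (Hopf_coc M) A B f) \<and>
            (regular_epi (Hopf_coc M) A B f \<longleftrightarrow> epic M (ob A) (ob B) f)) \<and>
         (\<forall>A\<in>Obj (Hopf_coc M). \<forall>B\<in>Obj (Hopf_coc M). \<forall>f\<in>Hom (Hopf_coc M) A B.
            monic (Hopf_coc M) A B f \<longleftrightarrow> monic M (ob A) (ob B) f)"
proof -
  interpret abelian_symmetric_monoidal_category M by (rule assms(1))
  note fcc = assms(2)
  {
    fix A B f assume A: "A \<in> Obj (Hopf_coc M)" and B: "B \<in> Obj (Hopf_coc M)" and f: "f \<in> Hom (Hopf_coc M) A B"
    have h [simp]: "hopf A" "hopf B" using A B by (simp_all add: Obj_Hopf_coc)
    let ?f = "Arr (ob A) (ob B) f"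
    have hf: "hhom A B ?f" using f by (simp add: Hom_Hopf_coc)
    have r: "raw ?f = f" by simp
    have "ob A \<in> Obj M" "ob B \<in> Obj M" by simp_all
    then have iff: "epic M (ob A) (ob B) f \<longleftrightarrow> epi ?f" "monic M (ob A) (ob B) f \<longleftrightarrow> mono ?f"
      by (simp_all add: epic_iff monic_iff)
    have "epi ?f \<Longrightarrow> is_cokernel (Hopf_coc M) A B f"
      using is_cokernel_Hopf_coc[OF fcc hf _ h] unfolding r .
    moreover have "is_cokernel (Hopf_coc M) A B f \<Longrightarrow> regular_epi (Hopf_coc M) A B f"
      by (rule is_cokernel_imp_regular_epi) simp_all
    moreover have "regular_epi (Hopf_coc M) A B f \<Longrightarrow> epi ?f"
      using regular_epi_imp_epi[OF _ hf h] unfolding r .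
    moreover have "monic (Hopf_coc M) A B f \<longleftrightarrow> mono ?f"
      using monic_Hopf_coc_imp_mono[OF fcc _ hf h] mono_imp_monic_Hopf_coc[OF _ hf h] unfolding r by blast
    ultimately have "(regular_epi (Hopf_coc M) A B f \<longleftrightarrow> is_cokernel (Hopf_coc M) A B f) \<and>
        (regular_epi (Hopf_coc M) A B f \<longleftrightarrow> epic M (ob A) (ob B) f) \<and>
        (monic (Hopf_coc M) A B f \<longleftrightarrow> monic M (ob A) (ob B) f)"
      unfolding iff by blast
  }
  then show ?thesis by blast
qed

end
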